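(* Let $S_0\in\Gamma_0$ be a monic even super-pseudodifferential operator independent of the time variables, let $U_M$ be the time evolution operator of the maximal SKP hierarchy, and let $S=S(t^\pm)=1+\sum_{j\ge1}s_{-j}D^{-j}\in\widehat\Gamma_0$ satisfy the Grassmann equation $$\big(S(t^\pm)\,U_M(t^\pm)\,S_0^{-1}\big)_-=0 .$$ Then $S$ satisfies the following system (the maximal SKP hierarchy), for all integers $n\ge 0$ in the first two equations and all $n\ge1$ in the last two: $$D^+_{2n+1}S=-\big(S\,\partial_\xi\partial_x^{\,n}S^{-1}\big)_-S,\qquad D^-_{2n+1}S=-\big(S\,\xi\,\partial_x^{\,n+1}S^{-1}\big)_-S,$$ $$D^+_{2n}S=-\big(S\,\partial_\xi\xi\,\partial_x^{\,n}S^{-1}\big)_-S,\qquad D^-_{2n}S=-\big(S\,\xi\partial_\xi\,\partial_x^{\,n}S^{-1}\big)_-S,$$ where $D_n^\pm$ act on the coefficients of $S$ and are the differential operators in the time variables $$D^\pm_{2n+1}=\partial_{t^\pm_{2n+1}}-\tfrac12\sum_{m\ge0}t^\mp_{2m+1}\big(\partial_{t^+_{2(n+m+1)}}+\partial_{t^-_{2(n+m+1)}}\big),$$ $$D^\pm_{2n}=\partial_{t^\pm_{2n}}\pm\sum_{m\ge0}\Big(t^+_{2m+1}\partial_{t^+_{2(n+m)+1}}-t^-_{2m+1}\partial_{t^-_{2(n+m)+1}}\Big).$$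
   Context: Operators. Let $\mathcal A$ be a supercommutative $\mathbf C$-superalgebra and $R=\mathcal A\otimes\mathbf C[[x,\xi]]$ with $x$ even, $\xi$ odd, $\xi^2=0$; $D=\partial_\xi+\xi\partial_x$, so $D^2=\partial_x$, $\partial_\xi=D-\xi D^2$, $D^{-1}=\partial_x^{-1}D$. Super-pseudodifferential operators are series $P=\sum_{j<\infty}p_jD^j$, $p_j\in R$ (finitely many positive powers, arbitrarily many negative ones), multiplied via $D^mf=\sum_{r\ge0}{m\brack r}(-1)^{|f|(m-r)}f^{[r]}D^{m-r}$ for homogeneous $f\in R$ and $m\in\mathbf Z$, where $|f|$ is the parity, $f^{[r]}=D^r(f)$, and ${m\brack r}=0$ if $r(m-r)$ is odd, ${m\brack r}=\binom{\lfloor m/2\rfloor}{\lfloor r/2\rfloor}$ otherwise. They form the algebra $\mathcal E$. $\Gamma_0\subset\mathcal E$ is the group of operators $1+\sum_{j\ge1}s_{-j}D^{-j}$ with $s_{-j}$ of parity $j$ mod 2. Time variables. $\{t^+_n\}_{n\ge1}$ and $\{t^-_n\}_{n\ge1}$: $t^\pm_{2n}$ are even, $t^\pm_{2n+1}$ are odd (supercommuting with everything). Give $t_n^\pm$ weight $n$. The time-dependent operator algebra $\widehat{\mathcal E}$ consists of formal sums $P=\sum_{n\in\mathbf Z}p_nD^n$ with $p_n\in R[[t^\pm]]$ such that for some constant $C$ every monomial in the $t$'s occurring in $p_n$ has weight $\ge n-C$, for all $n$; the multiplication is by the same rule. For $P=\sum_n p_nD^n$ put $P_-=\sum_{n<0}p_nD^n$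 and $P_+=P-P_-$. $\widehat\Gamma_0$ is the set of operators $1+\sum_{j\ge1}s_{-j}D^{-j}$ with $s_{-j}\in R[[t^\pm]]$ of parity $j$ mod 2. Time evolution operator: $U_M=e^{H_{(1)}}e^{H_{(0)}}$ with $$H_{(1)}=\sum_{n\ge0}\big(t^+_{2n+1}\partial_\xi\partial_x^n+t^-_{2n+1}\xi\partial_x^{n+1}\big),\qquad H_{(0)}=\sum_{n\ge1}\big(t^+_{2n}\,\partial_\xi\xi\,\partial_x^{n}+t^-_{2n}\,\xi\partial_\xi\,\partial_x^{n}\big),$$ where $\partial_\xi\xi$ and $\xi\partial_\xi$ are compositions of operators. *)

theory Defs
  imports
    Complex_Main
    "HOL-Library.Multiset"
    "HOL-Library.Function_Algebras"
    "HOL-Library.Groups_Big_Fun"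
    "HOL-Algebra.Ring"
begin

section \<open>Supercommutative complex superalgebras\<close>

text \<open>The zero algebra is allowed, hence the sort \<open>{ring, monoid_mult}\<close> instead of \<open>ring_1\<close>.\<close>

class supercommutative_superalgebra = ring + monoid_mult +
  fixes scaleC :: "complex \<Rightarrow> 'a \<Rightarrow> 'a" (infixr "*\<^sub>C" 75)
    and even_part :: "'a set"
    and odd_part :: "'a set"
  assumes scaleC_add_right: "c *\<^sub>C (a + b) = c *\<^sub>C a + c *\<^sub>C b"
    and scaleC_add_left: "(c + d) *\<^sub>C a = c *\<^sub>C a + d *\<^sub>C a"
    and scaleC_scaleC: "c *\<^sub>C (d *\<^sub>C a) = (c * d) *\<^sub>C a"
    and scaleC_one: "1 *\<^sub>C a = a"
    and scaleC_mult_left: "(c *\<^sub>C a) * b = c *\<^sub>C (a * b)"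
    and scaleC_mult_right: "a * (c *\<^sub>C b) = c *\<^sub>C (a * b)"
    and even_add: "a \<in> even_part \<Longrightarrow> b \<in> even_part \<Longrightarrow> a + b \<in> even_part"
    and even_scaleC: "a \<in> even_part \<Longrightarrow> c *\<^sub>C a \<in> even_part"
    and odd_add: "a \<in> odd_part \<Longrightarrow> b \<in> odd_part \<Longrightarrow> a + b \<in> odd_part"
    and odd_scaleC: "a \<in> odd_part \<Longrightarrow> c *\<^sub>C a \<in> odd_part"
    and even_odd_decomp: "\<exists>b\<in>even_part. \<exists>c\<in>odd_part. a = b + c"
    and even_odd_inter: "even_part \<inter> odd_part = {0}"
    and one_even: "1 \<in> even_part"
    and even_mult_even: "a \<in> even_part \<Longrightarrow> b \<in> even_part \<Longrightarrow> a * b \<in> even_part"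
    and even_mult_odd: "a \<in> even_part \<Longrightarrow> b \<in> odd_part \<Longrightarrow> a * b \<in> odd_part"
    and odd_mult_even: "a \<in> odd_part \<Longrightarrow> b \<in> even_part \<Longrightarrow> a * b \<in> odd_part"
    and odd_mult_odd: "a \<in> odd_part \<Longrightarrow> b \<in> odd_part \<Longrightarrow> a * b \<in> even_part"
    and even_commute: "a \<in> even_part \<Longrightarrow> a * b = b * a"
    and odd_anticommute: "a \<in> odd_part \<Longrightarrow> b \<in> odd_part \<Longrightarrow> a * b = - (b * a)"

definition graded_part :: "nat \<Rightarrow> 'a::supercommutative_superalgebra set" where
  "graded_part p = (if even p then even_part else odd_part)"

text \<open>The linear map with \<open>a \<mapsto> (-1)\<^bsup>|a|\<^esup> a\<close> on homogeneous elements.\<close>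

definition parity_inv :: "'a::supercommutative_superalgebra \<Rightarrow> 'a" where
  "parity_inv a = (THE s. \<exists>b\<in>even_part. \<exists>c\<in>odd_part. a = b + c \<and> s = b - c)"


section \<open>Formal series in the variables \<open>x, \<xi>, t\<^sup>\<plusminus>\<^sub>n\<close>\<close>

datatype sgn2 = Plus | Minus

fun opp :: "sgn2 \<Rightarrow> sgn2" where
  "opp Plus = Minus"
| "opp Minus = Plus"

text \<open>\<open>T Plus n\<close> and \<open>T Minus n\<close> stand for \<open>t\<^sup>+\<^sub>n\<close> and \<open>t\<^sup>-\<^sub>n\<close>; the junk case \<open>n = 0\<close> is
  excluded by \<open>valid\<close> below.\<close>

datatype svar = X | Xi | T sgn2 nat

fun odd_var :: "svar \<Rightarrow> bool" where
  "odd_var X = False"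
| "odd_var Xi = True"
| "odd_var (T s n) = odd n"

fun weight_var :: "svar \<Rightarrow> nat" where
  "weight_var X = 0"
| "weight_var Xi = 0"
| "weight_var (T s n) = n"

text \<open>An injective ranking that fixes the order in which the odd variables of a monomial are
  multiplied; \<open>\<xi>\<close> comes before all times.\<close>

fun rank_var :: "svar \<Rightarrow> nat" where
  "rank_var X = 0"
| "rank_var Xi = 1"
| "rank_var (T Plus n) = 2 * n + 2"
| "rank_var (T Minus n) = 2 * n + 3"

type_synonym smon = "svar multiset"

definition valid :: "smon \<Rightarrow> bool" where
  "valid m \<longleftrightarrow> (\<forall>v\<in>#m. (\<forall>s. v \<noteq> T s 0) \<and> (odd_var v \<longrightarrow> count m v = 1))"

definition odd_count :: "smon \<Rightarrow> nat" where
  "odd_count m = size (filter_mset odd_var m)"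

definition weight :: "smon \<Rightarrow> nat" where
  "weight m = (\<Sum>v\<in>#m. weight_var v)"

definition inversions :: "smon \<Rightarrow> smon \<Rightarrow> nat" where
  "inversions m n = (\<Sum>u\<in>#m. size {#v \<in># n. odd_var u \<and> odd_var v \<and> rank_var v < rank_var u#})"

text \<open>The product of the ordered monomials \<open>m\<close> and \<open>n\<close> is \<open>mon_sign m n\<close> times the ordered
  monomial \<open>m + n\<close>.\<close>

definition mon_sign :: "smon \<Rightarrow> smon \<Rightarrow> complex" where
  "mon_sign m n = (if valid (m + n) then (-1) ^ inversions m n else 0)"

text \<open>A function \<open>f\<close> represents the formal series \<open>\<Sum>m. f m \<cdot> m\<close> with the coefficients in \<open>\<A>\<close>
  to the left of the ordered monomials. It must vanish on invalid monomials; this is part of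
  the carrier sets \<open>coeffR\<close> and \<open>coeffRt\<close> below.\<close>

type_synonym 'a sser = "smon \<Rightarrow> 'a"

definition sser_one :: "'a::supercommutative_superalgebra sser" where
  "sser_one = (\<lambda>m. if m = {#} then 1 else 0)"

definition sser_var :: "svar \<Rightarrow> 'a::supercommutative_superalgebra sser" where
  "sser_var v = (\<lambda>m. if m = {#v#} then 1 else 0)"

definition sser_scale :: "complex \<Rightarrow> 'a::supercommutative_superalgebra sser \<Rightarrow> 'a sser" where
  "sser_scale c f = (\<lambda>m. c *\<^sub>C f m)"

text \<open>\<open>(a \<cdot> m) (b \<cdot> n) = (-1)\<^bsup>|m||b|\<^esup> a b \<cdot> m n\<close> for homogeneous \<open>b\<close>.\<close>

definition sser_mult ::
  "'a::supercommutative_superalgebra sser \<Rightarrow> 'a sser \<Rightarrow> 'a sser" (infixl "\<star>" 70) where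
  "f \<star> g = (\<lambda>k. \<Sum>m | m \<subseteq># k.
      mon_sign m (k - m) *\<^sub>C (f m * (parity_inv ^^ odd_count m) (g (k - m))))"

definition sser_parity_inv :: "'a::supercommutative_superalgebra sser \<Rightarrow> 'a sser" where
  "sser_parity_inv f = (\<lambda>m. (-1) ^ odd_count m *\<^sub>C parity_inv (f m))"

definition sser_homogeneous :: "nat \<Rightarrow> 'a::supercommutative_superalgebra sser \<Rightarrow> bool" where
  "sser_homogeneous p f \<longleftrightarrow> (\<forall>m. f m \<in> graded_part (p + odd_count m))"

text \<open>Formal infinite sums, taken coefficientwise (each coefficient of the sums below receives
  only finitely many nonzero contributions).\<close>

definition sser_sum :: "('i \<Rightarrow> 'a::supercommutative_superalgebra sser) \<Rightarrow> 'a sser" where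
  "sser_sum F = (\<lambda>m. Sum_any (\<lambda>i. F i m))"

text \<open>The (left) partial derivative with respect to the even or odd variable \<open>v\<close>. An odd \<open>v\<close> is
  first moved past the coefficient and past the smaller odd variables.\<close>

definition pd :: "svar \<Rightarrow> 'a::supercommutative_superalgebra sser \<Rightarrow> 'a sser" where
  "pd v f = (\<lambda>m. (of_nat (count m v + 1) * (-1) ^ inversions {#v#} m) *\<^sub>C
      (if odd_var v then parity_inv (f (add_mset v m)) else f (add_mset v m)))"

definition superD :: "'a::supercommutative_superalgebra sser \<Rightarrow> 'a sser" where
  "superD f = pd Xi f + sser_var Xi \<star> pd X f"


section \<open>The coefficient algebras \<open>R\<close> and \<open>R[[t\<^sup>\<plusminus>]]\<close>\<close>

definition C_x_xi :: "(smon \<Rightarrow> complex) set" where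
  "C_x_xi = {\<phi>. \<forall>m. \<phi> m \<noteq> 0 \<longrightarrow> valid m \<and> set_mset m \<subseteq> {X, Xi}}"

text \<open>The algebraic tensor product \<open>R = \<A> \<otimes> \<complex>[[x,\<xi>]]\<close>, as the set of all finite sums
  \<open>\<Sum>i. a\<^sub>i \<otimes> \<phi>\<^sub>i\<close>. (The canonical map from the tensor product to the formal series in \<open>x, \<xi>\<close> over
  \<open>\<A>\<close> is injective because \<open>\<complex>\<close> is a field; it is not surjective when \<open>\<A>\<close> has infinite
  dimension.)\<close>

definition coeffR :: "'a::supercommutative_superalgebra sser set" where
  "coeffR = {f. \<exists>(k::nat) a \<phi>. (\<forall>i<k. \<phi> i \<in> C_x_xi) \<and> f = (\<lambda>m. \<Sum>i<k. \<phi> i m *\<^sub>C a i)}"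

text \<open>The coefficient in \<open>\<A>[[x,\<xi>]]\<close> of the \<open>t\<close>-monomial \<open>\<mu>\<close>.\<close>

definition t_coeff :: "smon \<Rightarrow> 'a::supercommutative_superalgebra sser \<Rightarrow> 'a sser" where
  "t_coeff \<mu> f = (\<lambda>\<rho>. if set_mset \<rho> \<subseteq> {X, Xi} then f (\<rho> + \<mu>) else 0)"

definition coeffRt :: "'a::supercommutative_superalgebra sser set" where
  "coeffRt = {f. (\<forall>m. f m \<noteq> 0 \<longrightarrow> valid m) \<and>
      (\<forall>\<mu>. X \<notin># \<mu> \<and> Xi \<notin># \<mu> \<longrightarrow> t_coeff \<mu> f \<in> coeffR)}"


section \<open>Super-pseudodifferential operators\<close>

text \<open>\<open>P\<close> represents \<open>\<Sum>n. P n D\<^sup>n\<close>.\<close>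

type_synonym 'a sop = "int \<Rightarrow> 'a sser"

definition sbinom :: "int \<Rightarrow> nat \<Rightarrow> complex" where
  "sbinom m r = (if odd (int r * (m - int r)) then 0
     else of_int (m div 2) gchoose (r div 2))"

text \<open>\<open>D\<^sup>m f = \<Sum>r. [m r] (-1)\<^bsup>|f|(m-r)\<^esup> f\<^bsup>[r]\<^esup> D\<^bsup>m-r\<^esup>\<close>, extended linearly to inhomogeneous \<open>f\<close>; the
  summand \<open>(m, r)\<close> below is the contribution of \<open>P m D\<^sup>m \<cdot> Q n D\<^sup>n\<close> with \<open>m - r + n = k\<close>.\<close>

definition sop_mult :: "'a::supercommutative_superalgebra sop \<Rightarrow> 'a sop \<Rightarrow> 'a sop" where
  "sop_mult P Q = (\<lambda>k. sser_sum (\<lambda>(m::int, r::nat).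
      sser_scale (sbinom m r)
        (P m \<star> (superD ^^ r)
          ((if even (m - int r) then id else sser_parity_inv) (Q (k - m + int r))))))"

definition D_pow :: "int \<Rightarrow> 'a::supercommutative_superalgebra sop" where
  "D_pow j = (\<lambda>n. if n = j then sser_one else 0)"

definition sop_coeff :: "'a::supercommutative_superalgebra sser \<Rightarrow> 'a sop" where
  "sop_coeff f = (\<lambda>n. if n = 0 then f else 0)"

definition Ehat :: "'a::supercommutative_superalgebra sop ring" where
  "Ehat = \<lparr>
     carrier = {P. (\<forall>n. P n \<in> coeffRt) \<and>
       (\<exists>C::int. \<forall>n m. P n m \<noteq> 0 \<longrightarrow> int (weight m) \<ge> n - C)},
     mult = sop_mult,
     one = D_pow 0,
     zero = 0,
     add = (+)\<rparr>"

definition monic_even :: "'a::supercommutative_superalgebra sser set \<Rightarrow> 'a sop set" where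
  "monic_even B = {S. S 0 = sser_one \<and> (\<forall>n>0. S n = 0) \<and>
     (\<forall>j\<ge>1. S (- int j) \<in> B \<and> sser_homogeneous j (S (- int j)))}"

definition Gamma0 :: "'a::supercommutative_superalgebra sop set" where
  "Gamma0 = monic_even coeffR"

definition Gamma0_hat :: "'a::supercommutative_superalgebra sop set" where
  "Gamma0_hat = monic_even coeffRt"

definition neg_part :: "'a::supercommutative_superalgebra sop \<Rightarrow> 'a sop" where
  "neg_part P = (\<lambda>n. if n < 0 then P n else 0)"

definition sop_scale :: "complex \<Rightarrow> 'a::supercommutative_superalgebra sop \<Rightarrow> 'a sop" where
  "sop_scale c P = (\<lambda>n. sser_scale c (P n))"

definition sop_sum :: "('i \<Rightarrow> 'a::supercommutative_superalgebra sop) \<Rightarrow> 'a sop" where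
  "sop_sum F = (\<lambda>n. sser_sum (\<lambda>i. F i n))"

definition sop_exp :: "'a::supercommutative_superalgebra sop \<Rightarrow> 'a sop" where
  "sop_exp H = sop_sum (\<lambda>k::nat. sop_scale (1 / fact k) (H [^]\<^bsub>Ehat\<^esub> k))"

definition xi_op :: "'a::supercommutative_superalgebra sop" where
  "xi_op = sop_coeff (sser_var Xi)"

definition dx_op :: "'a::supercommutative_superalgebra sop" where
  "dx_op = D_pow 2"

definition dxi_op :: "'a::supercommutative_superalgebra sop" where
  "dxi_op = D_pow 1 - xi_op \<otimes>\<^bsub>Ehat\<^esub> D_pow 2"

definition t_op :: "sgn2 \<Rightarrow> nat \<Rightarrow> 'a::supercommutative_superalgebra sop" where
  "t_op s n = sop_coeff (sser_var (T s n))"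


section \<open>The time evolution operator and the derivations \<open>D\<^sup>\<plusminus>\<^sub>n\<close>\<close>

definition H_odd :: "'a::supercommutative_superalgebra sop" where
  "H_odd = sop_sum (\<lambda>n::nat.
      t_op Plus (2*n+1) \<otimes>\<^bsub>Ehat\<^esub> (dxi_op \<otimes>\<^bsub>Ehat\<^esub> dx_op [^]\<^bsub>Ehat\<^esub> n)
    + t_op Minus (2*n+1) \<otimes>\<^bsub>Ehat\<^esub> (xi_op \<otimes>\<^bsub>Ehat\<^esub> dx_op [^]\<^bsub>Ehat\<^esub> (n+1)))"

definition H_even :: "'a::supercommutative_superalgebra sop" where
  "H_even = sop_sum (\<lambda>n::nat. if n \<ge> 1 then
      t_op Plus (2*n) \<otimes>\<^bsub>Ehat\<^esub> (dxi_op \<otimes>\<^bsub>Ehat\<^esub> xi_op \<otimes>\<^bsub>Ehat\<^esub> dx_op [^]\<^bsub>Ehat\<^esub> n)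
    + t_op Minus (2*n) \<otimes>\<^bsub>Ehat\<^esub> (xi_op \<otimes>\<^bsub>Ehat\<^esub> dxi_op \<otimes>\<^bsub>Ehat\<^esub> dx_op [^]\<^bsub>Ehat\<^esub> n)
    else 0)"

definition U_M :: "'a::supercommutative_superalgebra sop" where
  "U_M = sop_exp H_odd \<otimes>\<^bsub>Ehat\<^esub> sop_exp H_even"

text \<open>\<open>tD_odd s n\<close> is \<open>D\<^sup>s\<^bsub>2n+1\<^esub>\<close>, and \<open>tD_even s n\<close> is \<open>D\<^sup>s\<^bsub>2n\<^esub>\<close>.\<close>

definition tD_odd :: "sgn2 \<Rightarrow> nat \<Rightarrow> 'a::supercommutative_superalgebra sser \<Rightarrow> 'a sser" where
  "tD_odd s n f = pd (T s (2*n+1)) f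
     - sser_scale (1/2) (sser_sum (\<lambda>m::nat. sser_var (T (opp s) (2*m+1)) \<star>
         (pd (T Plus (2*(n+m+1))) f + pd (T Minus (2*(n+m+1))) f)))"

definition tD_even :: "sgn2 \<Rightarrow> nat \<Rightarrow> 'a::supercommutative_superalgebra sser \<Rightarrow> 'a sser" where
  "tD_even s n f = pd (T s (2*n)) f
     + sser_scale (case s of Plus \<Rightarrow> 1 | Minus \<Rightarrow> -1) (sser_sum (\<lambda>m::nat.
           sser_var (T Plus (2*m+1)) \<star> pd (T Plus (2*(n+m)+1)) f
         - sser_var (T Minus (2*m+1)) \<star> pd (T Minus (2*(n+m)+1)) f))"

end

theory Submission
  imports Defs "HOL-Computational_Algebra.Formal_Power_Series"
begin

text \<open>The evolution operator satisfies the linear system \<open>D\<^sup>s\<^sub>n U = G U\<close>, where \<open>G\<close> is the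
  generator of the flow: with \<open>a\<^sub>n = \<partial>\<^sub>\<xi> \<partial>\<^sup>n\<close> and \<open>b\<^sub>n = \<xi> \<partial>\<^sup>n\<^sup>+\<^sup>1\<close> the commutators
  \<open>[a\<^sub>n, H\<^sub>1]\<close> and \<open>[b\<^sub>n, H\<^sub>1]\<close> are linear combinations of the elements
  \<open>t\<^sub>2\<^sub>m\<^sub>+\<^sub>1 \<partial>\<^sup>n\<^sup>+\<^sup>m\<^sup>+\<^sup>1\<close>, which commute with \<open>H\<^sub>1\<close>, and the correction terms in \<open>D\<^sup>s\<^sub>n\<close> cancel them.
  Put \<open>W = S U S\<^sub>0\<inverse>\<close>. Applying \<open>D\<^sup>s\<^sub>n\<close> gives \<open>(D\<^sup>s\<^sub>n S + S G) S\<inverse> W = D\<^sup>s\<^sub>n W\<close>, where \<open>W\<close> and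
  \<open>D\<^sup>s\<^sub>n W\<close> have no negative part and \<open>W = 1\<close> up to terms of positive weight. Hence the
  negative part of \<open>(D\<^sup>s\<^sub>n S + S G) S\<inverse>\<close> vanishes, and this is the hierarchy.

  All infinite sums are handled modulo the ideals of operators of weight at least \<open>w\<close>: modulo
  such an ideal the degree in \<open>D\<close> is bounded above, and products become finite sums.\<close>


subsection \<open>The parity involution\<close>

text \<open>In the statement operators are bare functions whose product is a \<open>Sum_any\<close>,
  meaningful only where supports are finite, and \<open>H_odd\<close> has unbounded degree in D. The
  proof therefore builds two genuine rings, \<open>ser\<close> for series and \<open>ops\<close> for
  operators, argues there algebraically and returns along the embedding \<open>raw\<close>. The type
  \<open>ops\<close> imposes only the weight bound; the finite-dimensionality hidden in
  \<open>coeffRt\<close> enters where the inverse of a monic operator has to be placed in the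
  carrier of \<open>Ehat\<close>.

  The factor 1/2 in the odd flows comes from the failure of a_n to commute with H_1: exp(u H_1) a
  exp(-u H_1) = a - u [a, H_1], and the mean over u from 0 to 1 is a - [a, H_1]/2. The correction in
  the even flows has another origin: their generator g commutes with H_0 but not with H_1, and the
  terms t d/dt act on H_1 exactly as the commutator [g, H_1], which brings g to the left of the
  whole product exp(H_1) exp(H_0).\<close>

interpretation scaleC: vector_space "scaleC :: complex \<Rightarrow> 'a \<Rightarrow> 'a::supercommutative_superalgebra"
  by unfold_locales (simp_all add: scaleC_add_right scaleC_add_left scaleC_scaleC scaleC_one)

lemma graded_part_minus: "a \<in> graded_part p \<Longrightarrow> - a \<in> graded_part p"
  using even_scaleC[of a "-1"] odd_scaleC[of a "-1"] by (auto simp: graded_part_def split: if_splits)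

lemma graded_part_diff: "a \<in> graded_part p \<Longrightarrow> b \<in> graded_part p \<Longrightarrow> a - b \<in> graded_part p"
  using graded_part_minus[of b p] even_add[of a "-b"] odd_add[of a "-b"]
  by (auto simp: graded_part_def split: if_splits)

lemma parity_inv_unique:
  assumes "b \<in> even_part" "c \<in> odd_part" "b' \<in> even_part" "c' \<in> odd_part" "b + c = b' + c'"
  shows "b = b' \<and> c = c'"
proof -
  have eq: "b - b' = c' - c" using assms(5) by (simp add: algebra_simps)
  have "b - b' \<in> even_part" using graded_part_diff[of b 0 b'] assms by (simp add: graded_part_def)
  moreover have "b - b' \<in> odd_part"
    unfolding eq using graded_part_diff[of c' 1 c] assms by (simp add: graded_part_def)
  ultimately have "b - b' \<in> {0}" using even_odd_inter by blast
  then show ?thesis using assms(5) by simp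
qed

lemma parity_inv_eq:
  assumes "b \<in> even_part" "c \<in> odd_part"
  shows "parity_inv (b + c) = b - c"
  unfolding parity_inv_def using assms parity_inv_unique by (intro the_equality) blast+

lemma parity_inv_add: "parity_inv (a + b) = parity_inv a + parity_inv b"
proof -
  obtain a0 a1 where a: "a0 \<in> even_part" "a1 \<in> odd_part" "a = a0 + a1" using even_odd_decomp by blast
  obtain b0 b1 where b: "b0 \<in> even_part" "b1 \<in> odd_part" "b = b0 + b1" using even_odd_decomp by blast
  have "a + b = (a0 + b0) + (a1 + b1)" using a b by simp
  then show ?thesis
    using a b parity_inv_eq even_add odd_add by (metis add_diff_add)
qed

lemma parity_inv_scaleC: "parity_inv (c *\<^sub>C a) = c *\<^sub>C parity_inv a"
proof -
  obtain a0 a1 where a: "a0 \<in> even_part" "a1 \<in> odd_part" "a = a0 + a1" using even_odd_decomp by blast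
  then have "parity_inv (c *\<^sub>C a0 + c *\<^sub>C a1) = c *\<^sub>C a0 - c *\<^sub>C a1"
    by (intro parity_inv_eq even_scaleC odd_scaleC)
  then show ?thesis using a by (simp add: parity_inv_eq scaleC_add_right scaleC.scale_right_diff_distrib)
qed

lemma parity_inv_even: "a \<in> even_part \<Longrightarrow> parity_inv a = a"
  using parity_inv_eq[of a 0] even_odd_inter by fastforce

lemma parity_inv_odd: "a \<in> odd_part \<Longrightarrow> parity_inv a = - a"
  using parity_inv_eq[of 0 a] even_odd_inter by fastforce

lemma parity_inv_mult: "parity_inv (a * b) = parity_inv a * parity_inv b"
proof -
  obtain a0 a1 where a: "a0 \<in> even_part" "a1 \<in> odd_part" "a = a0 + a1" using even_odd_decomp by blast
  obtain b0 b1 where b: "b0 \<in> even_part" "b1 \<in> odd_part" "b = b0 + b1" using even_odd_decomp by blast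
  have e: "a0 * b0 + a1 * b1 \<in> even_part" "a0 * b1 + a1 * b0 \<in> odd_part"
    using a b by (auto intro: even_add odd_add even_mult_even odd_mult_odd even_mult_odd odd_mult_even)
  have "a * b = (a0 * b0 + a1 * b1) + (a0 * b1 + a1 * b0)" using a b by (simp add: algebra_simps)
  then have "parity_inv (a * b) = (a0 * b0 + a1 * b1) - (a0 * b1 + a1 * b0)"
    using parity_inv_eq[OF e] by simp
  then show ?thesis using a b by (simp add: parity_inv_eq algebra_simps)
qed

lemma parity_inv_one [simp]: "parity_inv 1 = 1"
  by (simp add: parity_inv_even one_even)

lemma parity_inv_zero [simp]: "parity_inv 0 = 0"
  using parity_inv_scaleC[of 0 0] by simp

lemma parity_inv_minus: "parity_inv (- a) = - parity_inv a"
  using parity_inv_scaleC[of "-1" a] by simp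

lemma parity_inv_diff: "parity_inv (a - b) = parity_inv a - parity_inv b"
  using parity_inv_add[of a "-b"] by (simp add: parity_inv_minus)

lemma parity_inv_parity_inv [simp]: "parity_inv (parity_inv a) = a"
proof -
  obtain a0 a1 where a: "a0 \<in> even_part" "a1 \<in> odd_part" "a = a0 + a1" using even_odd_decomp by blast
  have "parity_inv (parity_inv a) = parity_inv a0 - parity_inv a1"
    using a by (simp only: parity_inv_eq parity_inv_diff)
  then show ?thesis
    using a by (simp only: parity_inv_even parity_inv_odd diff_minus_eq_add)
qed

lemma parity_inv_sum: "parity_inv (sum f A) = (\<Sum>x\<in>A. parity_inv (f x))"
  by (induction A rule: infinite_finite_induct) (auto simp: parity_inv_add)

lemma parity_inv_funpow: "(parity_inv ^^ n) = (if even n then id else parity_inv)"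
  by (induction n) (auto simp: fun_eq_iff)

lemma parity_inv_funpow_add: "(parity_inv ^^ n) (a + b) = (parity_inv ^^ n) a + (parity_inv ^^ n) b"
  and parity_inv_funpow_mult: "(parity_inv ^^ n) (a * b) = (parity_inv ^^ n) a * (parity_inv ^^ n) b"
  and parity_inv_funpow_scaleC: "(parity_inv ^^ n) (c *\<^sub>C a) = c *\<^sub>C (parity_inv ^^ n) a"
  and parity_inv_funpow_sum: "(parity_inv ^^ n) (sum f A) = (\<Sum>x\<in>A. (parity_inv ^^ n) (f x))"
  and parity_inv_funpow_zero: "(parity_inv ^^ n) 0 = 0"
  and parity_inv_funpow_one: "(parity_inv ^^ n) 1 = 1"
  by (simp_all add: parity_inv_funpow parity_inv_add parity_inv_mult parity_inv_scaleC parity_inv_sum)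


subsection \<open>Monomials and signs\<close>

lemma inversions_empty [simp]: "inversions {#} n = 0" "inversions m {#} = 0"
  by (simp_all add: inversions_def)

lemma inversions_add_left: "inversions (m + m') n = inversions m n + inversions m' n"
  by (simp add: inversions_def)

lemma inversions_add_right: "inversions m (n + n') = inversions m n + inversions m n'"
  by (simp add: inversions_def sum_mset.distrib)

lemma inversions_single:
  "inversions {#u#} {#v#} = of_bool (odd_var u \<and> odd_var v \<and> rank_var v < rank_var u)"
  by (simp add: inversions_def)

lemma inversions_even_var: "\<not> odd_var v \<Longrightarrow> inversions {#v#} m = 0" "\<not> odd_var v \<Longrightarrow> inversions m {#v#} = 0"
  by (simp_all add: inversions_def)

lemma rank_var_eq_iff: "rank_var u = rank_var v \<longleftrightarrow> u = v"
  by (cases u rule: rank_var.cases; cases v rule: rank_var.cases; simp; presburger?)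

text \<open>Each odd entry of \<open>m\<close> different from \<open>v\<close> lies on exactly one
  side of \<open>v\<close> in the ranking; copies of \<open>v\<close> lie on neither and are counted
  by \<open>count m v\<close>. When \<open>v\<close> is absent this gives the sign for moving
  \<open>v\<close> through \<open>m\<close>.\<close>

lemma inversions_swap:
  "odd_var v \<Longrightarrow> inversions {#v#} m + inversions m {#v#} + count m v = odd_count m"
proof (induction m)
  case (add u m)
  have "inversions {#v#} {#u#} + inversions {#u#} {#v#} + of_bool (u = v) = (of_bool (odd_var u) :: nat)"
    using add.prems rank_var_eq_iff[of u v] by (auto simp: inversions_single)
  then show ?case
    using add inversions_add_left[of "{#u#}" m "{#v#}"] inversions_add_right[of "{#v#}" "{#u#}" m]
    by (auto simp: odd_count_def)
qed (simp add: odd_count_def)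

lemma odd_count_add: "odd_count (m + n) = odd_count m + odd_count n"
  by (simp add: odd_count_def)

lemma odd_count_empty [simp]: "odd_count {#} = 0"
  by (simp add: odd_count_def)

lemma odd_count_single: "odd_count {#v#} = of_bool (odd_var v)"
  by (simp add: odd_count_def)

lemma weight_add: "weight (m + n) = weight m + weight n"
  by (simp add: weight_def)

lemma weight_single [simp]: "weight {#v#} = weight_var v"
  by (simp add: weight_def)

lemma valid_empty [simp]: "valid {#}"
  by (simp add: valid_def)

lemma valid_subset: "valid k \<Longrightarrow> m \<subseteq># k \<Longrightarrow> valid m"
  unfolding valid_def
  by (metis count_greater_zero_iff le_antisym mset_subset_eqD mset_subset_eq_count Suc_leI One_nat_def)

lemma valid_add: "valid (m + n) \<Longrightarrow> valid m" "valid (m + n) \<Longrightarrow> valid n"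
  by (auto elim!: valid_subset)

lemma valid_single: "valid {#v#} \<longleftrightarrow> (\<forall>s. v \<noteq> T s 0)"
  by (auto simp: valid_def)

lemma valid_count_le_1: "valid m \<Longrightarrow> odd_var v \<Longrightarrow> count m v \<le> 1"
  by (cases "v \<in># m") (auto simp: valid_def not_in_iff)

lemma finite_subset_mset: "finite {m. m \<subseteq># (k::'b multiset)}"
proof (induction k)
  case (add v k)
  have "{m. m \<subseteq># add_mset v k} \<subseteq> {m. m \<subseteq># k} \<union> add_mset v ` {m. m \<subseteq># k}"
  proof
    fix m assume "m \<in> {m. m \<subseteq># add_mset v k}"
    then have m: "m \<subseteq># add_mset v k" by simp
    show "m \<in> {m. m \<subseteq># k} \<union> add_mset v ` {m. m \<subseteq># k}"
    proof (cases "v \<in># m")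
      case True
      then obtain m' where "m = add_mset v m'" by (metis mset_add)
      then show ?thesis using m by auto
    next
      case False
      then show ?thesis using m by (metis UnI1 diff_single_trivial mem_Collect_eq subset_eq_diff_conv
            add_mset_add_single)
    qed
  qed
  then show ?case using add.IH by (meson finite_UnI finite_imageI finite_subset)
qed simp

text \<open>The cocycle identity behind associativity: \<open>inversions\<close> is additive in both
  arguments, and if the triple product is invalid then each side has a vanishing factor.\<close>

lemma mon_sign_assoc: "mon_sign (l + m) n * mon_sign l m = mon_sign l (m + n) * mon_sign m n"
proof (cases "valid (l + m + n)")
  case True
  then have "valid (l + (m + n))" "valid (l + m)" "valid (m + n)"
    using valid_add[of "l + m" n] valid_add[of l "m + n"] by (simp_all add: ac_simps)
  then show ?thesis using True
    by (simp add: mon_sign_def inversions_add_left inversions_add_right power_add)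
next
  case False
  then show ?thesis by (simp add: mon_sign_def ac_simps)
qed

lemma mon_sign_empty [simp]: "mon_sign {#} m = (if valid m then 1 else 0)"
  "mon_sign m {#} = (if valid m then 1 else 0)"
  by (simp_all add: mon_sign_def)


subsection \<open>The algebra of formal series\<close>

text \<open>Both sides run over the factorizations of \<open>k\<close> into three monomials; a chain
  of submultisets \<open>l\<close>, \<open>p\<close>, \<open>k\<close> corresponds to the pair
  \<open>(l, p - l)\<close>. The parity twists compose because \<open>odd_count\<close> is
  additive.\<close>

lemma sser_mult_assoc: "(f \<star> g) \<star> h = f \<star> (g \<star> h)"
proof
  fix k
  let ?t = "\<lambda>l m n. (mon_sign (l + m) n * mon_sign l m) *\<^sub>C
     (f l * (parity_inv ^^ odd_count l) (g m) * (parity_inv ^^ odd_count (l + m)) (h n))"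
  have "((f \<star> g) \<star> h) k = (\<Sum>p | p \<subseteq># k. \<Sum>l | l \<subseteq># p. ?t l (p - l) (k - p))"
    unfolding sser_mult_def
    by (intro sum.cong refl)
       (auto simp: scaleC.scale_sum_right sum_distrib_right scaleC_mult_left intro!: sum.cong)
  also have "\<dots> = (\<Sum>(p, l) \<in> (SIGMA p:{p. p \<subseteq># k}. {l. l \<subseteq># p}). ?t l (p - l) (k - p))"
    by (subst sum.Sigma) (auto simp: finite_subset_mset)
  also have "\<dots> = (\<Sum>(l, m) \<in> (SIGMA l:{l. l \<subseteq># k}. {m. m \<subseteq># k - l}). ?t l m (k - l - m))"
  proof (rule sum.reindex_bij_witness[of _ "\<lambda>(l, m). (l + m, l)" "\<lambda>(p, l). (l, p - l)"], goal_cases)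
    case (2 a)
    then obtain p l q r where "a = (p, l)" "p = l + q" "k = p + r"
      by (auto simp: subset_mset.le_iff_add)
    then show ?case by (simp add: add.assoc)
  next
    case (4 b)
    then show ?case by (auto simp: subset_mset.le_diff_conv2 add.commute)
  next
    case (5 a)
    then obtain p l q r where "a = (p, l)" "p = l + q" "k = p + r"
      by (auto simp: subset_mset.le_iff_add)
    then show ?case by (simp add: add.assoc)
  qed auto
  also have "\<dots> = (\<Sum>l | l \<subseteq># k. \<Sum>m | m \<subseteq># k - l. ?t l m (k - l - m))"
    by (subst sum.Sigma) (auto simp: finite_subset_mset)
  also have "\<dots> = (f \<star> (g \<star> h)) k"
    unfolding sser_mult_def
    apply (intro sum.cong refl)
    apply (simp add: parity_inv_funpow_sum scaleC.scale_sum_right sum_distrib_left)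
    apply (intro sum.cong refl)
    subgoal premises prems for l m
      using prems subset_mset.add_diff_inverse[of m "k - l"]
      by (simp add: mon_sign_assoc parity_inv_funpow_scaleC parity_inv_funpow_mult scaleC_mult_right
          odd_count_add funpow_add mult.assoc)
    done
  finally show "((f \<star> g) \<star> h) k = (f \<star> (g \<star> h)) k" .
qed

text \<open>The support condition belongs to the type because \<open>mon_sign\<close> vanishes on
  invalid monomials: a function with a nonzero value there would not be fixed by multiplication with
  1.\<close>

typedef (overloaded) 'a ser = "{f :: smon \<Rightarrow> 'a::zero. \<forall>m. \<not> valid m \<longrightarrow> f m = 0}"
  morphisms coef Ser
  by (intro exI[of _ "\<lambda>m. 0"]) simp

setup_lifting type_definition_ser

lemma not_valid_add_mset: "\<not> valid m \<Longrightarrow> \<not> valid (add_mset v m)"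
  using valid_add(2)[of "{#v#}" m] by auto

lemma coef_invalid: "\<not> valid m \<Longrightarrow> coef f m = 0"
  using coef[of f] by auto

lemma ser_eqI: "(\<And>m. coef f m = coef g m) \<Longrightarrow> f = g"
  by (simp add: coef_inject[symmetric] fun_eq_iff)

instantiation ser :: (supercommutative_superalgebra) "{ring, monoid_mult}"
begin

lift_definition zero_ser :: "'a ser" is "\<lambda>m. 0" by simp
lift_definition one_ser :: "'a ser" is sser_one by (auto simp: sser_one_def)
lift_definition plus_ser :: "'a ser \<Rightarrow> 'a ser \<Rightarrow> 'a ser" is "\<lambda>f g m. f m + g m" by simp
lift_definition minus_ser :: "'a ser \<Rightarrow> 'a ser \<Rightarrow> 'a ser" is "\<lambda>f g m. f m - g m" by simp
lift_definition uminus_ser :: "'a ser \<Rightarrow> 'a ser" is "\<lambda>f m. - f m" by simp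
lift_definition times_ser :: "'a ser \<Rightarrow> 'a ser \<Rightarrow> 'a ser" is sser_mult
  by (auto simp: sser_mult_def mon_sign_def intro!: sum.neutral)

instance
proof
  fix a b c :: "'a ser"
  show "a + b + c = a + (b + c)" by transfer (simp add: add.assoc)
  show "a + b = b + a" by transfer (simp add: add.commute)
  show "0 + a = a" by transfer simp
  show "- a + a = 0" by transfer simp
  show "a - b = a + - b" by transfer simp
  show "a * b * c = a * (b * c)" by transfer (rule sser_mult_assoc)
  show "(a + b) * c = a * c + b * c"
    by transfer (simp add: sser_mult_def distrib_right scaleC_add_right sum.distrib)
  show "a * (b + c) = a * b + a * c"
    by transfer (simp add: sser_mult_def distrib_left parity_inv_funpow_add scaleC_add_right sum.distrib)
  show "1 * a = a"
  proof (transfer, rule ext)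
    fix f :: "smon \<Rightarrow> 'a" and k
    assume f: "\<forall>m. \<not> valid m \<longrightarrow> f m = 0"
    have "(sser_one \<star> f) k = (\<Sum>m\<in>{{#}}. mon_sign m (k - m) *\<^sub>C (sser_one m * (parity_inv ^^ odd_count m) (f (k - m))))"
      unfolding sser_mult_def
      by (rule sum.mono_neutral_right) (auto simp: sser_one_def finite_subset_mset)
    then show "(sser_one \<star> f) k = f k" using f by (simp add: sser_one_def scaleC_one)
  qed
  show "a * 1 = a"
  proof (transfer, rule ext)
    fix f :: "smon \<Rightarrow> 'a" and k
    assume f: "\<forall>m. \<not> valid m \<longrightarrow> f m = 0"
    have "(f \<star> sser_one) k = (\<Sum>m\<in>{k}. mon_sign m (k - m) *\<^sub>C (f m * (parity_inv ^^ odd_count m) (sser_one (k - m))))"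
      unfolding sser_mult_def
      by (rule sum.mono_neutral_right)
         (auto simp: sser_one_def finite_subset_mset parity_inv_funpow_zero Diff_eq_empty_iff_mset)
    then show "(f \<star> sser_one) k = f k" using f by (simp add: sser_one_def scaleC_one parity_inv_funpow_one)
  qed
qed

end

section \<open>Scalars, parity, partial derivatives and variables on series\<close>

lift_definition sc :: "complex \<Rightarrow> 'a::supercommutative_superalgebra ser \<Rightarrow> 'a ser" is sser_scale
  by (simp add: sser_scale_def)

lift_definition par :: "'a::supercommutative_superalgebra ser \<Rightarrow> 'a ser" is sser_parity_inv
  by (simp add: sser_parity_inv_def)

lift_definition pds :: "svar \<Rightarrow> 'a::supercommutative_superalgebra ser \<Rightarrow> 'a ser" is pd
  by (simp add: pd_def not_valid_add_mset)

text \<open>\<open>t\<^sup>\<plusminus>\<^sub>0\<close> is not a variable; its junk value is \<open>0\<close>.\<close>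

lift_definition var :: "svar \<Rightarrow> 'a::supercommutative_superalgebra ser"
  is "\<lambda>v. if valid {#v#} then sser_var v else (\<lambda>m. 0)"
  by (auto simp: sser_var_def)

lemma coef_zero [simp]: "coef 0 m = 0" by (simp add: zero_ser.rep_eq)
lemma coef_add [simp]: "coef (f + g) m = coef f m + coef g m" by (simp add: plus_ser.rep_eq)
lemma coef_diff [simp]: "coef (f - g) m = coef f m - coef g m" by (simp add: minus_ser.rep_eq)
lemma coef_minus [simp]: "coef (- f) m = - coef f m" by (simp add: uminus_ser.rep_eq)
lemma coef_sum [simp]: "coef (sum F A) m = (\<Sum>i\<in>A. coef (F i) m)"
  by (induction A rule: infinite_finite_induct) auto
lemma coef_one: "coef 1 m = (if m = {#} then 1 else 0)" by (simp add: one_ser.rep_eq sser_one_def)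
lemma coef_mult: "coef (f * g) k = (\<Sum>m | m \<subseteq># k.
      mon_sign m (k - m) *\<^sub>C (coef f m * (parity_inv ^^ odd_count m) (coef g (k - m))))"
  by (simp add: times_ser.rep_eq sser_mult_def)
lemma coef_sc [simp]: "coef (sc c f) m = c *\<^sub>C coef f m" by (simp add: sc.rep_eq sser_scale_def)
lemma coef_par: "coef (par f) m = (-1) ^ odd_count m *\<^sub>C parity_inv (coef f m)"
  by (simp add: par.rep_eq sser_parity_inv_def)
lemma coef_var: "valid {#v#} \<Longrightarrow> coef (var v) m = (if m = {#v#} then 1 else 0)"
  by (simp add: var.rep_eq sser_var_def)
lemma coef_pds: "coef (pds v f) m = (of_nat (count m v + 1) * (-1) ^ inversions {#v#} m) *\<^sub>C
      (parity_inv ^^ odd_count {#v#}) (coef f (add_mset v m))"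
  by (simp add: pds.rep_eq pd_def odd_count_single)

interpretation sc: vector_space "sc :: complex \<Rightarrow> 'a ser \<Rightarrow> 'a::supercommutative_superalgebra ser"
  by unfold_locales
     (auto intro!: ser_eqI simp: scaleC_add_right scaleC_add_left scaleC_scaleC scaleC_one)

lemma sc_mult_left: "sc c f * g = sc c (f * g)"
  by (rule ser_eqI) (simp add: coef_mult scaleC_mult_left scaleC.scale_sum_right mult.commute)

lemma sc_mult_right: "f * sc c g = sc c (f * g)"
  by (rule ser_eqI)
     (simp add: coef_mult scaleC_mult_right parity_inv_funpow_scaleC scaleC.scale_sum_right mult.commute)

lemma par_add: "par (f + g) = par f + par g"
  by (rule ser_eqI) (simp add: coef_par parity_inv_add scaleC_add_right)

lemma par_sc: "par (sc c f) = sc c (par f)"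
  by (rule ser_eqI) (simp add: coef_par parity_inv_scaleC mult.commute)

lemma par_zero [simp]: "par 0 = 0" using par_sc[of 0 0] by simp

lemma par_minus: "par (- f) = - par f" using par_sc[of "-1" f] by simp

lemma par_diff: "par (f - g) = par f - par g" using par_add[of f "-g"] by (simp add: par_minus)

lemma par_sum: "par (sum F A) = (\<Sum>i\<in>A. par (F i))"
  by (induction A rule: infinite_finite_induct) (auto simp: par_add)

lemma par_par [simp]: "par (par f) = f"
  by (rule ser_eqI) (simp add: coef_par parity_inv_scaleC scaleC_one flip: power_add)

lemma par_one [simp]: "par 1 = 1"
  by (rule ser_eqI) (simp add: coef_par coef_one scaleC_one)

lemma par_mult: "par (f * g) = par f * par g"
proof (rule ser_eqI)
  fix k
  show "coef (par (f * g)) k = coef (par f * par g) k"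
    unfolding coef_par coef_mult parity_inv_sum scaleC.scale_sum_right
  proof (intro sum.cong refl)
    fix m assume "m \<in> {m. m \<subseteq># k}"
    then obtain n where k: "k = m + n" by (auto simp: subset_mset.le_iff_add)
    show "(- 1) ^ odd_count k *\<^sub>C parity_inv (mon_sign m (k - m) *\<^sub>C
            (coef f m * (parity_inv ^^ odd_count m) (coef g (k - m)))) =
         mon_sign m (k - m) *\<^sub>C ((- 1) ^ odd_count m *\<^sub>C parity_inv (coef f m) *
            (parity_inv ^^ odd_count m) ((- 1) ^ odd_count (k - m) *\<^sub>C parity_inv (coef g (k - m))))"
      unfolding k
      by (simp add: parity_inv_scaleC parity_inv_mult parity_inv_funpow scaleC_mult_left
          scaleC_mult_right odd_count_add power_add mult_ac)
  qed
qed

lemma coef_par_funpow: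
  "coef ((par ^^ n) f) m = (-1) ^ (n * odd_count m) *\<^sub>C (parity_inv ^^ n) (coef f m)"
  by (induction n)
     (simp_all add: coef_par parity_inv_scaleC power_add scaleC_one mult.commute)

section \<open>Partial derivatives and their Leibniz rule\<close>

lemma pds_add: "pds v (f + g) = pds v f + pds v g"
  by (rule ser_eqI) (simp add: coef_pds parity_inv_funpow_add scaleC_add_right)

lemma pds_sc: "pds v (sc c f) = sc c (pds v f)"
  by (rule ser_eqI) (simp add: coef_pds parity_inv_funpow_scaleC mult_ac)

lemma pds_zero [simp]: "pds v 0 = 0" using pds_sc[of v 0 0] by simp

lemma pds_minus: "pds v (- f) = - pds v f" using pds_sc[of v "-1" f] by simp

lemma pds_diff: "pds v (f - g) = pds v f - pds v g" using pds_add[of v f "-g"] by (simp add: pds_minus)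

lemma pds_sum: "pds v (sum F A) = (\<Sum>i\<in>A. pds v (F i))"
  by (induction A rule: infinite_finite_induct) (auto simp: pds_add)

lemma pds_one [simp]: "pds v 1 = 0"
  by (rule ser_eqI) (simp add: coef_pds coef_one parity_inv_funpow_zero)

lemma pds_var: "valid {#v#} \<Longrightarrow> pds u (var v) = (if u = v then 1 else 0)"
  by (rule ser_eqI) (auto simp: coef_pds coef_var coef_one parity_inv_funpow_zero
     parity_inv_funpow_one scaleC_one)

lemma var_invalid: "\<not> valid {#v#} \<Longrightarrow> var v = 0"
  by (intro ser_eqI) (simp add: var.rep_eq)

lemma par_var: "par (var v) = sc ((-1) ^ odd_count {#v#}) (var v)"
  by (cases "valid {#v#}") (auto intro!: ser_eqI simp: coef_par coef_var var_invalid)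

lemma pds_par: "pds v (par f) = sc ((-1) ^ odd_count {#v#}) (par (pds v f))"
  by (rule ser_eqI)
     (simp add: coef_par coef_pds parity_inv_scaleC parity_inv_funpow odd_count_single parity_inv_minus
       odd_count_add[of "{#v#}", simplified] mult_ac)

text \<open>Of two distinct odd variables exactly one has the larger rank, so the two orders of
  removal differ by one inversion.\<close>

lemma pds_pds_commute:
  "u \<noteq> v \<Longrightarrow> pds u (pds v f) = sc ((-1) ^ (odd_count {#u#} * odd_count {#v#})) (pds v (pds u f))"
proof (rule ser_eqI)
  fix m assume uv: "u \<noteq> v"
  have *: "inversions {#u#} {#v#} + inversions {#v#} {#u#} = odd_count {#u#} * odd_count {#v#}"
    using uv rank_var_eq_iff[of u v] by (auto simp: inversions_single odd_count_single)
  have a: "inversions {#u#} (add_mset v m) = inversions {#u#} {#v#} + inversions {#u#} m"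
    and b: "inversions {#v#} (add_mset u m) = inversions {#v#} {#u#} + inversions {#v#} m"
    using inversions_add_right[of _ "{#_#}" m] by simp_all
  have s: "(-1::complex) ^ inversions {#v#} {#u#} =
      (-1) ^ (odd_count {#u#} * odd_count {#v#}) * (-1) ^ inversions {#u#} {#v#}"
    unfolding *[symmetric] by (simp add: power_add flip: mult.assoc power_mult_distrib)
  show "coef (pds u (pds v f)) m = coef (sc ((-1) ^ (odd_count {#u#} * odd_count {#v#})) (pds v (pds u f))) m"
    using uv
    by (simp add: coef_pds parity_inv_funpow_scaleC a b power_add s add_mset_commute mult_ac
        funpow_add[symmetric, THEN fun_cong, unfolded comp_def] add.commute)
qed

lemma even_power_minus_one_cong:
  "even (a + b) \<Longrightarrow> (-1) ^ a = ((-1) ^ b :: complex)"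
  by (simp add: minus_one_power_iff)

text \<open>The coefficient at \<open>k\<close> comes from the splittings of
  \<open>add_mset v k\<close>, weighted by the multiplicity of \<open>v\<close>. This is the sum of
  its multiplicities in the two parts, and each of these gives one term of the rule. If
  \<open>add_mset v k\<close> is invalid, the left side vanishes; the interesting case is then an
  odd \<open>v\<close> already present in \<open>k\<close>, where the two terms on the right
  cancel.\<close>

lemma pds_mult: "pds v (f * g) = pds v f * g + (par ^^ odd_count {#v#}) f * pds v g"
proof (rule ser_eqI)
  fix k
  let ?p = "odd_count {#v#}" and ?K = "add_mset v k"
  let ?P = "parity_inv ^^ ?p"
  have K: "?K = {#v#} + k" by simp
  have R1: "coef (pds v f * g) k = (\<Sum>m | m \<subseteq># k. (mon_sign m (k - m) * of_nat (count m v + 1)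
      * (-1) ^ inversions {#v#} m) *\<^sub>C
      (?P (coef f (add_mset v m)) * (parity_inv ^^ odd_count m) (coef g (k - m))))"
    unfolding coef_mult coef_pds by (simp add: scaleC_mult_left mult.assoc)
  have R2: "coef ((par ^^ ?p) f * pds v g) k = (\<Sum>m | m \<subseteq># k. (mon_sign m (k - m) * (-1) ^ (?p * odd_count m)
      * (of_nat (count (k - m) v + 1) * (-1) ^ inversions {#v#} (k - m))) *\<^sub>C
      (?P (coef f m) * (parity_inv ^^ (odd_count m + ?p)) (coef g (add_mset v (k - m)))))"
    unfolding coef_mult coef_pds coef_par_funpow
    by (simp add: scaleC_mult_left scaleC_mult_right parity_inv_funpow_scaleC mult_ac funpow_add)
  show "coef (pds v (f * g)) k = coef (pds v f * g + (par ^^ ?p) f * pds v g) k"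
  proof (cases "valid ?K")
    case True
    \<comment> \<open>The summand of the product at \<open>?K\<close>, including the sign of
      removing \<open>v\<close> but not its multiplicity, which is distributed over the two parts
      afterwards.\<close>
    define t where "t m = ((-1) ^ (inversions {#v#} k + inversions m (?K - m))) *\<^sub>C
      (?P (coef f m) * (parity_inv ^^ (odd_count m + ?p)) (coef g (?K - m)))" for m
    have vK: "valid (m + (?K - m))" if "m \<subseteq># ?K" for m
      using that True by simp
    have "coef (pds v (f * g)) k = (\<Sum>m | m \<subseteq># ?K. of_nat (count ?K v) *\<^sub>C t m)"
      unfolding coef_pds coef_mult t_def parity_inv_funpow_sum scaleC.scale_sum_right
    proof (intro sum.cong refl)
      fix m assume "m \<in> {m. m \<subseteq># ?K}"
      then have ms: "mon_sign m (?K - m) = (-1) ^ inversions m (?K - m)"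
        using vK[of m] by (simp add: mon_sign_def)
      show "(of_nat (count k v + 1) * (- 1) ^ inversions {#v#} k) *\<^sub>C
          ?P (mon_sign m (?K - m) *\<^sub>C (coef f m * (parity_inv ^^ odd_count m) (coef g (?K - m)))) =
          of_nat (count ?K v) *\<^sub>C ((- 1) ^ (inversions {#v#} k + inversions m (?K - m))) *\<^sub>C
           (?P (coef f m) * (parity_inv ^^ (odd_count m + ?p)) (coef g (?K - m)))"
        unfolding ms
        by (simp add: parity_inv_funpow_scaleC parity_inv_funpow_mult power_add mult.assoc
             add.commute[of "odd_count m"] funpow_add)
    qed
    also have "\<dots> = (\<Sum>m | m \<subseteq># ?K. of_nat (count m v) *\<^sub>C t m) + (\<Sum>m | m \<subseteq># ?K. of_nat (count (?K - m) v) *\<^sub>C t m)"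
      unfolding sum.distrib[symmetric]
    proof (intro sum.cong refl)
      fix m assume "m \<in> {m. m \<subseteq># ?K}"
      then have "count ?K v = count m v + count (?K - m) v"
        by (metis mem_Collect_eq plus_multiset.rep_eq subset_mset.add_diff_inverse)
      then show "of_nat (count ?K v) *\<^sub>C t m = of_nat (count m v) *\<^sub>C t m + of_nat (count (?K - m) v) *\<^sub>C t m"
        by (simp only: of_nat_add scaleC_add_left)
    qed
    also have "(\<Sum>m | m \<subseteq># ?K. of_nat (count m v) *\<^sub>C t m) = (\<Sum>m\<in>add_mset v ` {m. m \<subseteq># k}. of_nat (count m v) *\<^sub>C t m)"
    proof (rule sum.mono_neutral_right)
      show "\<forall>i\<in>{m. m \<subseteq># ?K} - add_mset v ` {m. m \<subseteq># k}. of_nat (count i v) *\<^sub>C t i = 0"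
      proof
        fix m assume m: "m \<in> {m. m \<subseteq># ?K} - add_mset v ` {m. m \<subseteq># k}"
        have "v \<notin># m"
        proof
          assume "v \<in># m"
          then obtain m' where "m = add_mset v m'" by (metis mset_add)
          then show False using m by auto
        qed
        then show "of_nat (count m v) *\<^sub>C t m = 0" by (simp add: not_in_iff)
      qed
    qed (auto simp: finite_subset_mset)
    also have "\<dots> = (\<Sum>m | m \<subseteq># k. of_nat (count m v + 1) *\<^sub>C t (add_mset v m))"
      by (subst sum.reindex) (auto simp: inj_on_def)
    also have "\<dots> = coef (pds v f * g) k"
      unfolding R1
    proof (intro sum.cong refl)
      fix m assume "m \<in> {m. m \<subseteq># k}"
      then obtain n where k: "k = m + n" by (auto simp: subset_mset.le_iff_add)
      have val: "valid (m + n)" using valid_add(2)[of "{#v#}" k] True k by simp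
      have i: "inversions (add_mset v m) n = inversions {#v#} n + inversions m n"
        using inversions_add_left[of "{#v#}" m n] by simp
      \<comment> \<open>The inversions of \<open>v\<close> against \<open>n\<close> occur twice and
        drop out of the sign.\<close>
      have e: "(-1::complex) ^ (inversions {#v#} (m + n) + inversions (add_mset v m) n) =
          (-1) ^ (inversions {#v#} m + inversions m n)"
        by (rule even_power_minus_one_cong) (auto simp: i inversions_add_right)
      have p: "(parity_inv ^^ (odd_count (add_mset v m) + ?p)) x = (parity_inv ^^ odd_count m) x" for x :: 'a
        using odd_count_add[of "{#v#}" m] by (simp add: parity_inv_funpow)
      have d: "add_mset v (m + n) - add_mset v m = n" "m + n - m = n" by simp_all
      show "of_nat (count m v + 1) *\<^sub>C t (add_mset v m) = (mon_sign m (k - m) * of_nat (count m v + 1)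
          * (-1) ^ inversions {#v#} m) *\<^sub>C
          (?P (coef f (add_mset v m)) * (parity_inv ^^ odd_count m) (coef g (k - m)))"
        using val unfolding t_def k d e p
        by (simp add: mon_sign_def power_add mult.commute mult.left_commute)
    qed
    also have "(\<Sum>m | m \<subseteq># ?K. of_nat (count (?K - m) v) *\<^sub>C t m) = (\<Sum>m | m \<subseteq># k. of_nat (count (?K - m) v) *\<^sub>C t m)"
    proof (rule sum.mono_neutral_right)
      show "\<forall>i\<in>{m. m \<subseteq># ?K} - {m. m \<subseteq># k}. of_nat (count (?K - i) v) *\<^sub>C t i = 0"
      proof
        fix m assume m: "m \<in> {m. m \<subseteq># ?K} - {m. m \<subseteq># k}"
        then obtain n where n: "?K = m + n" by (auto simp: subset_mset.le_iff_add)
        have "v \<notin># n"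
        proof
          assume "v \<in># n"
          then obtain n' where "n = add_mset v n'" by (metis mset_add)
          then show False using m n by auto
        qed
        then have "count (?K - m) v = 0" unfolding n by (simp add: not_in_iff)
        then show "of_nat (count (?K - m) v) *\<^sub>C t m = 0" by simp
      qed
    qed (auto simp: finite_subset_mset intro: subset_mset.order_trans)
    also have "\<dots> = coef ((par ^^ ?p) f * pds v g) k"
      unfolding R2
    proof (intro sum.cong refl)
      fix m assume "m \<in> {m. m \<subseteq># k}"
      then obtain n where k: "k = m + n" by (auto simp: subset_mset.le_iff_add)
      have val: "valid (m + n)" using valid_add(2)[of "{#v#}" k] True k by simp
      have Km: "?K - m = add_mset v n" "?K = m + add_mset v n" using k by simp_all
      have i: "inversions m (add_mset v n) = inversions m {#v#} + inversions m n"
        using inversions_add_right[of m "{#v#}" n] by simp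
      have "even (inversions {#v#} m + inversions m {#v#} + ?p * odd_count m)"
      proof (cases "odd_var v")
        case odd: True
        then have "count m v = 0" using valid_count_le_1[OF True odd] k by simp
        then show ?thesis using inversions_swap[OF odd, of m] odd by (simp add: odd_count_single)
      qed (simp add: inversions_even_var odd_count_single)
      then have s: "(-1::complex) ^ (inversions {#v#} m + inversions m {#v#}) = (-1) ^ (?p * odd_count m)"
        by (rule even_power_minus_one_cong)
      have e: "(-1::complex) ^ (inversions {#v#} k + inversions m (add_mset v n)) =
         (-1) ^ (?p * odd_count m) * ((-1) ^ inversions {#v#} n * (-1) ^ inversions m n)"
        unfolding s[symmetric] by (simp add: k i inversions_add_right power_add mult.commute mult.left_commute)
      show "of_nat (count (?K - m) v) *\<^sub>C t m = (mon_sign m (k - m) * (-1) ^ (?p * odd_count m)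
          * (of_nat (count (k - m) v + 1) * (-1) ^ inversions {#v#} (k - m))) *\<^sub>C
          (?P (coef f m) * (parity_inv ^^ (odd_count m + ?p)) (coef g (add_mset v (k - m))))"
        using val unfolding t_def Km k
        apply (simp add: mon_sign_def mult.commute mult.left_commute)
        using e[unfolded k]
        apply (simp add: mult.commute mult.left_commute)
        done
    qed
    finally show ?thesis by simp
  next
    case False
    have L: "coef (pds v (f * g)) k = 0"
      using False by (simp add: coef_pds coef_invalid parity_inv_funpow_zero)
    show ?thesis
    proof (cases "valid k \<and> valid {#v#}")
      case nv: False
      have "coef (pds v f) m = 0 \<and> coef (pds v g) m = 0" if "m \<subseteq># k" "valid k" for m
      proof -
        have "\<not> valid (add_mset v m)" using nv that valid_add(1)[of "{#v#}" m] by auto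
        then show ?thesis by (simp add: coef_pds coef_invalid parity_inv_funpow_zero)
      qed
      then have "coef (pds v f * g + (par ^^ ?p) f * pds v g) k = 0"
        by (cases "valid k", simp_all only: coef_invalid not_False_eq_True coef_add)
           (simp_all add: coef_mult parity_inv_funpow_zero)
      then show ?thesis using L by simp
    next
      case vk: True
      \<comment> \<open>Since \<open>k\<close> and the single variable \<open>v\<close> are valid,
        \<open>?K\<close> can only fail by a repeated odd variable, and that variable is
        \<open>v\<close>.\<close>
      have "\<exists>u\<in>#?K. odd_var u \<and> count ?K u \<noteq> 1"
        using False vk by (auto simp: valid_def)
      then have odd: "odd_var v" "v \<in># k"
        using vk by (auto simp: valid_def split: if_splits)
      then obtain k0 where k0: "k = add_mset v k0" by (metis mset_add)
      have nk0: "v \<notin># k0" using vk odd valid_count_le_1[of k v] unfolding k0 by (auto simp flip: count_greater_zero_iff)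
      have p1: "?p = 1" using odd by (simp add: odd_count_single)
      have vv: "\<not> valid (add_mset v (add_mset v m))" for m
        using odd valid_count_le_1[of "add_mset v (add_mset v m)" v] by auto
      have sub: "{m. m \<subseteq># k0} \<subseteq> {m. m \<subseteq># k}" "add_mset v ` {m. m \<subseteq># k0} \<subseteq> {m. m \<subseteq># k}"
        unfolding k0 by (auto intro: subset_mset.order_trans)
      have "coef (pds v f * g) k = (\<Sum>m | m \<subseteq># k0. (mon_sign m (k - m) * of_nat (count m v + 1)
          * (-1) ^ inversions {#v#} m) *\<^sub>C
          (?P (coef f (add_mset v m)) * (parity_inv ^^ odd_count m) (coef g (k - m))))"
        unfolding R1
      proof (rule sum.mono_neutral_right)
        show "\<forall>i\<in>{m. m \<subseteq># k} - {m. m \<subseteq># k0}. (mon_sign i (k - i) * of_nat (count i v + 1)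
          * (-1) ^ inversions {#v#} i) *\<^sub>C
          (?P (coef f (add_mset v i)) * (parity_inv ^^ odd_count i) (coef g (k - i))) = 0"
        proof
          fix m assume m: "m \<in> {m. m \<subseteq># k} - {m. m \<subseteq># k0}"
          have "v \<in># m"
          proof (rule ccontr)
            assume "v \<notin># m"
            then have "m \<subseteq># k0" using m unfolding k0
              by (metis DiffD1 diff_single_trivial mem_Collect_eq subset_eq_diff_conv add_mset_add_single)
            then show False using m by simp
          qed
          then obtain m' where "m = add_mset v m'" by (metis mset_add)
          then show "(mon_sign m (k - m) * of_nat (count m v + 1)
          * (-1) ^ inversions {#v#} m) *\<^sub>C
          (?P (coef f (add_mset v m)) * (parity_inv ^^ odd_count m) (coef g (k - m))) = 0"
            by (simp add: coef_invalid vv parity_inv_funpow_zero)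
        qed
      qed (use sub in \<open>auto simp: finite_subset_mset\<close>)
      \<comment> \<open>The surviving terms pair off: the splitting \<open>m\<close> in the first
        family and \<open>add_mset v m\<close> in the second read \<open>f\<close> and
        \<open>g\<close> at the same two monomials, each containing \<open>v\<close>, but with
        opposite signs.\<close>
      also have "\<dots> = - (\<Sum>m | m \<subseteq># k0. (mon_sign (add_mset v m) (k - add_mset v m) * (-1) ^ (?p * odd_count (add_mset v m))
          * (of_nat (count (k - add_mset v m) v + 1) * (-1) ^ inversions {#v#} (k - add_mset v m))) *\<^sub>C
          (?P (coef f (add_mset v m)) * (parity_inv ^^ (odd_count (add_mset v m) + ?p)) (coef g (add_mset v (k - add_mset v m)))))"
        unfolding sum_negf[symmetric]
      proof (intro sum.cong refl)
        fix m assume "m \<in> {m. m \<subseteq># k0}"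
        then obtain n where k: "k0 = m + n" by (auto simp: subset_mset.le_iff_add)
        have c: "count m v = 0" "count n v = 0" using nk0 unfolding k by (simp_all add: not_in_iff)
        have i: "inversions m (add_mset v n) = inversions m {#v#} + inversions m n"
          "inversions (add_mset v m) n = inversions {#v#} n + inversions m n"
          "odd_count (add_mset v m) = Suc (odd_count m)"
          using inversions_add_right[of m "{#v#}" n] inversions_add_left[of "{#v#}" m n]
            odd_count_add[of "{#v#}" m] p1 by simp_all
        have s: "odd_count m = inversions {#v#} m + inversions m {#v#}"
          using inversions_swap[OF odd(1), of m] c by simp
        have val: "valid (add_mset v (m + n))" using vk unfolding k0 k by simp
        show "(mon_sign m (k - m) * of_nat (count m v + 1) * (- 1) ^ inversions {#v#} m) *\<^sub>C
          (?P (coef f (add_mset v m)) * (parity_inv ^^ odd_count m) (coef g (k - m))) =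
          - ((mon_sign (add_mset v m) (k - add_mset v m) * (- 1) ^ (?p * odd_count (add_mset v m)) *
           (of_nat (count (k - add_mset v m) v + 1) * (- 1) ^ inversions {#v#} (k - add_mset v m))) *\<^sub>C
          (?P (coef f (add_mset v m)) * (parity_inv ^^ (odd_count (add_mset v m) + ?p))
             (coef g (add_mset v (k - add_mset v m)))))"
        proof -
          have d: "add_mset v (m + n) - m = add_mset v n" "add_mset v (m + n) - add_mset v m = n"
            by simp_all
          have e: "(-1::complex) ^ inversions m (add_mset v n) * (-1) ^ inversions {#v#} m =
              - ((-1) ^ inversions (add_mset v m) n * (-1) ^ odd_count (add_mset v m) * (-1) ^ inversions {#v#} n)"
            unfolding i s by (simp add: power_add mult.commute mult.left_commute)
          have p: "(parity_inv ^^ (odd_count (add_mset v m) + 1)) x = (parity_inv ^^ odd_count m) x" for x :: 'a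
            unfolding i by (simp add: parity_inv_funpow)
          have ms: "mon_sign m (add_mset v n) = (-1) ^ inversions m (add_mset v n)"
            "mon_sign (add_mset v m) n = (-1) ^ inversions (add_mset v m) n"
            using val by (simp_all add: mon_sign_def)
          show ?thesis
            unfolding k0 k d p1 p ms c using e by (simp add: mult.assoc)
        qed
      qed
      also have "\<dots> = - (\<Sum>m\<in>add_mset v ` {m. m \<subseteq># k0}. (mon_sign m (k - m) * (-1) ^ (?p * odd_count m)
          * (of_nat (count (k - m) v + 1) * (-1) ^ inversions {#v#} (k - m))) *\<^sub>C
          (?P (coef f m) * (parity_inv ^^ (odd_count m + ?p)) (coef g (add_mset v (k - m)))))"
        by (subst sum.reindex) (auto simp: inj_on_def)
      also have "\<dots> = - coef ((par ^^ ?p) f * pds v g) k"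
        unfolding R2
      proof (intro arg_cong[where f=uminus] sum.mono_neutral_left)
        show "\<forall>i\<in>{m. m \<subseteq># k} - add_mset v ` {m. m \<subseteq># k0}. (mon_sign i (k - i) * (-1) ^ (?p * odd_count i)
          * (of_nat (count (k - i) v + 1) * (-1) ^ inversions {#v#} (k - i))) *\<^sub>C
          (?P (coef f i) * (parity_inv ^^ (odd_count i + ?p)) (coef g (add_mset v (k - i)))) = 0"
        proof
          fix m assume m: "m \<in> {m. m \<subseteq># k} - add_mset v ` {m. m \<subseteq># k0}"
          then obtain n where n: "k = m + n" by (auto simp: subset_mset.le_iff_add)
          have "v \<notin># m"
          proof
            assume "v \<in># m"
            then obtain m' where m': "m = add_mset v m'" by (metis mset_add)
            then have "m' \<subseteq># k0" using m unfolding k0 by simp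
            then show False using m m' by blast
          qed
          then have "v \<in># n" using odd(2) n by auto
          then obtain n' where "n = add_mset v n'" by (metis mset_add)
          then show "(mon_sign m (k - m) * (-1) ^ (?p * odd_count m)
          * (of_nat (count (k - m) v + 1) * (-1) ^ inversions {#v#} (k - m))) *\<^sub>C
          (?P (coef f m) * (parity_inv ^^ (odd_count m + ?p)) (coef g (add_mset v (k - m)))) = 0"
            unfolding n by (simp add: coef_invalid vv parity_inv_funpow_zero)
        qed
      qed (use sub in \<open>auto simp: finite_subset_mset\<close>)
      finally show ?thesis using L by simp
    qed
  qed
qed

text \<open>On either side only the splitting that separates one copy of \<open>v\<close>
  contributes. For odd \<open>v\<close> the sign is that of \<open>inversions_swap\<close>, with
  \<open>v\<close> absent from the rest because \<open>k\<close> is valid.\<close>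

lemma var_commute: "var v * f = (par ^^ odd_count {#v#}) f * var v"
proof (cases "valid {#v#}")
  case False
  then show ?thesis by (simp add: var_invalid)
next
  case True
  let ?p = "odd_count {#v#}"
  show ?thesis
  proof (rule ser_eqI)
    fix k
    show "coef (var v * f) k = coef ((par ^^ ?p) f * var v) k"
    proof (cases "v \<in># k \<and> valid k")
      case False
      have "coef (var v * f) k = 0"
        using False True by (cases "valid k") (auto simp: coef_invalid, auto simp: coef_mult coef_var intro!: sum.neutral)
      moreover have "coef ((par ^^ ?p) f * var v) k = 0"
      proof (cases "valid k")
        case vk: True
        have "k - m \<noteq> {#v#}" for m
          using False vk by (metis in_diffD union_single_eq_member)
        then show ?thesis using True by (simp add: coef_mult coef_var parity_inv_funpow_zero)
      qed (simp add: coef_invalid)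
      ultimately show ?thesis by simp
    next
      case vk: True
      then obtain n where k: "k = add_mset v n" by (metis mset_add)
      have L: "coef (var v * f) k = (\<Sum>m\<in>{{#v#}}. mon_sign m (k - m) *\<^sub>C (coef (var v) m * (parity_inv ^^ odd_count m) (coef f (k - m))))"
        unfolding coef_mult using True
        by (intro sum.mono_neutral_right) (auto simp: finite_subset_mset coef_var k)
      have R: "coef ((par ^^ ?p) f * var v) k = (\<Sum>m\<in>{n}. mon_sign m (k - m) *\<^sub>C (coef ((par ^^ ?p) f) m * (parity_inv ^^ odd_count m) (coef (var v) (k - m))))"
        unfolding coef_mult
      proof (intro sum.mono_neutral_right ballI)
        fix m assume m: "m \<in> {m. m \<subseteq># k} - {n}"
        have "k - m \<noteq> {#v#}"
        proof
          assume "k - m = {#v#}"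
          then have "k = m + {#v#}" using m by (metis DiffD1 mem_Collect_eq subset_mset.add_diff_inverse)
          then show False using m k by simp
        qed
        then show "mon_sign m (k - m) *\<^sub>C (coef ((par ^^ ?p) f) m * (parity_inv ^^ odd_count m) (coef (var v) (k - m))) = 0"
          using True by (simp add: coef_var parity_inv_funpow_zero)
      qed (auto simp: k finite_subset_mset)
      have "even (inversions {#v#} n + (inversions n {#v#} + ?p * odd_count n))"
      proof (cases "odd_var v")
        case odd: True
        then have "count n v = 0" using valid_count_le_1[of k v] vk k by auto
        then show ?thesis using inversions_swap[OF odd, of n, symmetric] odd by (auto simp: odd_count_single)
      qed (simp add: inversions_even_var odd_count_single)
      then have "(-1::complex) ^ inversions {#v#} n = (-1) ^ inversions n {#v#} * (-1) ^ (?p * odd_count n)"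
        unfolding power_add[symmetric] by (rule even_power_minus_one_cong)
      then show ?thesis
        unfolding L R using True vk
        by (simp add: k coef_var coef_par_funpow mon_sign_def parity_inv_funpow_one)
    qed
  qed
qed

lemma odd_count_X: "odd_count {#X#} = 0" "odd_count {#Xi#} = 1" "odd_count {#T s n#} = of_bool (odd n)"
  by (simp_all add: odd_count_single)

text \<open>The power of \<open>par\<close> with an integer exponent: on homogeneous
  \<open>f\<close> it is the sign \<open>(-1)^(|f| n)\<close> that arises when \<open>D^n\<close>
  passes \<open>f\<close>. Likewise \<open>eps n\<close> is \<open>(-1)^n\<close>.\<close>

definition tw :: "int \<Rightarrow> 'a::supercommutative_superalgebra ser \<Rightarrow> 'a ser" where
  "tw n f = (if even n then f else par f)"

definition eps :: "int \<Rightarrow> complex" where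
  "eps n = (if even n then 1 else -1)"

lemma eps_add: "eps (m + n) = eps m * eps n" by (simp add: eps_def)
lemma eps_square [simp]: "eps n * eps n = 1" by (simp add: eps_def)
lemma eps_simps [simp]: "eps 0 = 1" "eps 1 = -1" by (simp_all add: eps_def)
lemma tw_simps [simp]: "tw 0 f = f" "tw 1 f = par f" "tw n 0 = 0" "tw n 1 = 1"
  by (simp_all add: tw_def)
lemma tw_tw: "tw m (tw n f) = tw (m + n) f" by (auto simp: tw_def)
lemma tw_add: "tw n (f + g) = tw n f + tw n g" by (simp add: tw_def par_add)
lemma tw_diff: "tw n (f - g) = tw n f - tw n g" by (simp add: tw_def par_diff)
lemma tw_mult: "tw n (f * g) = tw n f * tw n g" by (simp add: tw_def par_mult)
lemma tw_sc: "tw n (sc c f) = sc c (tw n f)" by (simp add: tw_def par_sc)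
lemma par_tw: "par (tw n f) = tw (n + 1) f" by (simp add: tw_def)
subsection \<open>The odd derivation \<open>D\<close>\<close>

definition Ds :: "'a::supercommutative_superalgebra ser \<Rightarrow> 'a ser" where
  "Ds f = pds Xi f + var Xi * pds X f"

lemma valid_XXi [simp]: "valid {#X#}" "valid {#Xi#}"
  by (simp_all add: valid_single)

lemma coef_Ds: "coef (Ds f) = superD (coef f)"
  by (rule ext) (simp add: Ds_def superD_def pds.rep_eq times_ser.rep_eq var.rep_eq)

lemma Ds_add: "Ds (f + g) = Ds f + Ds g" by (simp add: Ds_def pds_add distrib_left)
lemma Ds_sc: "Ds (sc c f) = sc c (Ds f)"
  by (simp add: Ds_def pds_sc sc_mult_right sc.scale_right_distrib)
lemma Ds_zero [simp]: "Ds 0 = 0" by (simp add: Ds_def)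
lemma Ds_one [simp]: "Ds 1 = 0" by (simp add: Ds_def)
lemma Ds_minus: "Ds (- f) = - Ds f" using Ds_sc[of "-1" f] by simp
lemma Ds_diff: "Ds (f - g) = Ds f - Ds g" using Ds_add[of f "-g"] by (simp add: Ds_minus)
lemma Ds_sum: "Ds (sum F A) = (\<Sum>i\<in>A. Ds (F i))"
  by (induction A rule: infinite_finite_induct) (auto simp: Ds_add)

lemma Ds_par: "Ds (par f) = - par (Ds f)"
  by (simp add: Ds_def pds_par par_add par_mult par_var odd_count_X)

lemma Ds_mult: "Ds (f * g) = Ds f * g + par f * Ds g"
proof -
  have "var Xi * f = par f * var Xi"
    using var_commute[of Xi f] by (simp add: odd_count_X)
  then have "var Xi * (f * pds X g) = par f * (var Xi * pds X g)"
    by (metis mult.assoc)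
  then show ?thesis
    by (simp add: Ds_def pds_mult odd_count_X algebra_simps)
qed

lemma pds_T_Ds: "pds (T s n) (Ds f) = sc (eps n) (Ds (pds (T s n) f))"
proof -
  have "pds (T s n) (var Xi * pds X f) = sc (eps n) (var Xi * pds X (pds (T s n) f))"
    by (auto simp: pds_mult pds_var odd_count_X par_var eps_def pds_pds_commute[of "T s n" X])
  then show ?thesis
    by (simp add: Ds_def pds_add pds_pds_commute[of "T s n" Xi] odd_count_X eps_def sc.scale_right_distrib)
qed

lemma Ds_var_T [simp]: "Ds (var (T s n)) = 0"
proof (cases "valid {#T s n#}")
  case True then show ?thesis by (simp add: Ds_def pds_var)
qed (simp add: var_invalid)

lemma Ds_var_Xi [simp]: "Ds (var Xi) = 1"
  by (simp add: Ds_def pds_var)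

abbreviation Dp :: "nat \<Rightarrow> 'a::supercommutative_superalgebra ser \<Rightarrow> 'a ser" where
  "Dp r \<equiv> Ds ^^ r"

lemma Dp_add: "Dp r (f + g) = Dp r f + Dp r g" by (induction r) (auto simp: Ds_add)
lemma Dp_diff: "Dp r (f - g) = Dp r f - Dp r g" by (induction r) (auto simp: Ds_diff)
lemma Dp_sc: "Dp r (sc c f) = sc c (Dp r f)" by (induction r) (auto simp: Ds_sc)
lemma Dp_zero [simp]: "Dp r 0 = 0" by (induction r) auto
lemma par_Ds: "par (Ds f) = - Ds (par f)"
  by (simp add: Ds_par)

lemma par_Dp: "par (Dp r f) = sc (eps r) (Dp r (par f))"
  by (induction r) (simp_all add: par_Ds Ds_sc eps_add)

lemma tw_Dp: "tw n (Dp r f) = sc (eps (n * int r)) (Dp r (tw n f))"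
  by (auto simp: tw_def par_Dp eps_def)

lemma pds_T_Dp: "pds (T s n) (Dp r f) = sc (eps (int n * int r)) (Dp r (pds (T s n) f))"
  by (induction r) (auto simp: pds_T_Ds Ds_sc eps_add algebra_simps)

subsection \<open>Superbinomial coefficients\<close>

lemma sbinom_simps:
  "sbinom (2 * k) (2 * i) = (of_int k gchoose i)"
  "sbinom (2 * k) (Suc (2 * i)) = 0"
  "sbinom (2 * k + 1) (2 * i) = (of_int k gchoose i)"
  "sbinom (2 * k + 1) (Suc (2 * i)) = (of_int k gchoose i)"
  by (simp_all add: sbinom_def)

lemma sbinom_0 [simp]: "sbinom a 0 = 1"
  by (simp add: sbinom_def)

lemma int_parity_cases: obtains k where "(a::int) = 2 * k" | k where "a = 2 * k + 1"
  by (metis evenE oddE)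

lemma nat_parity_cases: obtains k where "(a::nat) = 2 * k" | k where "a = Suc (2 * k)"
  by (metis evenE oddE Suc_eq_plus1)

text \<open>The recursion for one more factor \<open>D\<close>: it either differentiates the
  coefficient or passes it, in the latter case with the sign \<open>- eps r = eps (r + 1)\<close> of
  an \<open>(r + 1)\<close>-fold derivative.\<close>

lemma sbinom_Pascal:
  "sbinom (a + 1) (Suc r) = sbinom a r - eps (int r) * sbinom a (Suc r)"
proof (cases a rule: int_parity_cases; cases r rule: nat_parity_cases)
  fix k i assume [simp]: "a = 2 * k" "r = 2 * i"
  show ?thesis by (simp add: sbinom_simps)
next
  fix k i assume [simp]: "a = 2 * k" "r = Suc (2 * i)"
  show ?thesis using sbinom_simps(1,3)[of k "Suc i"] sbinom_simps(2)[of k i]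
    by (simp add: eps_def)
next
  fix k i assume e: "a = 2 * k + 1" "r = 2 * i"
  have "a + 1 = 2 * (k + 1)" unfolding e by simp
  then show ?thesis unfolding e by (simp only: sbinom_simps) (simp add: eps_def)
next
  fix k i assume [simp]: "a = 2 * k + 1" "r = Suc (2 * i)"
  have "sbinom (2 * k + 1 + 1) (Suc (Suc (2 * i))) = (of_int k + 1 gchoose Suc i)"
    using sbinom_simps(1)[of "k + 1" "Suc i"] by (simp add: algebra_simps)
  then show ?thesis using sbinom_simps(3)[of k "Suc i"]
    by (simp add: sbinom_simps eps_def gbinomial_Suc_Suc)
qed

text \<open>The coefficient identity behind \<open>chi_mult\<close>. In each pattern of parities of
  \<open>a\<close>, \<open>r\<close>, \<open>s\<close> either both sides vanish or the halves
  satisfy the trinomial revision of ordinary binomials.\<close>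

lemma sbinom_trinomial:
  assumes "r \<le> s"
  shows "sbinom a s * sbinom (int s) r = sbinom a r * sbinom (a - int r) (s - r)"
proof -
  have nat: "sbinom (int (2 * j)) (2 * i) = (of_nat j gchoose i)" "sbinom (int (2 * j)) (Suc (2 * i)) = 0"
     "sbinom (int (Suc (2 * j))) (2 * i) = (of_nat j gchoose i)" "sbinom (int (Suc (2 * j))) (Suc (2 * i)) = (of_nat j gchoose i)"
    for i j :: nat
    using sbinom_simps[of "int j" i] by (simp_all add: add.commute)
  have sub: "2 * k - int (2 * i) = 2 * (k - int i)" "2 * k + 1 - int (2 * i) = 2 * (k - int i) + 1"
    "2 * k - int (Suc (2 * i)) = 2 * (k - int i - 1) + 1" "2 * k + 1 - int (Suc (2 * i)) = 2 * (k - int i)"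
    for k i by simp_all
  have subn: "2 * j - 2 * i = 2 * (j - i)" "Suc (2 * j) - Suc (2 * i) = 2 * (j - i)" for i j :: nat by simp_all
  have subn': "Suc (2 * j) - 2 * i = Suc (2 * (j - i))" if "2 * i \<le> Suc (2 * j)" for i j :: nat using that by simp
  have subn'': "2 * j - Suc (2 * i) = Suc (2 * (j - i - 1))" if "Suc (2 * i) \<le> 2 * j" for i j :: nat using that by simp
  have tri: "(of_int k gchoose j) * (of_nat j gchoose i) = (of_int k gchoose i) * (of_int (k - int i) gchoose (j - i) :: complex)"
    if "i \<le> j" for i j k using gbinomial_trinomial_revision[OF that, of "of_int k :: complex"] by simp
  show ?thesis
  proof (cases a rule: int_parity_cases; cases r rule: nat_parity_cases; cases s rule: nat_parity_cases)
    fix k i j assume e: "a = 2 * k" "r = 2 * i" "s = 2 * j"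
    show ?thesis using assms unfolding e nat sub subn sbinom_simps by (intro tri) simp
  next
    fix k i j assume e: "a = 2 * k" "r = 2 * i" "s = Suc (2 * j)"
    show ?thesis using assms unfolding e by (simp only: nat sub subn' sbinom_simps mult_zero_left mult_zero_right)
  next
    fix k i j assume e: "a = 2 * k" "r = Suc (2 * i)" "s = 2 * j"
    show ?thesis unfolding e nat sub subn sbinom_simps by simp
  next
    fix k i j assume e: "a = 2 * k" "r = Suc (2 * i)" "s = Suc (2 * j)"
    show ?thesis unfolding e nat sub subn sbinom_simps by simp
  next
    fix k i j assume e: "a = 2 * k + 1" "r = 2 * i" "s = 2 * j"
    show ?thesis using assms unfolding e nat sub subn sbinom_simps by (intro tri) simp
  next
    fix k i j assume e: "a = 2 * k + 1" "r = 2 * i" "s = Suc (2 * j)"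
    have "i \<le> j" using assms e by simp
    then show ?thesis using assms tri[of i j k] unfolding e by (simp only: nat sub subn' sbinom_simps)
  next
    fix k i j assume e: "a = 2 * k + 1" "r = Suc (2 * i)" "s = 2 * j"
    show ?thesis using assms unfolding e by (simp only: nat sub subn'' sbinom_simps mult_zero_right)
  next
    fix k i j assume e: "a = 2 * k + 1" "r = Suc (2 * i)" "s = Suc (2 * j)"
    show ?thesis using assms unfolding e nat sub subn sbinom_simps by (intro tri) simp
  qed
qed

lemma sum_atMost_double: "(\<Sum>r\<le>2 * t. f r) = (\<Sum>i\<le>t. f (2 * i)) + (\<Sum>i<t. f (Suc (2 * i)) :: 'b::comm_monoid_add)"
proof (induction t)
  case (Suc t)
  have "(\<Sum>r\<le>2 * Suc t. f r) = (\<Sum>r\<le>2 * t. f r) + f (Suc (2 * t)) + f (2 * Suc t)" by simp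
  then show ?case
    unfolding Suc.IH sum.atMost_Suc sum.lessThan_Suc by (simp add: add.assoc add.left_commute add.commute)
qed simp

lemma sum_atMost_double_Suc:
  "(\<Sum>r\<le>Suc (2 * t). f r) = (\<Sum>i\<le>t. f (2 * i)) + (\<Sum>i\<le>t. f (Suc (2 * i)) :: 'b::comm_monoid_add)"
proof -
  have "(\<Sum>i\<le>t. f (Suc (2 * i))) = (\<Sum>i<t. f (Suc (2 * i))) + f (Suc (2 * t))"
    by (simp flip: lessThan_Suc_atMost)
  then show ?thesis by (simp only: sum.atMost_Suc sum_atMost_double add.assoc)
qed

lemma Vandermonde_atMost:
  "(\<Sum>i\<le>t. (of_int k gchoose i) * (of_int l gchoose (t - i))) = (of_int (k + l) gchoose t :: complex)"
  using gbinomial_Vandermonde[of "of_int k :: complex" "of_int l" t] by (simp add: atMost_atLeast0)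

text \<open>The coefficient form of \<open>D^a D^b = D^(a+b)\<close>; the sign is that of the
  remaining \<open>a - r\<close> factors \<open>D\<close> passing \<open>s - r\<close> derivatives.
  The parities reduce it to the Vandermonde convolution of the halves.\<close>

lemma sbinom_Vandermonde:
  "(\<Sum>r\<le>s. sbinom a r * sbinom b (s - r) * eps ((a - int r) * int (s - r))) = sbinom (a + b) s"
proof -
  have subn: "2 * j - 2 * i = 2 * (j - i)" "Suc (2 * j) - Suc (2 * i) = 2 * (j - i)" for i j :: nat by simp_all
  have subn': "Suc (2 * j) - 2 * i = Suc (2 * (j - i))" if "i \<le> j" for i j :: nat using that by simp
  have subn'': "2 * j - Suc (2 * i) = Suc (2 * (j - i - 1))" if "i < j" for i j :: nat using that by simp
  show ?thesis
  proof (cases a rule: int_parity_cases; cases b rule: int_parity_cases; cases s rule: nat_parity_cases)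
    fix k l t assume e: "a = 2 * k" "b = 2 * l" "s = 2 * t"
    show ?thesis using sbinom_simps(1)[of "k + l" t] unfolding e sum_atMost_double
      by (simp add: sbinom_simps subn eps_def Vandermonde_atMost flip: of_int_add)
  next
    fix k l t assume e: "a = 2 * k" "b = 2 * l" "s = Suc (2 * t)"
    show ?thesis using sbinom_simps(2)[of "k + l" t] unfolding e sum_atMost_double_Suc
      by (simp add: sbinom_simps subn' eps_def)
  next
    fix k l t assume e: "a = 2 * k" "b = 2 * l + 1" "s = 2 * t"
    show ?thesis using sbinom_simps(3)[of "k + l" t] unfolding e sum_atMost_double
      by (simp add: sbinom_simps subn eps_def Vandermonde_atMost add.assoc flip: of_int_add)
  next
    fix k l t assume e: "a = 2 * k" "b = 2 * l + 1" "s = Suc (2 * t)"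
    show ?thesis using sbinom_simps(4)[of "k + l" t] unfolding e sum_atMost_double_Suc
      by (simp add: sbinom_simps subn' eps_def Vandermonde_atMost add.assoc flip: of_int_add)
  next
    fix k l t assume e: "a = 2 * k + 1" "b = 2 * l" "s = 2 * t"
    have ab: "a + b = 2 * (k + l) + 1" unfolding e by simp
    have "sbinom (a + b) s = (of_int (k + l) gchoose t)"
      unfolding ab e(3) sbinom_simps ..
    then show ?thesis unfolding e sum_atMost_double
      by (simp add: sbinom_simps subn subn'' eps_def Vandermonde_atMost flip: of_int_add)
  next
    fix k l t assume e: "a = 2 * k + 1" "b = 2 * l" "s = Suc (2 * t)"
    have ab: "a + b = 2 * (k + l) + 1" unfolding e by simp
    have "sbinom (a + b) s = (of_int (k + l) gchoose t)"
      unfolding ab e(3) sbinom_simps ..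
    then show ?thesis unfolding e sum_atMost_double_Suc
      by (simp add: sbinom_simps subn subn' eps_def Vandermonde_atMost flip: of_int_add)
  next
    fix k l t assume e: "a = 2 * k + 1" "b = 2 * l + 1" "s = 2 * t"
    \<comment> \<open>Even and odd \<open>r\<close> each give a convolution, with lower indices
      \<open>t\<close> and \<open>t - 1\<close>; Pascal's rule merges them into the upper index
      \<open>k + l + 1\<close>, the half of \<open>a + b\<close>.\<close>
    have "(of_int (k + l) gchoose t) + (\<Sum>i<t. (of_int k gchoose i) * (of_int l gchoose (t - Suc i)))
        = (of_int (k + l + 1) gchoose t :: complex)"
    proof (cases t)
      case (Suc u)
      then show ?thesis using Vandermonde_atMost[of k l u]
        by (simp add: lessThan_Suc_atMost gbinomial_Suc_Suc del: of_int_add) (simp add: gbinomial_Suc_Suc)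
    qed simp
    moreover have "sbinom (a + b) s = (of_int (k + l + 1) gchoose t)"
      using sbinom_simps(1)[of "k + l + 1" t] unfolding e by (simp add: algebra_simps)
    ultimately show ?thesis unfolding e sum_atMost_double
      by (simp add: sbinom_simps subn subn'' eps_def Vandermonde_atMost del: of_int_add)
  next
    fix k l t assume e: "a = 2 * k + 1" "b = 2 * l + 1" "s = Suc (2 * t)"
    \<comment> \<open>An odd lower index over an even upper one gives 0; on the other side the terms
      for even and odd \<open>r\<close> cancel in pairs.\<close>
    have "sbinom (a + b) s = 0"
      using sbinom_simps(2)[of "k + l + 1" t] unfolding e by (simp add: algebra_simps)
    then show ?thesis unfolding e sum_atMost_double_Suc
      by (simp add: sbinom_simps subn subn' eps_def sum_negf)
  qed
qed

text \<open>Each derivative that falls on \<open>g\<close> has passed \<open>f\<close> and twists it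
  once. The induction step is \<open>sbinom_Pascal\<close>.\<close>

lemma Dp_mult:
  "Dp s (f * g) = (\<Sum>r\<le>s. sc (sbinom (int s) r) (Dp r (tw (int (s - r)) f) * Dp (s - r) g))"
proof (induction s)
  case (Suc s)
  let ?A = "\<lambda>r. Dp r (tw (int (Suc s - r)) f) * Dp (Suc s - r) g"
  have "Dp (Suc s) (f * g) = (\<Sum>r\<le>s. sc (sbinom (int s) r) (Ds (Dp r (tw (int (s - r)) f) * Dp (s - r) g)))"
    by (simp add: Suc.IH Ds_sum Ds_sc)
  also have "\<dots> = (\<Sum>r\<le>s. sc (sbinom (int s) r) (?A (Suc r)) + sc (eps r * sbinom (int s) r) (?A r))"
  proof (intro sum.cong refl)
    fix r assume "r \<in> {..s}"
    then have r: "Suc s - r = Suc (s - r)" by auto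
    have "par (Dp r (tw (int (s - r)) f)) = sc (eps r) (Dp r (tw (int (Suc s - r)) f))"
      unfolding par_Dp par_tw r by (simp add: add.commute)
    then show "sc (sbinom (int s) r) (Ds (Dp r (tw (int (s - r)) f) * Dp (s - r) g)) =
      sc (sbinom (int s) r) (?A (Suc r)) + sc (eps r * sbinom (int s) r) (?A r)"
      by (simp add: Ds_mult r sc_mult_left sc.scale_right_distrib mult.commute)
  qed
  also have "\<dots> = (\<Sum>r\<le>s. sc (sbinom (int s) r) (?A (Suc r))) + (\<Sum>r\<le>s. sc (eps r * sbinom (int s) r) (?A r))"
    by (simp add: sum.distrib)
  \<comment> \<open>The added summand \<open>r = Suc s\<close> has coefficient 0; with it the sum
    can be shifted by one.\<close>
  also have "(\<Sum>r\<le>s. sc (eps r * sbinom (int s) r) (?A r)) = (\<Sum>r\<le>Suc s. sc (eps r * sbinom (int s) r) (?A r))"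
  proof -
    have "sbinom (int s) (Suc s) = 0"
    proof (cases s rule: nat_parity_cases)
      fix k assume "s = 2 * k"
      then show ?thesis using sbinom_simps(2)[of "int k" k] by simp
    next
      fix k assume "s = Suc (2 * k)"
      then show ?thesis using sbinom_simps(3)[of "int k" "Suc k"]
        by (simp add: add.commute gbinomial_of_nat_symmetric binomial_gbinomial[symmetric])
    qed
    then show ?thesis by simp
  qed
  also have "\<dots> = ?A 0 + (\<Sum>r\<le>s. sc (eps (Suc r) * sbinom (int s) (Suc r)) (?A (Suc r)))"
    by (subst sum.atMost_Suc_shift) simp
  also have "(\<Sum>r\<le>s. sc (sbinom (int s) r) (?A (Suc r))) + (?A 0 + (\<Sum>r\<le>s. sc (eps (Suc r) * sbinom (int s) (Suc r)) (?A (Suc r))))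
      = ?A 0 + (\<Sum>r\<le>s. sc (sbinom (int (Suc s)) (Suc r)) (?A (Suc r)))"
  proof -
    have "sc (sbinom (int (Suc s)) (Suc r)) x =
        sc (sbinom (int s) r) x + sc (eps (Suc r) * sbinom (int s) (Suc r)) x" for r and x :: "'a ser"
      using sbinom_Pascal[of "int s" r]
      by (simp add: eps_add add.commute[of 1] sc.scale_left_diff_distrib)
    then show ?thesis by (simp only: sum.distrib add.left_commute)
  qed
  also have "\<dots> = (\<Sum>r\<le>Suc s. sc (sbinom (int (Suc s)) r) (?A r))"
    by (simp only: sum.atMost_Suc_shift) simp
  finally show ?case .
qed simp

subsection \<open>The coefficients of \<open>D\<^sup>m f\<close>\<close>

text \<open>\<open>D\<^sup>m f = \<Sum>j. chi m j f D\<^sup>j\<close>\<close>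

definition chi :: "int \<Rightarrow> int \<Rightarrow> 'a::supercommutative_superalgebra ser \<Rightarrow> 'a ser" where
  "chi m j f = (if j \<le> m then sc (sbinom m (nat (m - j))) (Dp (nat (m - j)) (tw j f)) else 0)"

lemma chi_add: "chi m j (f + g) = chi m j f + chi m j g"
  by (simp add: chi_def tw_add Dp_add sc.scale_right_distrib)
lemma chi_diff: "chi m j (f - g) = chi m j f - chi m j g"
  by (simp add: chi_def tw_diff Dp_diff sc.scale_right_diff_distrib)
lemma chi_zero [simp]: "chi m j 0 = 0" by (simp add: chi_def)
lemma chi_sc: "chi m j (sc c f) = sc c (chi m j f)"
  by (simp add: chi_def tw_sc Dp_sc mult.commute)
lemma chi_sum: "chi m j (sum F A) = (\<Sum>i\<in>A. chi m j (F i))"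
  by (induction A rule: infinite_finite_induct) (auto simp: chi_add)
lemma chi_gt [simp]: "m < j \<Longrightarrow> chi m j f = 0" by (simp add: chi_def)
lemma chi_same: "chi m m f = tw m f" by (simp add: chi_def)

lemma chi_const: "Ds f = 0 \<Longrightarrow> chi m j f = (if j = m then tw m f else 0)"
proof -
  assume f: "Ds f = 0"
  then have "Ds (tw j f) = 0" using Ds_par[of f] by (simp add: tw_def)
  then have "Dp (nat (m - j)) (tw j f) = 0" if "j < m"
    using that by (cases "nat (m - j)") (simp_all add: funpow_Suc_right del: funpow.simps)
  then show ?thesis by (auto simp: chi_same) (auto simp: chi_def)
qed

lemma chi_0: "chi 0 j f = (if j = 0 then f else 0)"
proof (cases "j < 0")
  case True
  define r where "r = nat (- j) - 1"
  have r: "nat (- j) = Suc r" using True by (simp add: r_def)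
  have "sbinom 0 (Suc r) = 0"
  proof (cases r rule: nat_parity_cases)
    fix k assume "r = 2 * k" then show ?thesis using sbinom_simps(2)[of 0 k] by simp
  next
    fix k assume "r = Suc (2 * k)" then show ?thesis using sbinom_simps(1)[of 0 "Suc k"] by simp
  qed
  then show ?thesis using True by (simp add: chi_def r)
qed (auto simp: chi_def)

text \<open>A nonnegative power of \<open>D\<close> times a function is a differential operator,
  because the binomial coefficients vanish beyond \<open>m\<close>.\<close>

lemma chi_nonneg: "0 \<le> m \<Longrightarrow> j < 0 \<Longrightarrow> chi m j f = 0"
proof -
  assume m: "0 \<le> m" "j < 0"
  define n r where "n = nat m" "r = nat (m - j)"
  have nr: "m = int n" "n < r" "nat (m - j) = r" using m by (auto simp: n_r_def)
  have z: "of_nat a gchoose b = (0::complex)" if "a < b" for a b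
    using that by (metis binomial_eq_0 binomial_gbinomial of_nat_0)
  have "sbinom m r = 0"
  proof -
    have "int n div 2 = int (n div 2)" by simp
    \<comment> \<open>If the halves agree although \<open>n < r\<close>, then \<open>n = 2q\<close>
      and \<open>r = 2q + 1\<close>, and the parity clause of \<open>sbinom\<close> applies.\<close>
    moreover have "n div 2 < r div 2 \<or> odd (int r * (int n - int r))"
      using nr(2) by (cases n rule: nat_parity_cases; cases r rule: nat_parity_cases) auto
    ultimately show ?thesis unfolding nr(1) sbinom_def by (auto simp: z)
  qed
  then show ?thesis by (simp add: chi_def nr(3))
qed

text \<open>Compares coefficients in \<open>D^a (D^b h) = D^(a+b) h\<close>. Any finite range
  covering the nonzero terms is allowed, so that several such identities can share one
  range.\<close>

lemma chi_comp:
  assumes "finite I" "{l - b..a} \<subseteq> I"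
  shows "(\<Sum>i\<in>I. chi a i (chi b (l - i) h)) = chi (a + b) l h"
proof (cases "l \<le> a + b")
  case False
  have "chi a i (chi b (l - i) h) = 0" for i
    using False by (cases "i \<le> a") auto
  then show ?thesis using False by simp
next
  case True
  define s where "s = nat (a + b - l)"
  have "(\<Sum>i\<in>I. chi a i (chi b (l - i) h)) = (\<Sum>i\<in>{l - b..a}. chi a i (chi b (l - i) h))"
    using assms by (intro sum.mono_neutral_right) auto
  also have "\<dots> = (\<Sum>r\<le>s. chi a (a - int r) (chi b (l - (a - int r)) h))"
    by (rule sum.reindex_bij_witness[of _ "\<lambda>r. a - int r" "\<lambda>i. nat (a - i)"])
       (use True in \<open>auto simp: s_def\<close>)
  also have "\<dots> = (\<Sum>r\<le>s. sc (sbinom a r * sbinom b (s - r) * eps ((a - int r) * int (s - r))) (Dp s (tw l h)))"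
  proof (intro sum.cong refl)
    fix r assume r: "r \<in> {..s}"
    have e: "l - (a - int r) \<le> b" "nat (b - (l - (a - int r))) = s - r"
      using r True unfolding s_def by auto
    have "Dp r (Dp (s - r) x) = Dp s x" for x :: "'a ser"
      using r by (simp flip: funpow_add[THEN fun_cong, unfolded comp_def])
    then show "chi a (a - int r) (chi b (l - (a - int r)) h) =
      sc (sbinom a r * sbinom b (s - r) * eps ((a - int r) * int (s - r))) (Dp s (tw l h))"
      using e by (simp add: chi_def tw_sc Dp_sc tw_Dp tw_tw)
  qed
  also have "\<dots> = sc (sbinom (a + b) s) (Dp s (tw l h))"
    by (simp only: sc.scale_sum_left[symmetric] sbinom_Vandermonde)
  finally show ?thesis using True by (simp add: chi_def s_def)
qed

text \<open>Compares coefficients in \<open>(D^a g) h = D^a (g h)\<close>. Together with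
  \<open>chi_comp\<close> it yields associativity of operators.\<close>

lemma chi_mult:
  assumes "finite I" "{l..a} \<subseteq> I"
  shows "chi a l (g * h) = (\<Sum>i\<in>I. chi a i g * chi i l h)"
proof (cases "l \<le> a")
  case False
  have "chi a i g * chi i l h = 0" for i
    using False by (cases "i \<le> a") auto
  then show ?thesis using False by simp
next
  case True
  define s where "s = nat (a - l)"
  have l: "l = a - int s" using True by (simp add: s_def)
  have "(\<Sum>i\<in>I. chi a i g * chi i l h) = (\<Sum>i\<in>{l..a}. chi a i g * chi i l h)"
    using assms by (intro sum.mono_neutral_right) auto
  also have "\<dots> = (\<Sum>r\<le>s. chi a (a - int r) g * chi (a - int r) l h)"
    by (rule sum.reindex_bij_witness[of _ "\<lambda>r. a - int r" "\<lambda>i. nat (a - i)"])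
       (use True in \<open>auto simp: s_def\<close>)
  also have "\<dots> = (\<Sum>r\<le>s. sc (sbinom a s) (sc (sbinom (int s) r) (Dp r (tw (int (s - r)) (tw l g)) * Dp (s - r) (tw l h))))"
  proof (intro sum.cong refl)
    fix r assume "r \<in> {..s}"
    then have r: "r \<le> s" by simp
    have e: "nat (a - int r - l) = s - r" "l \<le> a - int r" using r by (simp_all add: l)
    have "tw (a - int r) g = tw (int (s - r)) (tw l g)" using r by (simp add: tw_tw l)
    moreover have "sbinom (a - int r) (s - r) * sbinom a r = sbinom a s * sbinom (int s) r"
      using sbinom_trinomial[OF r] by (simp add: mult.commute)
    ultimately show "chi a (a - int r) g * chi (a - int r) l h =
        sc (sbinom a s) (sc (sbinom (int s) r) (Dp r (tw (int (s - r)) (tw l g)) * Dp (s - r) (tw l h)))"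
      using e by (simp add: chi_def sc_mult_left sc_mult_right)
  qed
  also have "\<dots> = sc (sbinom a s) (Dp s (tw l g * tw l h))"
    by (simp add: Dp_mult sc.scale_sum_right)
  finally show ?thesis using True by (simp add: chi_def s_def tw_mult)
qed

lemma tw_chi: "tw n (chi m j f) = sc (eps (n * (m - j))) (chi m j (tw n f))"
  by (auto simp: chi_def tw_sc tw_Dp tw_tw add.commute mult.commute)

text \<open>The sign depends on \<open>m\<close> alone: the derivation passes the
  \<open>m - j\<close> factors \<open>D\<close> that act on \<open>f\<close>, and the twist
  belonging to \<open>D^j\<close> supplies the other \<open>j\<close>.\<close>

lemma pds_T_chi: "pds (T s n) (chi m j f) = sc (eps (int n * m)) (chi m j (pds (T s n) f))"
proof -
  have t: "pds (T s n) (tw j f) = sc (eps (int n * j)) (tw j (pds (T s n) f))"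
    by (auto simp: tw_def pds_par odd_count_X eps_def)
  have e: "eps (int n * (m - j)) * eps (int n * j) = eps (int n * m)"
    unfolding eps_add[symmetric] by (simp add: algebra_simps)
  show ?thesis
  proof (cases "j \<le> m")
    case True
    then show ?thesis
      by (simp add: chi_def pds_sc pds_T_Dp t Dp_sc mult.assoc mult.left_commute flip: e)
  qed simp
qed

subsection \<open>The weight filtration\<close>

definition wt :: "nat \<Rightarrow> 'a::supercommutative_superalgebra ser \<Rightarrow> bool" where
  "wt w f \<longleftrightarrow> (\<forall>m. coef f m \<noteq> 0 \<longrightarrow> w \<le> weight m)"

text \<open>Giving \<open>\<xi>\<close> the weight \<open>1\<close> makes the degree bound of operators
  submultiplicative with respect to the bounds \<open>C\<close>, since \<open>D\<close> can remove a factor \<open>\<xi>\<close>. As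
  \<open>\<xi>\<^sup>2 = 0\<close>, this changes \<open>C\<close> by at most one.\<close>

definition xwt :: "int \<Rightarrow> 'a::supercommutative_superalgebra ser \<Rightarrow> bool" where
  "xwt c f \<longleftrightarrow> (\<forall>m. coef f m \<noteq> 0 \<longrightarrow> c \<le> int (weight m + count m Xi))"

lemma wt_0 [simp]: "wt 0 f" by (simp add: wt_def)
lemma wt_zero [simp]: "wt w 0" by (simp add: wt_def)
lemma wt_mono: "wt w f \<Longrightarrow> v \<le> w \<Longrightarrow> wt v f" unfolding wt_def using le_trans by blast
lemma wt_minus: "wt w f \<Longrightarrow> wt w (- f)" by (simp add: wt_def)
lemma wt_add: "wt w f \<Longrightarrow> wt w g \<Longrightarrow> wt w (f + g)"
  unfolding wt_def coef_add by (metis add.right_neutral)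
lemma wt_diff: "wt w f \<Longrightarrow> wt w g \<Longrightarrow> wt w (f - g)"
  using wt_add[of w f "- g"] wt_minus[of w g] by simp
lemma wt_sum: "(\<And>i. i \<in> A \<Longrightarrow> wt w (F i)) \<Longrightarrow> wt w (sum F A)"
  by (induction A rule: infinite_finite_induct) (auto intro: wt_add)
lemma wt_sc: "wt w f \<Longrightarrow> wt w (sc c f)"
  unfolding wt_def coef_sc by (metis scaleC.scale_zero_right)
lemma wt_par: "wt w f \<Longrightarrow> wt w (par f)"
  unfolding wt_def coef_par by (metis parity_inv_zero scaleC.scale_zero_right)
lemma wt_tw: "wt w f \<Longrightarrow> wt w (tw n f)" by (simp add: tw_def wt_par)

lemma coef_mult_nonzero:
  assumes "coef (f * g) k \<noteq> 0"
  obtains m n where "k = m + n" "coef f m \<noteq> 0" "coef g n \<noteq> 0"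
proof -
  obtain m where m: "m \<subseteq># k" "mon_sign m (k - m) *\<^sub>C (coef f m * (parity_inv ^^ odd_count m) (coef g (k - m))) \<noteq> 0"
    using assms unfolding coef_mult by (metis (no_types, lifting) mem_Collect_eq sum.not_neutral_contains_not_neutral)
  then have "coef f m \<noteq> 0" "coef g (k - m) \<noteq> 0" by (auto simp: parity_inv_funpow_zero)
  then show ?thesis using that[of m "k - m"] m by simp
qed

lemma wt_mult: "wt v f \<Longrightarrow> wt w g \<Longrightarrow> wt (v + w) (f * g)"
  unfolding wt_def by (metis coef_mult_nonzero weight_add add_mono)
lemma wt_mult_left: "wt w f \<Longrightarrow> wt w (f * g)" using wt_mult[of w f 0 g] by simp
lemma wt_mult_right: "wt w g \<Longrightarrow> wt w (f * g)" using wt_mult[of 0 f w g] by simp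

lemma coef_pds_nonzero: "coef (pds v f) m \<noteq> 0 \<Longrightarrow> coef f (add_mset v m) \<noteq> 0"
  by (auto simp: coef_pds parity_inv_funpow_zero)

lemma weight_add_mset: "weight (add_mset v m) = weight_var v + weight m"
  using weight_add[of "{#v#}" m] by simp

lemma wt_pds: "wt (weight_var v + w) f \<Longrightarrow> wt w (pds v f)"
  unfolding wt_def using coef_pds_nonzero weight_add_mset by (metis add_le_cancel_left)

lemma wt_pds_X: "wt w f \<Longrightarrow> wt w (pds X f)" "wt w f \<Longrightarrow> wt w (pds Xi f)"
  using wt_pds[of X w f] wt_pds[of Xi w f] by simp_all

lemma wt_Ds: "wt w f \<Longrightarrow> wt w (Ds f)"
  unfolding Ds_def by (intro wt_add wt_mult_right wt_pds_X)

lemma wt_Dp: "wt w f \<Longrightarrow> wt w (Dp r f)"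
  by (induction r) (auto intro: wt_Ds)

lemma wt_chi: "wt w f \<Longrightarrow> wt w (chi m j f)"
  by (simp add: chi_def wt_sc wt_Dp wt_tw)

lemma wt_var: "wt (weight_var v) (var v)"
  by (cases "valid {#v#}") (auto simp: wt_def coef_var var_invalid)

lemma wt_all_zero: "(\<And>w. wt w f) \<Longrightarrow> f = 0"
  by (rule ser_eqI) (metis wt_def coef_zero not_less_eq_eq le_refl)

lemma xwt_zero [simp]: "xwt c 0" by (simp add: xwt_def)
lemma xwt_mono: "xwt c f \<Longrightarrow> d \<le> c \<Longrightarrow> xwt d f" unfolding xwt_def using order_trans by blast
lemma xwt_minus: "xwt c f \<Longrightarrow> xwt c (- f)" by (simp add: xwt_def)
lemma xwt_add: "xwt c f \<Longrightarrow> xwt c g \<Longrightarrow> xwt c (f + g)"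
  unfolding xwt_def coef_add by (metis add.right_neutral)
lemma xwt_diff: "xwt c f \<Longrightarrow> xwt c g \<Longrightarrow> xwt c (f - g)"
  using xwt_add[of c f "- g"] xwt_minus[of c g] by simp
lemma xwt_sc: "xwt c f \<Longrightarrow> xwt c (sc a f)"
  unfolding xwt_def coef_sc by (metis scaleC.scale_zero_right)
lemma xwt_par: "xwt c f \<Longrightarrow> xwt c (par f)"
  unfolding xwt_def coef_par by (metis parity_inv_zero scaleC.scale_zero_right)
lemma xwt_tw: "xwt c f \<Longrightarrow> xwt c (tw n f)" by (simp add: tw_def xwt_par)
lemma xwt_mult: "xwt c f \<Longrightarrow> xwt d g \<Longrightarrow> xwt (c + d) (f * g)"
  unfolding xwt_def
proof (intro allI impI)
  fix k assume fg: "\<forall>m. coef f m \<noteq> 0 \<longrightarrow> c \<le> int (weight m + count m Xi)"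
    "\<forall>m. coef g m \<noteq> 0 \<longrightarrow> d \<le> int (weight m + count m Xi)" and k: "coef (f * g) k \<noteq> 0"
  then obtain m n where k': "k = m + n" "coef f m \<noteq> 0" "coef g n \<noteq> 0" by (elim coef_mult_nonzero)
  then have "c \<le> int (weight m + count m Xi)" "d \<le> int (weight n + count n Xi)" using fg by blast+
  then show "c + d \<le> int (weight k + count k Xi)" unfolding k'(1) by (simp add: weight_add)
qed
lemma xwt_nonpos: "c \<le> 0 \<Longrightarrow> xwt c f" by (simp add: xwt_def)
lemma xwt_pds: "xwt c f \<Longrightarrow> xwt (c - int (weight_var v) - of_bool (v = Xi)) (pds v f)"
  unfolding xwt_def
proof (intro allI impI)
  fix m assume f: "\<forall>m. coef f m \<noteq> 0 \<longrightarrow> c \<le> int (weight m + count m Xi)" and m: "coef (pds v f) m \<noteq> 0"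
  then have "c \<le> int (weight (add_mset v m) + count (add_mset v m) Xi)"
    using coef_pds_nonzero by blast
  then show "c - int (weight_var v) - of_bool (v = Xi) \<le> int (weight m + count m Xi)"
    by (auto simp: weight_add_mset split: if_splits)
qed
lemma xwt_Ds: "xwt c f \<Longrightarrow> xwt (c - 1) (Ds f)"
  unfolding Ds_def
  using xwt_pds[of c f X] xwt_pds[of c f Xi] xwt_mult[of "-1" "var Xi" c "pds X f"]
  by (intro xwt_add) (auto simp: xwt_nonpos)
lemma xwt_Dp: "xwt c f \<Longrightarrow> xwt (c - int r) (Dp r f)"
proof (induction r)
  case (Suc r)
  then show ?case using xwt_Ds[of "c - int r" "Dp r f"] by (simp add: algebra_simps)
qed simp
lemma xwt_chi: "xwt c f \<Longrightarrow> xwt (c + j - m) (chi m j f)"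
  using xwt_Dp[OF xwt_tw, of c f "nat (m - j)" j] by (auto simp: chi_def algebra_simps intro: xwt_sc)

lemma xwt_imp_wt: "xwt c f \<Longrightarrow> wt (nat (c - 1)) f"
  unfolding xwt_def wt_def
proof (intro allI impI)
  fix m assume f: "\<forall>m. coef f m \<noteq> 0 \<longrightarrow> c \<le> int (weight m + count m Xi)" and m: "coef f m \<noteq> 0"
  then have "valid m" using coef_invalid by blast
  then have "count m Xi \<le> 1" by (rule valid_count_le_1) simp
  moreover have "c \<le> int (weight m + count m Xi)" using f m by blast
  ultimately show "nat (c - 1) \<le> weight m" by simp
qed

lemma wt_imp_xwt: "wt w f \<Longrightarrow> xwt (int w) f"
  unfolding xwt_def wt_def by (metis of_nat_le_iff trans_le_add1)

text \<open>Congruence modulo one of the ideals of the overview. These intersect in zero, so an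
  equation may be checked separately for every \<open>w\<close>.\<close>

definition cg :: "nat \<Rightarrow> 'a::supercommutative_superalgebra ser \<Rightarrow> 'a ser \<Rightarrow> bool" where
  "cg w f g \<longleftrightarrow> wt w (f - g)"

lemma cg_refl [simp]: "cg w f f" by (simp add: cg_def)
lemma cg_sym: "cg w f g \<Longrightarrow> cg w g f" unfolding cg_def using wt_minus by fastforce
lemma cg_trans [trans]: "cg w f g \<Longrightarrow> cg w g h \<Longrightarrow> cg w f h"
  unfolding cg_def using wt_add by fastforce
lemma cg_eq_trans [trans]: "cg w f g \<Longrightarrow> g = h \<Longrightarrow> cg w f h" "f = g \<Longrightarrow> cg w g h \<Longrightarrow> cg w f h" by simp_all
lemma cg_add: "cg w f f' \<Longrightarrow> cg w g g' \<Longrightarrow> cg w (f + g) (f' + g')"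
  unfolding cg_def using wt_add[of w "f - f'" "g - g'"] by (simp add: algebra_simps)
lemma cg_sum: "(\<And>i. i \<in> A \<Longrightarrow> cg w (F i) (G i)) \<Longrightarrow> cg w (sum F A) (sum G A)"
  unfolding cg_def sum_subtractf[symmetric] by (rule wt_sum)
lemma cg_mult: "cg w f f' \<Longrightarrow> cg w g g' \<Longrightarrow> cg w (f * g) (f' * g')"
  unfolding cg_def
proof -
  assume "wt w (f - f')" "wt w (g - g')"
  then have "wt w ((f - f') * g + f' * (g - g'))" by (intro wt_add wt_mult_left wt_mult_right)
  then show "wt w (f * g - f' * g')" by (simp add: algebra_simps)
qed
lemma cg_chi: "cg w f g \<Longrightarrow> cg w (chi m j f) (chi m j g)"
  unfolding cg_def using wt_chi by (fastforce simp: chi_diff)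
lemma cg_pds: "cg (weight_var v + w) f g \<Longrightarrow> cg w (pds v f) (pds v g)"
  unfolding cg_def using wt_pds by (fastforce simp: pds_diff)
lemma cg_eqI: "(\<And>w. cg w f g) \<Longrightarrow> f = g"
  unfolding cg_def using wt_all_zero[of "f - g"] by simp
subsection \<open>The algebra of super-pseudodifferential operators\<close>

definition bd :: "int \<Rightarrow> (int \<Rightarrow> 'a::supercommutative_superalgebra ser) \<Rightarrow> bool" where
  "bd C P \<longleftrightarrow> (\<forall>n. xwt (n - C) (P n))"

lemma bd_wt: "bd C P \<Longrightarrow> int w + C < n \<Longrightarrow> wt w (P n)"
  unfolding bd_def by (rule wt_mono[OF xwt_imp_wt[of "n - C"]]) auto

lemma bd_mono: "bd C P \<Longrightarrow> C \<le> D \<Longrightarrow> bd D P"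
  unfolding bd_def using xwt_mono diff_left_mono by blast

definition mterm :: "(int \<Rightarrow> 'a::supercommutative_superalgebra ser) \<Rightarrow> (int \<Rightarrow> 'a ser) \<Rightarrow> int \<Rightarrow> int \<times> nat \<Rightarrow> 'a ser"
  where "mterm P Q k = (\<lambda>(m, r). P m * chi m (m - int r) (Q (k - m + int r)))"

lemma sop_mult_eq:
  "sop_mult (\<lambda>n. coef (P n)) (\<lambda>n. coef (Q n)) k \<mu> = Sum_any (\<lambda>x. coef (mterm P Q k x) \<mu>)"
proof -
  have D: "(superD ^^ r) (coef f) = coef (Dp r f)" for r and f :: "'a ser"
    by (induction r) (simp_all add: coef_Ds)
  have t: "(if even n then id else sser_parity_inv) (coef f) = coef (tw n f)" for n and f :: "'a ser"
    by (simp add: tw_def par.rep_eq)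
  have "sser_scale (sbinom m r) (coef (P m) \<star> (superD ^^ r)
          ((if even (m - int r) then id else sser_parity_inv) (coef (Q (k - m + int r)))))
     = coef (mterm P Q k (m, r))" for m r
    by (simp only: t D times_ser.rep_eq[symmetric] sc.rep_eq[symmetric])
       (simp add: mterm_def chi_def sc_mult_right)
  then show ?thesis by (simp add: sop_mult_def sser_sum_def split_def)
qed

lift_definition mulraw :: "(int \<Rightarrow> 'a::supercommutative_superalgebra ser) \<Rightarrow> (int \<Rightarrow> 'a ser) \<Rightarrow> int \<Rightarrow> 'a ser"
  is "\<lambda>P Q k. sop_mult (\<lambda>n. coef (P n)) (\<lambda>n. coef (Q n)) k"
  by (simp add: sop_mult_eq coef_invalid)

lemma coef_mulraw: "coef (mulraw P Q k) \<mu> = Sum_any (\<lambda>x. coef (mterm P Q k x) \<mu>)"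
  by (simp add: mulraw.rep_eq sop_mult_eq)

lemma coef_mulraw_nonzero:
  assumes "coef (mulraw P Q k) \<mu> \<noteq> 0"
  obtains m r where "coef (P m * chi m (m - int r) (Q (k - m + int r))) \<mu> \<noteq> 0"
proof -
  obtain x where "coef (mterm P Q k x) \<mu> \<noteq> 0"
    using assms unfolding coef_mulraw by (rule Sum_any.not_neutral_obtains_not_neutral)
  then show ?thesis using that by (cases x) (simp add: mterm_def)
qed

lemma bd_mulraw: "bd C P \<Longrightarrow> bd D Q \<Longrightarrow> bd (C + D) (mulraw P Q)"
  unfolding bd_def
proof (intro allI)
  fix k assume PQ: "\<forall>n. xwt (n - C) (P n)" "\<forall>n. xwt (n - D) (Q n)"
  have "xwt (k - (C + D)) (P m * chi m (m - int r) (Q (k - m + int r)))" for m r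
    by (rule xwt_mono[OF xwt_mult[OF PQ(1)[rule_format] xwt_chi[OF PQ(2)[rule_format]]]]) simp
  then show "xwt (k - (C + D)) (mulraw P Q k)"
    unfolding xwt_def by (metis coef_mulraw_nonzero)
qed

lemma wt_mulraw: "(\<And>n. wt v (P n)) \<Longrightarrow> (\<And>n. wt w (Q n)) \<Longrightarrow> wt (v + w) (mulraw P Q k)"
proof -
  assume PQ: "\<And>n. wt v (P n)" "\<And>n. wt w (Q n)"
  have "wt (v + w) (P m * chi m (m - int r) (Q (k - m + int r)))" for m r
    by (intro wt_mult wt_chi PQ)
  then show ?thesis unfolding wt_def by (metis coef_mulraw_nonzero)
qed

text \<open>A monomial of weight below \<open>w\<close> receives terms only from
  \<open>a \<le> M\<close>, \<open>b \<le> N\<close> and \<open>k - b \<le> a\<close>, hence from a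
  finite window; larger finite ranges add terms that vanish at such monomials. The summation pair
  \<open>(m, r)\<close> is exchanged for the pair of exponents
  \<open>(a, b) = (m, k - m + r)\<close>.\<close>

lemma mulraw_window:
  assumes P: "\<And>a. M < a \<Longrightarrow> wt w (P a)" and Q: "\<And>b. N < b \<Longrightarrow> wt w (Q b)"
    and A: "finite A" "{k - N..M} \<subseteq> A" and B: "finite B" "{k - M..N} \<subseteq> B"
  shows "cg w (mulraw P Q k) (\<Sum>a\<in>A. \<Sum>b\<in>B. P a * chi a (k - b) (Q b))"
  unfolding cg_def wt_def
proof (intro allI impI)
  fix \<mu> assume ne: "coef (mulraw P Q k - (\<Sum>a\<in>A. \<Sum>b\<in>B. P a * chi a (k - b) (Q b))) \<mu> \<noteq> 0"
  show "w \<le> weight \<mu>"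
  proof (rule ccontr)
    assume less: "\<not> w \<le> weight \<mu>"
    define c where "c = (\<lambda>(a, b). coef (P a * chi a (k - b) (Q b)) \<mu>)"
    have c0: "a \<in> {k - N..M} \<and> b \<in> {k - M..N} \<and> k - b \<le> a" if "c (a, b) \<noteq> 0" for a b
    proof -
      have "\<not> wt w (P a * chi a (k - b) (Q b))" using that less unfolding c_def wt_def by auto
      then have "\<not> wt w (P a)" "\<not> wt w (Q b)" by (auto intro: wt_mult_left wt_mult_right wt_chi)
      then have "a \<le> M" "b \<le> N" using P Q by force+
      moreover have "k - b \<le> a" using that unfolding c_def by (cases "a < k - b") auto
      ultimately show ?thesis by auto
    qed
    have inj: "inj_on (\<lambda>(m, r). (m, k - m + int r)) X" for X :: "(int \<times> nat) set"
      by (auto simp: inj_on_def)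
    have mt: "coef (mterm P Q k x) \<mu> = c ((\<lambda>(m, r). (m, k - m + int r)) x)" for x
      by (cases x) (simp add: mterm_def c_def)
    let ?X = "{x. c ((\<lambda>(m, r). (m, k - m + int r)) x) \<noteq> 0}"
    have sub: "(\<lambda>(m, r). (m, k - m + int r)) ` ?X \<subseteq> {k - N..M} \<times> {k - M..N}"
      using c0 by auto
    then have "finite ((\<lambda>(m, r). (m, k - m + int r)) ` ?X)" by (rule finite_subset) simp
    then have "finite ?X" using inj by (rule finite_imageD)
    have "coef (mulraw P Q k) \<mu> = sum (\<lambda>x. c ((\<lambda>(m, r). (m, k - m + int r)) x)) ?X"
      unfolding coef_mulraw mt using \<open>finite ?X\<close> by (subst Sum_any.expand_set) simp
    also have "\<dots> = sum c ((\<lambda>(m, r). (m, k - m + int r)) ` ?X)"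
      by (subst sum.reindex[OF inj]) simp
    also have "\<dots> = sum c (A \<times> B)"
    proof (rule sum.mono_neutral_left)
      show "\<forall>i\<in>A \<times> B - (\<lambda>(m, r). (m, k - m + int r)) ` ?X. c i = 0"
      proof (rule ballI, rule ccontr)
        fix i assume i: "i \<in> A \<times> B - (\<lambda>(m, r). (m, k - m + int r)) ` ?X" "c i \<noteq> 0"
        obtain a b where ab: "i = (a, b)" by (cases i)
        then have "k - b \<le> a" using c0 i by blast
        then have "i = (\<lambda>(m, r). (m, k - m + int r)) (a, nat (a - (k - b)))" using ab by simp
        then show False using i by blast
      qed
    qed (use A B sub in auto)
    finally have "coef (mulraw P Q k) \<mu> = coef (\<Sum>a\<in>A. \<Sum>b\<in>B. P a * chi a (k - b) (Q b)) \<mu>"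
      by (simp add: sum.cartesian_product c_def split_def)
    then show False using ne by simp
  qed
qed

lemma mulraw_high:
  assumes P: "\<And>a. M < a \<Longrightarrow> wt w (P a)" and Q: "\<And>b. N < b \<Longrightarrow> wt w (Q b)" and "M + N < k"
  shows "wt w (mulraw P Q k)"
  using mulraw_window[of M w P N Q "{}" k "{}", OF P Q] assms(3) by (simp add: cg_def)

lemma sum_rotate3: "(\<Sum>l\<in>L. \<Sum>a\<in>A. \<Sum>b\<in>B. f l a b) = (\<Sum>a\<in>A. \<Sum>b\<in>B. \<Sum>l\<in>L. f l a b)"
  by (subst sum.swap) (intro sum.cong refl sum.swap)

lemma sum_rotate4: "(\<Sum>l\<in>L. \<Sum>a\<in>A. \<Sum>b\<in>B. \<Sum>c\<in>C. f l a b c) = (\<Sum>a\<in>A. \<Sum>b\<in>B. \<Sum>c\<in>C. \<Sum>l\<in>L. f l a b c)"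
  by (subst sum.swap) (intro sum.cong refl sum_rotate3)

text \<open>Modulo weight \<open>w\<close> both products become the same finite sum
  \<open>?g\<close>. On the left, \<open>i\<close> is the power of \<open>D\<close> that remains
  after \<open>D^a\<close> has passed \<open>Q b\<close>; on the right, \<open>chi_mult\<close>
  distributes \<open>D^a\<close> over the inner product and \<open>chi_comp\<close> merges the two
  powers of \<open>D\<close> acting on \<open>R c\<close>.\<close>

lemma mulraw_assoc:
  assumes "bd C P" "bd D Q" "bd E R"
  shows "mulraw (mulraw P Q) R k = mulraw P (mulraw Q R) k"
proof (rule cg_eqI)
  fix w
  define M where "M = max 0 (int w + max C (max D E))"
  have M: "0 \<le> M" and P: "\<And>a. M < a \<Longrightarrow> wt w (P a)" and Q: "\<And>a. M < a \<Longrightarrow> wt w (Q a)"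
    and R: "\<And>a. M < a \<Longrightarrow> wt w (R a)"
    using assms by (auto simp: M_def intro!: bd_wt)
  \<comment> \<open>Modulo weight \<open>w\<close> the factors have order at most \<open>M\<close>
    and the products of two at most \<open>2 * M\<close>. The lower ends are such that every inner
    window, shifted by an index from \<open>L\<close>, still lies in \<open>W\<close>.\<close>
  define W where "W = {k - 3 * M..M}"
  define L where "L = {k - 2 * M..2 * M}"
  define I where "I = {k - 2 * M..M}"
  have fin: "finite W" "finite L" "finite I" by (simp_all add: W_def L_def I_def)
  have PQ: "\<And>a. 2 * M < a \<Longrightarrow> wt w (mulraw P Q a)" and QR: "\<And>a. 2 * M < a \<Longrightarrow> wt w (mulraw Q R a)"
    using mulraw_high[OF P Q] mulraw_high[OF Q R] by simp_all
  let ?g = "\<lambda>a b c i l. P a * (chi a i (Q b) * chi l (k - c) (R c))"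
  have "cg w (mulraw (mulraw P Q) R k) (\<Sum>l\<in>L. \<Sum>c\<in>W. mulraw P Q l * chi l (k - c) (R c))"
    by (rule mulraw_window[OF PQ R fin(2) _ fin(1)]) (use M in \<open>auto simp: W_def L_def\<close>)
  also have "cg w \<dots> (\<Sum>l\<in>L. \<Sum>c\<in>W. (\<Sum>a\<in>W. \<Sum>b\<in>W. P a * chi a (l - b) (Q b)) * chi l (k - c) (R c))"
    by (intro cg_sum cg_mult cg_refl mulraw_window[OF P Q fin(1) _ fin(1)]) (use M in \<open>auto simp: W_def L_def\<close>)
  also have "\<dots> = (\<Sum>l\<in>L. \<Sum>c\<in>W. \<Sum>a\<in>W. \<Sum>b\<in>W. ?g a b c (l - b) l)"
    by (simp add: sum_distrib_right mult.assoc)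
  also have "\<dots> = (\<Sum>c\<in>W. \<Sum>l\<in>L. \<Sum>a\<in>W. \<Sum>b\<in>W. ?g a b c (l - b) l)"
    by (rule sum.swap)
  also have "\<dots> = (\<Sum>c\<in>W. \<Sum>a\<in>W. \<Sum>b\<in>W. \<Sum>l\<in>L. ?g a b c (l - b) l)"
    by (intro sum.cong refl sum_rotate3)
  also have "\<dots> = (\<Sum>c\<in>W. \<Sum>a\<in>W. \<Sum>b\<in>W. \<Sum>i\<in>I. ?g a b c i (i + b))"
  proof (rule sum.cong[OF refl], rule sum.cong[OF refl], rule sum.cong[OF refl])
    fix c a b assume abc: "c \<in> W" "a \<in> W" "b \<in> W"
    show "(\<Sum>l\<in>L. ?g a b c (l - b) l) = (\<Sum>i\<in>I. ?g a b c i (i + b))"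
    proof (rule sum.reindex_bij_witness_not_neutral
        [of "{l\<in>L. a < l - b \<or> l < k - c}" "{i\<in>I. a < i \<or> i + b < k - c}" _ "\<lambda>i. i + b" "\<lambda>l. l - b"])
      show "l - b \<in> I - {i \<in> I. a < i \<or> i + b < k - c}" if "l \<in> L - {l \<in> L. a < l - b \<or> l < k - c}" for l
        using that abc by (auto simp: W_def L_def I_def)
      show "i + b \<in> L - {l \<in> L. a < l - b \<or> l < k - c}" if "i \<in> I - {i \<in> I. a < i \<or> i + b < k - c}" for i
        using that abc M by (auto simp: W_def L_def I_def)
    qed (auto simp: fin)
  qed
  also have "\<dots> = (\<Sum>a\<in>W. \<Sum>c\<in>W. \<Sum>b\<in>W. \<Sum>i\<in>I. ?g a b c i (i + b))"
    by (rule sum.swap)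
  also have "\<dots> = (\<Sum>a\<in>W. \<Sum>b\<in>W. \<Sum>c\<in>W. \<Sum>i\<in>I. ?g a b c i (i + b))"
    by (intro sum.cong refl sum.swap)
  finally have 1: "cg w (mulraw (mulraw P Q) R k) (\<Sum>a\<in>W. \<Sum>b\<in>W. \<Sum>c\<in>W. \<Sum>i\<in>I. ?g a b c i (i + b))" .
  have "cg w (mulraw P (mulraw Q R) k) (\<Sum>a\<in>W. \<Sum>e\<in>L. P a * chi a (k - e) (mulraw Q R e))"
    by (rule mulraw_window[OF P QR fin(1) _ fin(2)]) (use M in \<open>auto simp: W_def L_def\<close>)
  also have "cg w \<dots> (\<Sum>a\<in>W. \<Sum>e\<in>L. P a * chi a (k - e) (\<Sum>b\<in>W. \<Sum>c\<in>W. Q b * chi b (e - c) (R c)))"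
    by (intro cg_sum cg_mult cg_refl cg_chi mulraw_window[OF Q R fin(1) _ fin(1)]) (use M in \<open>auto simp: W_def L_def\<close>)
  also have "\<dots> = (\<Sum>a\<in>W. \<Sum>e\<in>L. \<Sum>b\<in>W. \<Sum>c\<in>W. \<Sum>i\<in>I. P a * (chi a i (Q b) * chi i (k - e) (chi b (e - c) (R c))))"
  proof (intro sum.cong refl)
    fix a e assume ae: "a \<in> W" "e \<in> L"
    have "chi a (k - e) (Q b * chi b (e - c) (R c)) = (\<Sum>i\<in>I. chi a i (Q b) * chi i (k - e) (chi b (e - c) (R c)))" for b c
      by (rule chi_mult[OF fin(3)]) (use ae in \<open>auto simp: W_def L_def I_def\<close>)
    then show "P a * chi a (k - e) (\<Sum>b\<in>W. \<Sum>c\<in>W. Q b * chi b (e - c) (R c)) =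
       (\<Sum>b\<in>W. \<Sum>c\<in>W. \<Sum>i\<in>I. P a * (chi a i (Q b) * chi i (k - e) (chi b (e - c) (R c))))"
      by (simp add: chi_sum sum_distrib_left)
  qed
  also have "\<dots> = (\<Sum>a\<in>W. \<Sum>b\<in>W. \<Sum>c\<in>W. \<Sum>i\<in>I. \<Sum>e\<in>L. P a * (chi a i (Q b) * chi i (k - e) (chi b (e - c) (R c))))"
    by (intro sum.cong refl sum_rotate4)
  also have "\<dots> = (\<Sum>a\<in>W. \<Sum>b\<in>W. \<Sum>c\<in>W. \<Sum>i\<in>I. ?g a b c i (i + b))"
  proof (intro sum.cong refl)
    fix a b c i assume abc: "a \<in> W" "b \<in> W" "c \<in> W" "i \<in> I"
    have "(\<Sum>e\<in>L. chi i (k - e) (chi b (e - c) (R c))) = (\<Sum>j\<in>(\<lambda>e. k - e) ` L. chi i j (chi b ((k - c) - j) (R c)))"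
      by (subst sum.reindex) (auto simp: inj_on_def algebra_simps)
    also have "\<dots> = chi (i + b) (k - c) (R c)"
    proof (rule chi_comp)
      show "{k - c - b..i} \<subseteq> (\<lambda>e. k - e) ` L"
      proof
        fix j assume "j \<in> {k - c - b..i}"
        then have "k - j \<in> L" using abc M by (auto simp: W_def L_def I_def)
        then show "j \<in> (\<lambda>e. k - e) ` L" by (rule rev_image_eqI) simp
      qed
    qed (simp add: fin)
    finally show "(\<Sum>e\<in>L. P a * (chi a i (Q b) * chi i (k - e) (chi b (e - c) (R c)))) = ?g a b c i (i + b)"
      by (simp flip: sum_distrib_left)
  qed
  finally show "cg w (mulraw (mulraw P Q) R k) (mulraw P (mulraw Q R) k)"
    using 1 cg_sym cg_trans by blast
qed

typedef (overloaded) 'a ops = "{P :: int \<Rightarrow> 'a::supercommutative_superalgebra ser. \<exists>C. bd C P}"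
  morphisms opc Ops
  by (intro exI[of _ "\<lambda>n. 0"]) (simp add: bd_def)

setup_lifting type_definition_ops

lemma ops_eqI: "(\<And>n. opc P n = opc Q n) \<Longrightarrow> P = Q"
  by (simp add: opc_inject[symmetric] fun_eq_iff)

lemma ops_bd: obtains C where "bd C (opc P)"
  using opc[of P] by auto

lemma bd_max: "bd C P \<Longrightarrow> bd D Q \<Longrightarrow> bd (max C D) P \<and> bd (max C D) Q"
  using bd_mono[of C P "max C D"] bd_mono[of D Q "max C D"] by simp

lemma bd_add: "bd C P \<Longrightarrow> bd D Q \<Longrightarrow> bd (max C D) (\<lambda>n. P n + Q n)"
  and bd_diff: "bd C P \<Longrightarrow> bd D Q \<Longrightarrow> bd (max C D) (\<lambda>n. P n - Q n)"
  using bd_max[of C P D Q] by (auto simp: bd_def intro!: xwt_add xwt_diff)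

instantiation ops :: (supercommutative_superalgebra) "{ring, monoid_mult}"
begin

lift_definition zero_ops :: "'a ops" is "\<lambda>n. 0" by (simp add: bd_def)
lift_definition one_ops :: "'a ops" is "\<lambda>n. if n = 0 then 1 else 0"
  by (rule exI[of _ 0]) (simp add: bd_def xwt_nonpos)
lift_definition plus_ops :: "'a ops \<Rightarrow> 'a ops \<Rightarrow> 'a ops" is "\<lambda>P Q n. P n + Q n"
  using bd_add by blast
lift_definition minus_ops :: "'a ops \<Rightarrow> 'a ops \<Rightarrow> 'a ops" is "\<lambda>P Q n. P n - Q n"
  using bd_diff by blast
lift_definition uminus_ops :: "'a ops \<Rightarrow> 'a ops" is "\<lambda>P n. - P n"
  by (auto simp: bd_def intro: xwt_minus)
lift_definition times_ops :: "'a ops \<Rightarrow> 'a ops \<Rightarrow> 'a ops" is mulraw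
  using bd_mulraw by blast

definition wsum :: "int set \<Rightarrow> (int \<Rightarrow> 'a ser) \<Rightarrow> (int \<Rightarrow> 'a ser) \<Rightarrow> int \<Rightarrow> 'a ser" where
  "wsum A P Q k = (\<Sum>a\<in>A. \<Sum>b\<in>A. P a * chi a (k - b) (Q b))"

text \<open>Stated for all sufficiently large finite ranges, so that several products can be
  computed over one common range.\<close>

lemma opc_mult_wsum:
  "\<exists>A0. finite A0 \<and> (\<forall>A. finite A \<and> A0 \<subseteq> A \<longrightarrow> cg w (opc (P * Q) k) (wsum A (opc P) (opc Q) k))"
proof -
  obtain C D where "bd C (opc P)" "bd D (opc Q)" using ops_bd by metis
  define M where "M = int w + max C D"
  have M: "\<And>a. M < a \<Longrightarrow> wt w (opc P a)" "\<And>a. M < a \<Longrightarrow> wt w (opc Q a)"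
    using \<open>bd C (opc P)\<close> \<open>bd D (opc Q)\<close> by (auto intro!: bd_wt simp: M_def)
  show ?thesis
    by (rule exI[of _ "{k - M..M}"]) (auto simp: times_ops.rep_eq wsum_def intro!: mulraw_window[OF M])
qed

instance
proof
  fix a b c :: "'a ops"
  show "a + b + c = a + (b + c)" by transfer (simp add: add.assoc)
  show "a + b = b + a" by transfer (simp add: add.commute)
  show "0 + a = a" by transfer simp
  show "- a + a = 0" by transfer simp
  show "a - b = a + - b" by transfer simp
  show "a * b * c = a * (b * c)" by transfer (auto simp: fun_eq_iff mulraw_assoc)
  show "(a + b) * c = a * c + b * c"
  proof (intro ops_eqI cg_eqI)
    fix k w
    obtain A1 where 1: "finite A1" "\<forall>A. finite A \<and> A1 \<subseteq> A \<longrightarrow> cg w (opc ((a + b) * c) k) (wsum A (opc (a + b)) (opc c) k)"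
      using opc_mult_wsum[of w "(a + b)" "c" k] by blast
    obtain A2 where 2: "finite A2" "\<forall>A. finite A \<and> A2 \<subseteq> A \<longrightarrow> cg w (opc (a * c) k) (wsum A (opc a) (opc c) k)"
      using opc_mult_wsum[of w "a" "c" k] by blast
    obtain A3 where 3: "finite A3" "\<forall>A. finite A \<and> A3 \<subseteq> A \<longrightarrow> cg w (opc (b * c) k) (wsum A (opc b) (opc c) k)"
      using opc_mult_wsum[of w "b" "c" k] by blast
    let ?A = "A1 \<union> A2 \<union> A3"
    have "cg w (opc ((a + b) * c) k) (wsum ?A (opc (a + b)) (opc c) k)" using 1(2)[rule_format, of ?A] 1(1) 2(1) 3(1) by auto
    also have "\<dots> = wsum ?A (opc a) (opc c) k + wsum ?A (opc b) (opc c) k"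
      by (simp add: wsum_def plus_ops.rep_eq distrib_right sum.distrib)
    also have "cg w \<dots> (opc (a * c + b * c) k)"
      unfolding plus_ops.rep_eq using 2(2)[rule_format, of ?A] 3(2)[rule_format, of ?A] 1(1) 2(1) 3(1)
      by (intro cg_add cg_sym[of w _ "wsum _ _ _ _"]) auto
    finally show "cg w (opc ((a + b) * c) k) (opc (a * c + b * c) k)" .
  qed
  show "a * (b + c) = a * b + a * c"
  proof (intro ops_eqI cg_eqI)
    fix k w
    obtain A1 where 1: "finite A1" "\<forall>A. finite A \<and> A1 \<subseteq> A \<longrightarrow> cg w (opc (a * (b + c)) k) (wsum A (opc a) (opc (b + c)) k)"
      using opc_mult_wsum[of w "a" "(b + c)" k] by blast
    obtain A2 where 2: "finite A2" "\<forall>A. finite A \<and> A2 \<subseteq> A \<longrightarrow> cg w (opc (a * b) k) (wsum A (opc a) (opc b) k)"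
      using opc_mult_wsum[of w "a" "b" k] by blast
    obtain A3 where 3: "finite A3" "\<forall>A. finite A \<and> A3 \<subseteq> A \<longrightarrow> cg w (opc (a * c) k) (wsum A (opc a) (opc c) k)"
      using opc_mult_wsum[of w "a" "c" k] by blast
    let ?A = "A1 \<union> A2 \<union> A3"
    have "cg w (opc (a * (b + c)) k) (wsum ?A (opc a) (opc (b + c)) k)" using 1(2)[rule_format, of ?A] 1(1) 2(1) 3(1) by auto
    also have "\<dots> = wsum ?A (opc a) (opc b) k + wsum ?A (opc a) (opc c) k"
      by (simp add: wsum_def plus_ops.rep_eq chi_add distrib_left sum.distrib)
    also have "cg w \<dots> (opc (a * b + a * c) k)"
      unfolding plus_ops.rep_eq using 2(2)[rule_format, of ?A] 3(2)[rule_format, of ?A] 1(1) 2(1) 3(1)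
      by (intro cg_add cg_sym[of w _ "wsum _ _ _ _"]) auto
    finally show "cg w (opc (a * (b + c)) k) (opc (a * b + a * c) k)" .
  qed
  show "1 * a = a"
  proof (intro ops_eqI cg_eqI)
    fix k w
    obtain A0 where A0: "finite A0" "\<forall>A. finite A \<and> A0 \<subseteq> A \<longrightarrow> cg w (opc (1 * a) k) (wsum A (opc 1) (opc a) k)"
      using opc_mult_wsum[of w "1" "a" k] by blast
    let ?A = "{0, k} \<union> A0"
    have "wsum ?A (opc 1) (opc a) k = (\<Sum>x\<in>?A. if x = 0 then \<Sum>y\<in>?A. if k = y then opc a y else 0 else 0)"
      unfolding wsum_def by (intro sum.cong refl) (auto simp: one_ops.rep_eq chi_0 intro!: sum.cong)
    also have "\<dots> = opc a k" using A0(1) by simp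
    finally show "cg w (opc (1 * a) k) (opc a k)" using A0(1) A0(2)[rule_format, of ?A] by auto
  qed
  show "a * 1 = a"
  proof (intro ops_eqI cg_eqI)
    fix k w
    obtain A0 where A0: "finite A0" "\<forall>A. finite A \<and> A0 \<subseteq> A \<longrightarrow> cg w (opc (a * 1) k) (wsum A (opc a) (opc 1) k)"
      using opc_mult_wsum[of w "a" "1" k] by blast
    let ?A = "{0, k} \<union> A0"
    have "wsum ?A (opc a) (opc 1) k = (\<Sum>x\<in>?A. \<Sum>y\<in>?A. if y = 0 then (if k = x then opc a x else 0) else 0)"
      unfolding wsum_def by (intro sum.cong refl) (auto simp: one_ops.rep_eq chi_const)
    also have "\<dots> = opc a k" using A0(1) by simp
    finally show "cg w (opc (a * 1) k) (opc a k)" using A0(1) A0(2)[rule_format, of ?A] by auto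
  qed
qed

end

lifting_forget ser.lifting

lemma opc_0 [simp]: "opc 0 k = 0" by (simp add: zero_ops.rep_eq)
lemma opc_add [simp]: "opc (P + Q) k = opc P k + opc Q k" by (simp add: plus_ops.rep_eq)
lemma opc_diff [simp]: "opc (P - Q) k = opc P k - opc Q k" by (simp add: minus_ops.rep_eq)
lemma opc_minus [simp]: "opc (- P) k = - opc P k" by (simp add: uminus_ops.rep_eq)
lemma opc_1: "opc 1 k = (if k = 0 then 1 else 0)" by (simp add: one_ops.rep_eq)
lemma opc_sum [simp]: "opc (sum F A) k = (\<Sum>i\<in>A. opc (F i) k)"
  by (induction A rule: infinite_finite_induct) auto

text \<open>A value shared by all large truncations is congruent to the true coefficient modulo
  every weight, hence equal to it.\<close>

lemma opc_mult_eqI: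
  assumes "finite B" "\<And>A. finite A \<Longrightarrow> B \<subseteq> A \<Longrightarrow> wsum A (opc P) (opc Q) k = v"
  shows "opc (P * Q) k = v"
proof (rule cg_eqI)
  fix w
  obtain A0 where A0: "finite A0" "\<forall>A. finite A \<and> A0 \<subseteq> A \<longrightarrow> cg w (opc (P * Q) k) (wsum A (opc P) (opc Q) k)"
    using opc_mult_wsum[of w P Q k] by blast
  then show "cg w (opc (P * Q) k) v"
    using A0(2)[rule_format, of "A0 \<union> B"] assms(2)[of "A0 \<union> B"] assms(1) A0(1) by auto
qed

lift_definition cofo :: "'a::supercommutative_superalgebra ser \<Rightarrow> 'a ops" is "\<lambda>f n. if n = 0 then f else 0"
  by (rule exI[of _ 0]) (simp add: bd_def xwt_nonpos)

lift_definition DD :: "int \<Rightarrow> 'a::supercommutative_superalgebra ops" is "\<lambda>j n. if n = j then 1 else 0"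
  subgoal for j by (rule exI[of _ j]) (simp add: bd_def xwt_nonpos) done

lift_definition osc :: "complex \<Rightarrow> 'a::supercommutative_superalgebra ops \<Rightarrow> 'a ops" is "\<lambda>c P n. sc c (P n)"
  by (auto simp: bd_def intro: xwt_sc)

text \<open>The factor \<open>eps n\<close> is there because \<open>D\<close> is odd.\<close>

lift_definition opar :: "'a::supercommutative_superalgebra ops \<Rightarrow> 'a ops" is "\<lambda>P n. sc (eps n) (par (P n))"
  by (auto simp: bd_def intro: xwt_sc xwt_par)

lift_definition opd :: "sgn2 \<Rightarrow> nat \<Rightarrow> 'a::supercommutative_superalgebra ops \<Rightarrow> 'a ops" is "\<lambda>s n P k. pds (T s n) (P k)"
proof -
  fix s n and P :: "int \<Rightarrow> 'a ser"
  assume "\<exists>C. bd C P"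
  then obtain C where C: "\<And>k. xwt (k - C) (P k)" by (auto simp: bd_def)
  have "xwt (k - (C + int n)) (pds (T s n) (P k))" for k
    using xwt_pds[OF C, of k "T s n"] by (simp add: algebra_simps)
  then show "\<exists>C. bd C (\<lambda>k. pds (T s n) (P k))" by (auto simp: bd_def)
qed

lemma opc_cofo: "opc (cofo f) k = (if k = 0 then f else 0)" by (simp add: cofo.rep_eq)
lemma opc_DD: "opc (DD j) k = (if k = j then 1 else 0)" by (simp add: DD.rep_eq)
lemma opc_osc [simp]: "opc (osc c P) k = sc c (opc P k)" by (simp add: osc.rep_eq)
lemma opc_opar: "opc (opar P) k = sc (eps k) (par (opc P k))" by (simp add: opar.rep_eq)
lemma opc_opd: "opc (opd s n P) k = pds (T s n) (opc P k)" by (simp add: opd.rep_eq)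

lemma opc_cofo_mult: "opc (cofo f * P) k = f * opc P k"
proof (rule opc_mult_eqI[of "{0, k}"])
  fix A assume A: "finite (A :: int set)" "{0, k} \<subseteq> A"
  have "wsum A (opc (cofo f)) (opc P) k = (\<Sum>x\<in>A. if x = 0 then \<Sum>y\<in>A. if k = y then f * opc P y else 0 else 0)"
    unfolding wsum_def by (intro sum.cong refl) (auto simp: opc_cofo chi_0 intro!: sum.cong)
  also have "\<dots> = f * opc P k" using A by simp
  finally show "wsum A (opc (cofo f)) (opc P) k = f * opc P k" .
qed simp

lemma opc_mult_DD: "opc (P * DD j) k = opc P (k - j)"
proof (rule opc_mult_eqI[of "{k - j, j}"])
  fix A assume A: "finite (A :: int set)" "{k - j, j} \<subseteq> A"
  have "wsum A (opc P) (opc (DD j)) k = (\<Sum>x\<in>A. \<Sum>y\<in>A. if y = j then (if k - j = x then opc P x else 0) else 0)"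
    unfolding wsum_def by (intro sum.cong refl) (auto simp: opc_DD chi_const)
  also have "\<dots> = opc P (k - j)" using A by simp
  finally show "wsum A (opc P) (opc (DD j)) k = opc P (k - j)" .
qed simp

lemma opc_mult_cofo: "Ds f = 0 \<Longrightarrow> opc (P * cofo f) k = opc P k * tw k f"
proof (rule opc_mult_eqI[of "{0, k}"])
  fix A assume A: "finite (A :: int set)" "{0, k} \<subseteq> A" and f: "Ds f = 0"
  have "wsum A (opc P) (opc (cofo f)) k = (\<Sum>x\<in>A. \<Sum>y\<in>A. if y = 0 then (if k = x then opc P x * tw x f else 0) else 0)"
    unfolding wsum_def by (intro sum.cong refl) (auto simp: opc_cofo chi_const f)
  also have "\<dots> = opc P k * tw k f" using A by simp
  finally show "wsum A (opc P) (opc (cofo f)) k = opc P k * tw k f" .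
qed simp

lemma opc_DD_cofo: "opc (DD m * cofo f) k = chi m k f"
proof (rule opc_mult_eqI[of "{0, m}"])
  fix A assume A: "finite (A :: int set)" "{0, m} \<subseteq> A"
  have "wsum A (opc (DD m)) (opc (cofo f)) k = (\<Sum>x\<in>A. \<Sum>y\<in>A. if y = 0 then (if x = m then chi m k f else 0) else 0)"
    unfolding wsum_def by (intro sum.cong refl) (auto simp: opc_cofo opc_DD)
  also have "\<dots> = chi m k f" using A by simp
  finally show "wsum A (opc (DD m)) (opc (cofo f)) k = chi m k f" .
qed simp

lemma DD_mult: "DD i * DD j = DD (i + j)"
  by (rule ops_eqI) (auto simp: opc_mult_DD opc_DD)

lemma DD_0: "DD 0 = 1" by (rule ops_eqI) (simp add: opc_DD opc_1)

lemma DD_power: "DD i ^ n = DD (i * int n)"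
  by (induction n) (simp_all add: DD_0 DD_mult algebra_simps)

lemma cofo_mult: "cofo f * cofo g = cofo (f * g)"
  by (rule ops_eqI) (simp add: opc_cofo_mult opc_cofo)

lemma Dxi: "DD 1 * cofo (var Xi) = (1 - cofo (var Xi) * DD 1 :: 'a::supercommutative_superalgebra ops)"
proof (rule ops_eqI)
  fix k :: int
  consider "k > 1" | "k = 1" | "k = 0" | "k < 0" by linarith
  then show "opc (DD 1 * cofo (var Xi)) k = opc (1 - cofo (var Xi) * DD 1 :: 'a ops) k"
  proof cases
    case 3
    then show ?thesis using sbinom_simps(4)[of 0 0]
      by (simp add: opc_DD_cofo opc_cofo_mult opc_1 opc_DD chi_def)
  next
    case 4
    define r where "r = nat (- 1 - k)"
    have "nat (1 - k) = Suc (Suc r)" using 4 by (simp add: r_def)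
    moreover have "Dp (Suc (Suc r)) (tw k (var Xi :: 'a ser)) = 0"
      by (auto simp: tw_def par_var odd_count_X Ds_minus funpow_Suc_right simp del: funpow.simps)
    ultimately show ?thesis using 4
      by (simp add: opc_DD_cofo opc_cofo_mult opc_1 opc_DD chi_def del: funpow.simps)
  qed (auto simp: opc_DD_cofo opc_cofo_mult opc_1 opc_DD chi_same par_var odd_count_X)
qed

lemma osc_cofo_left: "osc c P = cofo (sc c 1) * P"
  by (rule ops_eqI) (simp add: opc_cofo_mult sc_mult_left)

lemma osc_cofo_right: "osc c P = P * cofo (sc c 1)"
  by (rule ops_eqI) (simp add: opc_mult_cofo Ds_sc tw_sc sc_mult_right)

lemma osc_mult_left: "osc c P * Q = osc c (P * Q)"
  by (simp add: osc_cofo_left mult.assoc)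

lemma osc_mult_right: "P * osc c Q = osc c (P * Q)"
  by (simp add: osc_cofo_right mult.assoc)

interpretation osc: vector_space "osc :: complex \<Rightarrow> 'a ops \<Rightarrow> 'a::supercommutative_superalgebra ops"
  by unfold_locales
     (auto intro!: ops_eqI simp: sc.scale_right_distrib sc.scale_left_distrib)

lemma opar_add: "opar (P + Q) = opar P + opar Q"
  by (rule ops_eqI) (simp add: opc_opar par_add sc.scale_right_distrib)
lemma opar_osc: "opar (osc c P) = osc c (opar P)"
  by (rule ops_eqI) (simp add: opc_opar par_sc mult.commute)
lemma opar_minus: "opar (- P) = - opar P" using opar_osc[of "-1" P] by simp
lemma opar_diff: "opar (P - Q) = opar P - opar Q" using opar_add[of P "-Q"] by (simp add: opar_minus)
lemma opar_0 [simp]: "opar 0 = 0" using opar_osc[of 0 0] by simp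
lemma opar_cofo: "opar (cofo f) = cofo (par f)"
  by (rule ops_eqI) (simp add: opc_opar opc_cofo)
lemma opar_DD: "opar (DD j) = osc (eps j) (DD j)"
  by (rule ops_eqI) (simp add: opc_opar opc_DD)
lemma opar_1 [simp]: "opar 1 = 1" using opar_DD[of 0] by (simp add: DD_0)

lemma opar_mult: "opar (P * Q) = opar P * opar Q"
proof (intro ops_eqI cg_eqI)
  fix k w
  obtain A1 where 1: "finite A1" "\<forall>A. finite A \<and> A1 \<subseteq> A \<longrightarrow> cg w (opc (P * Q) k) (wsum A (opc P) (opc Q) k)"
    using opc_mult_wsum[of w P Q k] by blast
  obtain A2 where 2: "finite A2" "\<forall>A. finite A \<and> A2 \<subseteq> A \<longrightarrow>
      cg w (opc (opar P * opar Q) k) (wsum A (opc (opar P)) (opc (opar Q)) k)"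
    using opc_mult_wsum[of w "opar P" "opar Q" k] by blast
  let ?A = "A1 \<union> A2"
  have "cg w (opc (P * Q) k) (wsum ?A (opc P) (opc Q) k)" using 1 2(1) by simp
  then have "cg w (opc (opar (P * Q)) k) (sc (eps k) (par (wsum ?A (opc P) (opc Q) k)))"
    unfolding opc_opar cg_def by (metis wt_par wt_sc par_diff sc.scale_right_diff_distrib)
  also have "sc (eps k) (par (wsum ?A (opc P) (opc Q) k)) = wsum ?A (opc (opar P)) (opc (opar Q)) k"
    unfolding wsum_def par_sum sc.scale_sum_right
  proof (intro sum.cong refl)
    fix a b
    have "eps k * eps (a - (k - b)) = eps a * eps b" by (auto simp: eps_def)
    then show "sc (eps k) (par (opc P a * chi a (k - b) (opc Q b))) =
        opc (opar P) a * chi a (k - b) (opc (opar Q) b)"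
      using tw_chi[of 1 a "k - b" "opc Q b"]
      by (simp add: par_mult opc_opar chi_sc sc_mult_left sc_mult_right mult.commute)
  qed
  also have "cg w \<dots> (opc (opar P * opar Q) k)" using 1(1) 2 by (intro cg_sym[of w "opc _ _"]) simp
  finally show "cg w (opc (opar (P * Q)) k) (opc (opar P * opar Q) k)" .
qed

lemma opar_power: "opar (P ^ n) = opar P ^ n"
  by (induction n) (simp_all add: opar_mult)

definition opart :: "nat \<Rightarrow> 'a::supercommutative_superalgebra ops \<Rightarrow> 'a ops" where
  "opart n P = (if even n then P else opar P)"

lemma opd_add: "opd s n (P + Q) = opd s n P + opd s n Q"
  by (rule ops_eqI) (simp add: opc_opd pds_add)
lemma opd_osc: "opd s n (osc c P) = osc c (opd s n P)"
  by (rule ops_eqI) (simp add: opc_opd pds_sc)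
lemma opd_minus: "opd s n (- P) = - opd s n P" using opd_osc[of s n "-1" P] by simp
lemma opd_diff: "opd s n (P - Q) = opd s n P - opd s n Q" using opd_add[of s n P "-Q"] by (simp add: opd_minus)
lemma opd_0 [simp]: "opd s n 0 = 0" using opd_osc[of s n 0 0] by simp
lemma opd_DD [simp]: "opd s n (DD j) = 0"
  by (rule ops_eqI) (simp add: opc_opd opc_DD)
lemma opd_1 [simp]: "opd s n 1 = 0" using opd_DD[of s n 0] by (simp add: DD_0)
lemma opd_cofo: "opd s n (cofo f) = cofo (pds (T s n) f)"
  by (rule ops_eqI) (simp add: opc_opd opc_cofo)

text \<open>Combines \<open>pds_mult\<close> on coefficients with the sign of
  \<open>pds_T_chi\<close>, which is the \<open>eps\<close> built into \<open>opar\<close>. The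
  product is truncated at weight \<open>n + w\<close> because the derivative costs weight
  \<open>n\<close>.\<close>

lemma opd_mult: "opd s n (P * Q) = opd s n P * Q + opart n P * opd s n Q"
proof (intro ops_eqI cg_eqI)
  fix k w
  obtain A1 where 1: "finite A1" "\<forall>A. finite A \<and> A1 \<subseteq> A \<longrightarrow> cg (n + w) (opc (P * Q) k) (wsum A (opc P) (opc Q) k)"
    using opc_mult_wsum[of "n + w" P Q k] by blast
  obtain A2 where 2: "finite A2" "\<forall>A. finite A \<and> A2 \<subseteq> A \<longrightarrow>
      cg w (opc (opd s n P * Q) k) (wsum A (opc (opd s n P)) (opc Q) k)"
    using opc_mult_wsum[of w "opd s n P" "Q" k] by blast
  obtain A3 where 3: "finite A3" "\<forall>A. finite A \<and> A3 \<subseteq> A \<longrightarrow>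
      cg w (opc (opart n P * opd s n Q) k) (wsum A (opc (opart n P)) (opc (opd s n Q)) k)"
    using opc_mult_wsum[of w "opart n P" "opd s n Q" k] by blast
  let ?A = "A1 \<union> A2 \<union> A3"
  have "cg (n + w) (opc (P * Q) k) (wsum ?A (opc P) (opc Q) k)"
    using 1(2)[rule_format, of ?A] 1(1) 2(1) 3(1) by auto
  then have "cg w (opc (opd s n (P * Q)) k) (pds (T s n) (wsum ?A (opc P) (opc Q) k))"
    unfolding opc_opd by (intro cg_pds) simp
  also have "pds (T s n) (wsum ?A (opc P) (opc Q) k) =
      wsum ?A (opc (opd s n P)) (opc Q) k + wsum ?A (opc (opart n P)) (opc (opd s n Q)) k"
    unfolding wsum_def pds_sum sum.distrib[symmetric]
  proof (intro sum.cong refl)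
    fix a b
    have e: "opc (opart n P) a = sc (eps (int n * a)) ((par ^^ odd_count {#T s n#}) (opc P a))"
      by (auto simp: opart_def opc_opar odd_count_X eps_def)
    show "pds (T s n) (opc P a * chi a (k - b) (opc Q b)) =
        opc (opd s n P) a * chi a (k - b) (opc Q b) + opc (opart n P) a * chi a (k - b) (opc (opd s n Q) b)"
      unfolding e by (simp add: pds_mult pds_T_chi opc_opd sc_mult_left sc_mult_right)
  qed
  also have "cg w \<dots> (opc (opd s n P * Q + opart n P * opd s n Q) k)"
    unfolding opc_add using 2(2)[rule_format, of ?A] 3(2)[rule_format, of ?A] 1(1) 2(1) 3(1)
    by (intro cg_add cg_sym[of w _ "wsum _ _ _ _"]) auto
  finally show "cg w (opc (opd s n (P * Q)) k) (opc (opd s n P * Q + opart n P * opd s n Q) k)" .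
qed

definition tv :: "sgn2 \<Rightarrow> nat \<Rightarrow> 'a::supercommutative_superalgebra ops" where
  "tv s n = cofo (var (T s n))"

lemma tv_commute:
  fixes P :: "'a::supercommutative_superalgebra ops"
  shows "tv s n * P = opart n P * tv s n"
proof (rule ops_eqI)
  fix k
  have "tw k (var (T s n)) = sc (eps (int n * k)) (var (T s n) :: 'a ser)"
    by (auto simp: tw_def par_var odd_count_X eps_def)
  then have "opc (opart n P * tv s n) k = sc (eps (int n * k)) (opc (opart n P) k * var (T s n))"
    by (simp add: tv_def opc_mult_cofo sc_mult_right)
  also have "\<dots> = (par ^^ odd_count {#T s n#}) (opc P k) * var (T s n)"
    by (auto simp: opart_def opc_opar sc_mult_left odd_count_X eps_def)
  also have "\<dots> = opc (tv s n * P) k"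
    by (simp add: tv_def opc_cofo_mult var_commute[of "T s n" "opc P k"])
  finally show "opc (tv s n * P) k = opc (opart n P * tv s n) k" ..
qed

lemma opd_tv: "1 \<le> n \<Longrightarrow> opd r m (tv s n) = (if r = s \<and> m = n then 1 else 0)"
  by (auto simp: tv_def opd_cofo pds_var valid_single intro!: ops_eqI simp: opc_cofo opc_1)

lemma opar_tv: "opar (tv s n) = osc (eps n) (tv s n)"
  by (rule ops_eqI) (auto simp: tv_def opar_cofo par_var odd_count_X eps_def opc_cofo)

subsection \<open>Convergence in the weight filtration\<close>

definition wto :: "nat \<Rightarrow> 'a::supercommutative_superalgebra ops \<Rightarrow> bool" where
  "wto w P \<longleftrightarrow> (\<forall>k. wt w (opc P k))"

lemma wto_0 [simp]: "wto 0 P" by (simp add: wto_def)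
lemma wto_zero [simp]: "wto w 0" by (simp add: wto_def)
lemma wto_mono: "wto w P \<Longrightarrow> v \<le> w \<Longrightarrow> wto v P" unfolding wto_def using wt_mono by blast
lemma wto_add: "wto w P \<Longrightarrow> wto w Q \<Longrightarrow> wto w (P + Q)" by (simp add: wto_def wt_add)
lemma wto_diff: "wto w P \<Longrightarrow> wto w Q \<Longrightarrow> wto w (P - Q)" by (simp add: wto_def wt_diff)
lemma wto_minus: "wto w P \<Longrightarrow> wto w (- P)" by (simp add: wto_def wt_minus)
lemma wto_osc: "wto w P \<Longrightarrow> wto w (osc c P)" by (simp add: wto_def wt_sc)
lemma wto_opar: "wto w P \<Longrightarrow> wto w (opar P)" by (simp add: wto_def opc_opar wt_sc wt_par)
lemma wto_opd: "wto (n + w) P \<Longrightarrow> wto w (opd s n P)"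
  unfolding wto_def opc_opd by (auto intro: wt_pds)
lemma wto_mult: "wto v P \<Longrightarrow> wto w Q \<Longrightarrow> wto (v + w) (P * Q)"
  by (simp add: wto_def times_ops.rep_eq wt_mulraw)
lemma wto_mult_left: "wto w P \<Longrightarrow> wto w (P * Q)" using wto_mult[of w P 0 Q] by simp
lemma wto_mult_right: "wto w Q \<Longrightarrow> wto w (P * Q)" using wto_mult[of 0 P w Q] by simp
lemma wto_sum: "(\<And>i. i \<in> A \<Longrightarrow> wto w (F i)) \<Longrightarrow> wto w (sum F A)"
  by (simp add: wto_def wt_sum)
lemma wto_tv: "wto n (tv s n)"
  using wt_var[of "T s n"] by (simp add: wto_def tv_def opc_cofo)
lemma wto_all_zero: "(\<And>w. wto w P) \<Longrightarrow> P = 0"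
  by (rule ops_eqI) (simp add: wto_def wt_all_zero)
lemma wto_power: "wto 1 P \<Longrightarrow> wto n (P ^ n)"
proof (induction n)
  case (Suc n)
  then show ?case using wto_mult[of 1 P n "P ^ n"] by simp
qed simp

definition osums :: "(nat \<Rightarrow> 'a::supercommutative_superalgebra ops) \<Rightarrow> 'a ops \<Rightarrow> bool" where
  "osums F P \<longleftrightarrow> (\<forall>w. \<exists>N. \<forall>M\<ge>N. wto w (P - (\<Sum>j<M. F j)))"

lemma osums_unique: "osums F P \<Longrightarrow> osums F Q \<Longrightarrow> P = Q"
proof -
  assume PQ: "osums F P" "osums F Q"
  have "wto w (P - Q)" for w
  proof -
    obtain N1 N2 where "\<forall>M\<ge>N1. wto w (P - (\<Sum>j<M. F j))" "\<forall>M\<ge>N2. wto w (Q - (\<Sum>j<M. F j))"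
      using PQ unfolding osums_def by metis
    then have "wto w (P - (\<Sum>j<max N1 N2. F j))" "wto w (Q - (\<Sum>j<max N1 N2. F j))" by auto
    then show ?thesis using wto_diff by fastforce
  qed
  then show ?thesis using wto_all_zero[of "P - Q"] by simp
qed

text \<open>An additive map that lowers the weight by at most a fixed \<open>c\<close> is
  continuous; for the derivative with respect to a time of index \<open>n\<close> this is
  \<open>c = n\<close>.\<close>

lemma osums_map:
  assumes "osums F P" "\<And>x y. f (x - y) = f x - f y" "\<And>w x. wto (w + c) x \<Longrightarrow> wto w (f x)"
  shows "osums (\<lambda>j. f (F j)) (f P)"
  unfolding osums_def
proof
  fix w
  have f0: "f 0 = 0" using assms(2)[of 0 0] by simp
  have f_add: "f (x + y) = f x + f y" for x y
    using assms(2)[of x "0 - y"] assms(2)[of 0 y] by (simp add: f0)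
  have s: "(\<Sum>j<M. f (F j)) = f (\<Sum>j<M. F j)" for M
    by (induction M) (simp_all add: f0 f_add)
  show "\<exists>N. \<forall>M\<ge>N. wto w (f P - (\<Sum>j<M. f (F j)))"
    using assms(1)[unfolded osums_def, rule_format, of "w + c"] assms(3) unfolding s assms(2)[symmetric] by blast
qed

lemma osums_add:
  assumes "osums F P" "osums G Q" shows "osums (\<lambda>j. F j + G j) (P + Q)"
  unfolding osums_def
proof
  fix w
  obtain N1 N2 where "\<forall>M\<ge>N1. wto w (P - (\<Sum>j<M. F j))" "\<forall>M\<ge>N2. wto w (Q - (\<Sum>j<M. G j))"
    using assms unfolding osums_def by metis
  then have "wto w ((P - (\<Sum>j<M. F j)) + (Q - (\<Sum>j<M. G j)))" if "M \<ge> max N1 N2" for M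
    using that by (intro wto_add) auto
  then show "\<exists>N. \<forall>M\<ge>N. wto w (P + Q - (\<Sum>j<M. F j + G j))"
    by (intro exI[of _ "max N1 N2"]) (simp add: sum.distrib algebra_simps)
qed

lemma osums_mult_left: "osums F P \<Longrightarrow> osums (\<lambda>j. Q * F j) (Q * P)"
  by (rule osums_map[where c=0]) (auto simp: algebra_simps wto_mult_right)
lemma osums_mult_right: "osums F P \<Longrightarrow> osums (\<lambda>j. F j * Q) (P * Q)"
  by (rule osums_map[where c=0]) (auto simp: algebra_simps wto_mult_left)
lemma osums_minus: "osums F P \<Longrightarrow> osums (\<lambda>j. - F j) (- P)"
  by (rule osums_map[where c=0]) (auto simp: wto_minus)
lemma osums_osc: "osums F P \<Longrightarrow> osums (\<lambda>j. osc c (F j)) (osc c P)"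
  by (rule osums_map[where c=0]) (auto simp: wto_osc osc.scale_right_diff_distrib)
lemma osums_opar: "osums F P \<Longrightarrow> osums (\<lambda>j. opar (F j)) (opar P)"
  by (rule osums_map[where c=0]) (auto simp: wto_opar opar_diff)
lemma osums_opd: "osums F P \<Longrightarrow> osums (\<lambda>j. opd s n (F j)) (opd s n P)"
  by (rule osums_map[where c=n]) (auto simp: opd_diff add.commute intro: wto_opd)
lemma osums_diff: "osums F P \<Longrightarrow> osums G Q \<Longrightarrow> osums (\<lambda>j. F j - G j) (P - Q)"
  using osums_add[of F P "\<lambda>j. - G j" "- Q"] osums_minus[of G Q] by simp
lemma osums_zero: "osums (\<lambda>j. 0) 0" by (simp add: osums_def)
lemma osums_single: "osums (\<lambda>j. if j = n then P else 0) P"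
  unfolding osums_def
proof
  fix w show "\<exists>N. \<forall>M\<ge>N. wto w (P - (\<Sum>j<M. if j = n then P else 0))"
    by (intro exI[of _ "Suc n"]) simp
qed
lemma osums_Suc: "osums (\<lambda>j. F (Suc j)) P \<Longrightarrow> osums F (F 0 + P)"
  unfolding osums_def
proof
  fix w assume "\<forall>w. \<exists>N. \<forall>M\<ge>N. wto w (P - (\<Sum>j<M. F (Suc j)))"
  then obtain N where N: "\<forall>M\<ge>N. wto w (P - (\<Sum>j<M. F (Suc j)))" by blast
  have "wto w (F 0 + P - (\<Sum>j<M. F j))" if M: "M \<ge> Suc N" for M
  proof -
    obtain M' where M': "M = Suc M'" "M' \<ge> N" using M by (cases M) auto
    have "F 0 + P - (\<Sum>j<M. F j) = P - (\<Sum>j<M'. F (Suc j))"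
      unfolding M'(1) sum.lessThan_Suc_shift by simp
    then show ?thesis using N M'(2) by (simp only:)
  qed
  then show "\<exists>N. \<forall>M\<ge>N. wto w (F 0 + P - (\<Sum>j<M. F j))" by blast
qed

lemma osums_wto: "osums F P \<Longrightarrow> (\<And>j. wto w (F j)) \<Longrightarrow> wto w P"
proof -
  assume "osums F P" and F: "\<And>j. wto w (F j)"
  then obtain N where "wto w (P - (\<Sum>j<N. F j))" unfolding osums_def by blast
  moreover have "wto w (\<Sum>j<N. F j)" using F by (rule wto_sum)
  ultimately show ?thesis using wto_add by fastforce
qed

text \<open>Since \<open>F j\<close> has weight at least \<open>j\<close>, a monomial only sees
  \<open>j\<close> up to its own weight; the limit therefore agrees with the coefficientwise sums
  \<open>sser_sum\<close> of the definitions. The common \<open>C\<close> keeps the limit within the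
  order bound.\<close>

lemma osums_exists:
  assumes w: "\<And>j. wto j (F j)" and bd: "\<And>j. bd C (opc (F j))"
  obtains P where "osums F P" "bd C (opc P)"
    "\<And>k \<mu>. coef (opc P k) \<mu> = Sum_any (\<lambda>j. coef (opc (F j) k) \<mu>)"
proof -
  define c where "c k \<mu> = (\<Sum>j\<le>weight \<mu>. coef (opc (F j) k) \<mu>)" for k \<mu>
  have van: "coef (opc (F j) k) \<mu> = 0" if "weight \<mu> < j" for j k \<mu>
    using w[of j] that unfolding wto_def wt_def by (meson not_le)
  have cs: "c k \<mu> = (\<Sum>j<M. coef (opc (F j) k) \<mu>)" if "weight \<mu> < M" for k \<mu> M
    unfolding c_def using that van by (intro sum.mono_neutral_left) auto
  have ca: "c k \<mu> = Sum_any (\<lambda>j. coef (opc (F j) k) \<mu>)" for k \<mu>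
    unfolding c_def by (rule Sum_any.expand_superset[symmetric]) (use van in \<open>auto simp: not_less[symmetric]\<close>)
  have "\<forall>m. \<not> valid m \<longrightarrow> c k m = 0" for k by (simp add: c_def coef_invalid)
  then have cP: "coef (Ser (c k)) = c k" for k by (simp add: Ser_inverse)
  have bdP: "bd C (\<lambda>k. Ser (c k))"
    unfolding bd_def xwt_def cP
  proof (intro allI impI)
    fix k m assume "c k m \<noteq> 0"
    then obtain j where "coef (opc (F j) k) m \<noteq> 0"
      unfolding c_def by (metis (no_types, lifting) sum.neutral)
    then show "k - C \<le> int (weight m + count m Xi)"
      using bd[of j] unfolding bd_def xwt_def by blast
  qed
  then have "opc (Ops (\<lambda>k. Ser (c k))) = (\<lambda>k. Ser (c k))" by (auto intro!: Ops_inverse)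
  then have co: "coef (opc (Ops (\<lambda>k. Ser (c k))) k) = c k" for k by (simp add: cP)
  show ?thesis
  proof (rule that[of "Ops (\<lambda>k. Ser (c k))"])
    show "osums F (Ops (\<lambda>k. Ser (c k)))"
      unfolding osums_def
    proof
      fix w
      have "wto w (Ops (\<lambda>k. Ser (c k)) - (\<Sum>j<M. F j))" if "w \<le> M" for M
        unfolding wto_def wt_def
      proof (intro allI impI)
        fix k \<mu> assume "coef (opc (Ops (\<lambda>k. Ser (c k)) - (\<Sum>j<M. F j)) k) \<mu> \<noteq> 0"
        then have "c k \<mu> \<noteq> (\<Sum>j<M. coef (opc (F j) k) \<mu>)" by (simp add: co)
        then show "w \<le> weight \<mu>" using cs[of \<mu> M k] that by linarith
      qed
      then show "\<exists>N. \<forall>M\<ge>N. wto w (Ops (\<lambda>k. Ser (c k)) - (\<Sum>j<M. F j))" by blast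
    qed
    show "bd C (opc (Ops (\<lambda>k. Ser (c k))))" using bdP by (simp add: Ops_inverse exI)
  qed (simp add: co ca)
qed

lemma bd_opc_mult: "bd C (opc P) \<Longrightarrow> bd D (opc Q) \<Longrightarrow> bd (C + D) (opc (P * Q))"
  by (simp add: times_ops.rep_eq bd_mulraw)
lemma bd_opc_add: "bd C (opc P) \<Longrightarrow> bd C (opc Q) \<Longrightarrow> bd C (opc (P + Q))"
  by (simp add: bd_def xwt_add)
lemma bd_opc_diff: "bd C (opc P) \<Longrightarrow> bd C (opc Q) \<Longrightarrow> bd C (opc (P - Q))"
  by (simp add: bd_def xwt_diff)
lemma bd_opc_osc: "bd C (opc P) \<Longrightarrow> bd C (opc (osc c P))"
  by (simp add: bd_def xwt_sc)
lemma bd_opc_opd: "bd C (opc P) \<Longrightarrow> bd (C + int n) (opc (opd s n P))"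
  unfolding bd_def opc_opd
proof
  fix k assume "\<forall>k. xwt (k - C) (opc P k)"
  then show "xwt (k - (C + int n)) (pds (T s n) (opc P k))"
    using xwt_pds[of "k - C" "opc P k" "T s n"] by (simp add: algebra_simps)
qed
lemma bd_opc_tv: "bd (- int n) (opc (tv s n))"
  unfolding bd_def tv_def opc_cofo using wt_imp_xwt[OF wt_var[of "T s n"]] by simp
lemma bd_opc_DD: "bd j (opc (DD j))"
  unfolding bd_def opc_DD by (simp add: xwt_nonpos)
lemma bd_opc_xi: "bd (-1) (opc (cofo (var Xi)))"
  unfolding bd_def opc_cofo xwt_def by (simp add: coef_var)
lemma bd_opc_1: "bd 0 (opc 1)"
  using bd_opc_DD[of 0] by (simp add: DD_0)
lemma bd_opc_power: "bd 0 (opc P) \<Longrightarrow> bd 0 (opc (P ^ n))"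
proof (induction n)
  case (Suc n)
  then show ?case using bd_opc_mult[of 0 P 0 "P ^ n"] by simp
qed (simp add: bd_opc_1)

lemma opar_opar [simp]: "opar (opar P) = P"
  by (rule ops_eqI) (simp add: opc_opar par_sc)

lemma osums_eqI: "osums F P \<Longrightarrow> osums G Q \<Longrightarrow> (\<And>j. F j = G j) \<Longrightarrow> P = Q"
  using osums_unique[of F P Q] ext[of F G] by simp

definition opsum :: "(nat \<Rightarrow> 'a::supercommutative_superalgebra ops) \<Rightarrow> 'a ops" where
  "opsum F = (SOME P. osums F P)"

lemma opsum:
  assumes w: "\<And>j. wto j (F j)" and bd: "\<And>j. bd C (opc (F j))"
  shows "osums F (opsum F)" and "bd C (opc (opsum F))"
    and "coef (opc (opsum F) k) \<mu> = Sum_any (\<lambda>j. coef (opc (F j) k) \<mu>)"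
proof -
  obtain P where P: "osums F P" "bd C (opc P)" "\<And>k \<mu>. coef (opc P k) \<mu> = Sum_any (\<lambda>j. coef (opc (F j) k) \<mu>)"
    using osums_exists[OF w bd] by blast
  have "opsum F = P"
    unfolding opsum_def by (rule some_equality) (use P(1) osums_unique in blast)+
  then show "osums F (opsum F)" "bd C (opc (opsum F))"
    "coef (opc (opsum F) k) \<mu> = Sum_any (\<lambda>j. coef (opc (F j) k) \<mu>)" using P by simp_all
qed

subsection \<open>Exponentials\<close>

definition op_exp :: "'a::supercommutative_superalgebra ops \<Rightarrow> 'a ops" where
  "op_exp H = opsum (\<lambda>k. osc (1 / fact k) (H ^ k))"

context
  fixes H :: "'a::supercommutative_superalgebra ops"
  assumes H: "wto 1 H" "bd 0 (opc H)"
begin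

lemma op_exp_osums: "osums (\<lambda>k. osc (1 / fact k) (H ^ k)) (op_exp H)"
  and op_exp_bd: "bd 0 (opc (op_exp H))"
  and op_exp_coef: "coef (opc (op_exp H) k) \<mu> = Sum_any (\<lambda>j. coef (opc (osc (1 / fact j) (H ^ j)) k) \<mu>)"
  unfolding op_exp_def using H
  by (intro opsum[where C=0] wto_osc wto_power bd_opc_osc bd_opc_power; simp)+

lemma op_exp_opar: "opar H = H \<Longrightarrow> opar (op_exp H) = op_exp H"
  using osums_opar[OF op_exp_osums] op_exp_osums by (simp add: opar_osc opar_power) (rule osums_unique)

lemma power_commute: "Q * H = H * Q \<Longrightarrow> Q * H ^ n = H ^ n * Q"
proof (induction n)
  case (Suc n)
  then show ?case by (metis mult.assoc power_Suc)
qed simp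

lemma op_exp_commute: "Q * H = H * Q \<Longrightarrow> Q * op_exp H = op_exp H * Q"
  using osums_mult_left[OF op_exp_osums, of Q] osums_mult_right[OF op_exp_osums, of Q]
  by (simp add: osc_mult_left osc_mult_right power_commute) (rule osums_unique)

lemma op_exp_minus_one: "wto 1 (op_exp H - 1)"
proof -
  have "osums (\<lambda>k. (osc (1 / fact k) (H ^ k)) - (if k = 0 then 1 else 0)) (op_exp H - 1)"
    by (intro osums_diff op_exp_osums osums_single)
  then show ?thesis
  proof (rule osums_wto)
    fix k show "wto 1 (osc (1 / fact k) (H ^ k) - (if k = 0 then 1 else 0))"
      using wto_mono[OF wto_osc[OF wto_power[OF H(1)]], of 1 k] by (cases k) auto
  qed
qed

context
  fixes \<delta> :: "'a ops \<Rightarrow> 'a ops" and d :: nat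
  assumes diff: "\<And>x y. \<delta> (x - y) = \<delta> x - \<delta> y"
    and lin: "\<And>c x. \<delta> (osc c x) = osc c (\<delta> x)"
    and cont: "\<And>w x. wto (w + d) x \<Longrightarrow> wto w (\<delta> x)"
    and one: "\<delta> 1 = 0"
begin

text \<open>The Baker-Campbell-Hausdorff situation in which \<open>c = [a, H]\<close> commutes with
  \<open>H\<close>: in the derivative of a power, moving \<open>a\<close> to the left past
  \<open>i\<close> factors \<open>H\<close> costs \<open>i\<close> copies of \<open>c\<close>, and
  over the exponential series this amounts to \<open>c / 2\<close>. The Leibniz rule is assumed for
  the left factor \<open>H\<close>, which covers even and odd \<open>\<delta>\<close> alike.\<close>

lemma op_exp_derivation:
  assumes Leibniz: "\<And>X. \<delta> (H * X) = a * X + H * \<delta> X"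
    and c: "a * H = H * a + c" "c * H = H * c"
  shows "\<delta> (op_exp H) = a * op_exp H - osc (1 / 2) (c * op_exp H)"
proof -
  let ?E = "\<lambda>k. osc (1 / fact k) (H ^ k)"
  \<comment> \<open>The exponential series delayed by one place, and in \<open>q\<close> by two,
    with 0 filled in: \<open>\<delta>\<close> lowers the degree in \<open>H\<close> by one, and the
    term with \<open>c\<close> loses one degree more.\<close>
  let ?p = "\<lambda>k. if k = 0 then 0 else ?E (k - 1)"
  have p: "osums ?p (op_exp H)"
    using osums_Suc[of ?p "op_exp H"] op_exp_osums by simp
  have q: "osums (\<lambda>k. if k = 0 then 0 else ?p (k - 1)) (op_exp H)"
  proof -
    have "(\<lambda>k. if Suc k = 0 then 0 else ?p (Suc k - 1)) = ?p" by (simp add: fun_eq_iff)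
    then show ?thesis using osums_Suc[of "\<lambda>k. if k = 0 then 0 else ?p (k - 1)" "op_exp H"] p
      by (simp only: if_True add_0 simp_thms)
  qed
  have aH: "a * H ^ k = H ^ k * a + osc (of_nat k) (c * H ^ (k - 1))" for k
  proof (induction k)
    case (Suc k)
    have cHk: "c * H ^ k = H * (c * H ^ (k - 1))" if "0 < k"
      using that c(2) by (cases k) (simp_all add: mult.assoc[symmetric])
    have "a * H ^ Suc k = H * (a * H ^ k) + c * H ^ k"
      using c(1) by (simp add: mult.assoc[symmetric] distrib_right)
    also have "H * (a * H ^ k) = H ^ Suc k * a + osc (of_nat k) (c * H ^ k)"
      using cHk by (cases "k = 0") (simp_all add: Suc.IH distrib_left osc_mult_right mult.assoc)
    finally show ?case by (simp add: osc.scale_left_distrib algebra_simps)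
  qed simp
  \<comment> \<open>\<open>\<delta> (H^(k+1))\<close> is the sum of \<open>H^i a H^(k-i)\<close> for
    \<open>i \<le> k\<close>, and \<open>H^i a = a H^i - i c H^(i-1)\<close>; the numbers
    \<open>i\<close> add up to \<open>k (k+1) / 2\<close>. At \<open>k = 0\<close> the truncated
    exponent \<open>k - 1\<close> comes with the factor 0.\<close>
  have dH: "\<delta> (H ^ Suc k) = osc (of_nat (Suc k)) (a * H ^ k) - osc (of_nat k * of_nat (Suc k) / 2) (c * H ^ (k - 1))" for k
  proof (induction k)
    case 0
    then show ?case using Leibniz[of 1] one by simp
  next
    case (Suc k)
    have Ha: "H * (a * H ^ k) = a * H ^ Suc k - c * H ^ k"
      using c(1) by (simp add: mult.assoc[symmetric] distrib_right)
    have Hc: "osc (of_nat k * x) (H * (c * H ^ (k - 1))) = osc (of_nat k * x) (c * H ^ k)" for x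
      using c(2) by (cases k) (simp_all add: mult.assoc[symmetric])
    have "\<delta> (H ^ Suc (Suc k)) = a * H ^ Suc k + H * (osc (of_nat (Suc k)) (a * H ^ k) - osc (of_nat k * of_nat (Suc k) / 2) (c * H ^ (k - 1)))"
      using Leibniz[of "H ^ Suc k"] Suc.IH by simp
    also have "\<dots> = a * H ^ Suc k + osc (of_nat (Suc k)) (a * H ^ Suc k - c * H ^ k) - osc (of_nat k * (of_nat (Suc k) / 2)) (c * H ^ k)"
      using Hc[of "of_nat (Suc k) / 2"] by (simp add: right_diff_distrib osc_mult_right Ha add_diff_eq)
    also have "\<dots> = osc (1 + of_nat (Suc k)) (a * H ^ Suc k) - osc (of_nat (Suc k) + of_nat k * (of_nat (Suc k) / 2)) (c * H ^ k)"
      by (simp only: osc.scale_left_distrib osc.scale_right_diff_distrib osc.scale_one) (simp add: algebra_simps)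
    also have "of_nat (Suc k) + of_nat k * (of_nat (Suc k) / 2) = (of_nat (Suc k) * of_nat (Suc (Suc k)) / 2 :: complex)"
      by (simp add: field_simps)
    finally show ?case by simp
  qed
  have dE: "\<delta> (?E k) = a * ?p k - osc (1 / 2) (c * (if k = 0 then 0 else ?p (k - 1)))" for k
  proof (cases k)
    case 0
    then show ?thesis using lin[of 1 1] one by simp
  next
    case (Suc j)
    have f1: "1 / fact (Suc j) * of_nat (Suc j) = (1 / fact j :: complex)"
      by (simp add: field_simps del: of_nat_Suc)
    have f2: "1 / fact (Suc j) * (of_nat j * of_nat (Suc j) / 2) = (1 / 2 * (if j = 0 then 0 else 1 / fact (j - 1)) :: complex)"
      by (cases j) (simp_all add: field_simps del: of_nat_Suc)
    have "\<delta> (?E k) = osc (1 / fact (Suc j)) (osc (of_nat (Suc j)) (a * H ^ j) - osc (of_nat j * of_nat (Suc j) / 2) (c * H ^ (j - 1)))"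
      unfolding Suc lin dH ..
    also have "\<dots> = osc (1 / fact j) (a * H ^ j) - osc (1 / 2 * (if j = 0 then 0 else 1 / fact (j - 1))) (c * H ^ (j - 1))"
      unfolding osc.scale_right_diff_distrib osc.scale_scale f1 f2 ..
    finally show ?thesis
      by (cases "j = 0") (simp_all add: Suc osc_mult_right)
  qed
  have "osums (\<lambda>k. \<delta> (?E k)) (\<delta> (op_exp H))"
    by (rule osums_map[OF op_exp_osums, of \<delta> d]) (auto simp: diff cont)
  moreover have "osums (\<lambda>k. \<delta> (?E k)) (a * op_exp H - osc (1 / 2) (c * op_exp H))"
    unfolding dE
    by (intro osums_diff osums_osc osums_mult_left p q)
  ultimately show ?thesis by (rule osums_unique)
qed

text \<open>\<open>\<delta>\<close> and the commutator with \<open>e\<close> agree on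
  \<open>H\<close> and follow the same Leibniz rule, hence agree on all powers of \<open>H\<close>
  and on their limit.\<close>

lemma op_exp_bracket:
  assumes Leibniz: "\<And>X. \<delta> (H * X) = (e * H - H * e) * X + H * \<delta> X"
  shows "\<delta> (op_exp H) = e * op_exp H - op_exp H * e"
proof -
  let ?E = "\<lambda>k. osc (1 / fact k) (H ^ k)"
  have dH: "\<delta> (H ^ k) = e * H ^ k - H ^ k * e" for k
  proof (induction k)
    case (Suc k)
    have "\<delta> (H ^ Suc k) = (e * H - H * e) * H ^ k + H * (e * H ^ k - H ^ k * e)"
      using Leibniz[of "H ^ k"] Suc.IH by simp
    then show ?case by (simp add: algebra_simps)
  qed (simp add: one)
  have "osums (\<lambda>k. \<delta> (?E k)) (\<delta> (op_exp H))"
    by (rule osums_map[OF op_exp_osums, of \<delta> d]) (auto simp: diff cont)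
  moreover have "osums (\<lambda>k. \<delta> (?E k)) (e * op_exp H - op_exp H * e)"
  proof -
    have "\<delta> (?E k) = e * ?E k - ?E k * e" for k
      by (simp only: lin dH osc.scale_right_diff_distrib osc_mult_left osc_mult_right)
    then show ?thesis
      by (simp only: osums_diff osums_mult_left osums_mult_right op_exp_osums)
  qed
  ultimately show ?thesis by (rule osums_unique)
qed

end

end

subsection \<open>The generators of the flows\<close>

definition xi :: "'a::supercommutative_superalgebra ops" where "xi = cofo (var Xi)"

definition dxi :: "'a::supercommutative_superalgebra ops" where "dxi = DD 1 - xi * DD 2"

definition gen_odd :: "sgn2 \<Rightarrow> nat \<Rightarrow> 'a::supercommutative_superalgebra ops" where
  "gen_odd s n = (case s of Plus \<Rightarrow> dxi * DD 2 ^ n | Minus \<Rightarrow> xi * DD 2 ^ Suc n)"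

definition gen_even :: "sgn2 \<Rightarrow> nat \<Rightarrow> 'a::supercommutative_superalgebra ops" where
  "gen_even s n = (case s of Plus \<Rightarrow> dxi * xi * DD 2 ^ n | Minus \<Rightarrow> xi * dxi * DD 2 ^ n)"

lemma xi_xi: "xi * xi = 0"
proof -
  have "var Xi * var Xi = - (var Xi * var Xi :: 'a ser)"
    using var_commute[of Xi "var Xi :: 'a ser"] by (simp add: odd_count_X par_var)
  then have "sc 2 (var Xi * var Xi :: 'a ser) = 0"
    using sc.scale_left_distrib[of 1 1 "var Xi * var Xi :: 'a ser"] by (simp add: eq_neg_iff_add_eq_0)
  then have "var Xi * var Xi = (0 :: 'a ser)" by simp
  then show ?thesis by (intro ops_eqI) (simp add: xi_def cofo_mult opc_cofo)
qed

lemma DD2: "DD 2 = DD 1 * DD 1" by (simp add: DD_mult)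

lemma D_xi: "DD 1 * xi = 1 - xi * DD 1" by (simp add: xi_def Dxi)

lemma dx_xi: "DD 2 * xi = xi * DD 2"
proof -
  have "DD 2 * xi = DD 1 * (DD 1 * xi)" by (simp add: DD2 mult.assoc)
  also have "\<dots> = DD 1 * (1 - xi * DD 1)" by (simp only: D_xi)
  also have "\<dots> = DD 1 - DD 1 * xi * DD 1" by (simp add: right_diff_distrib mult.assoc)
  also have "\<dots> = DD 1 - (1 - xi * DD 1) * DD 1" by (simp only: D_xi)
  also have "\<dots> = xi * DD 2" by (simp add: left_diff_distrib mult.assoc DD2)
  finally show ?thesis .
qed

lemma dx_dxi: "DD 2 * dxi = dxi * DD 2"
proof -
  have "DD 2 * (xi * DD 2) = xi * DD 2 * DD 2" by (simp only: mult.assoc[symmetric] dx_xi)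
  then show ?thesis by (simp add: dxi_def right_diff_distrib left_diff_distrib DD_mult)
qed

lemma dxi_xi: "dxi * xi = 1 - xi * DD 1"
proof -
  have "dxi * xi = DD 1 * xi - xi * (DD 2 * xi)" by (simp add: dxi_def algebra_simps)
  then show ?thesis by (simp add: dx_xi D_xi xi_xi flip: mult.assoc)
qed

lemma xi_dxi: "xi * dxi = xi * DD 1"
  by (simp add: dxi_def right_diff_distrib xi_xi flip: mult.assoc)

text \<open>With \<open>xi_xi\<close>, \<open>dxi_dxi\<close> and the commuting \<open>DD 2\<close>
  these are Clifford relations. The identities between generators follow by normal ordering:
  \<open>xi\<close> to the left, then \<open>dxi\<close>, then the powers of
  \<open>DD 2\<close>.\<close>

lemma dxi_xi_anti: "dxi * xi = 1 - xi * dxi"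
  by (simp add: dxi_xi xi_dxi)

lemma dxi_dxi: "dxi * dxi = 0"
proof -
  have "dxi * dxi = dxi * DD 1 - (dxi * xi) * DD 2"
    by (simp add: dxi_def algebra_simps)
  also have "\<dots> = dxi * DD 1 - DD 2 + xi * DD 3"
    by (simp add: dxi_xi algebra_simps DD_mult)
  also have "\<dots> = 0"
    by (simp add: dxi_def algebra_simps DD_mult)
  finally show ?thesis .
qed

lemma dx_power_commute: "DD 2 ^ n * xi = xi * DD 2 ^ n" "DD 2 ^ n * dxi = dxi * DD 2 ^ n"
  by (induction n) (simp_all add: mult.assoc, simp_all add: dx_xi dx_dxi flip: mult.assoc)

lemmas gen_simps = dx_power_commute xi_xi dxi_dxi dxi_xi_anti

lemma gen_simps':
  "DD 2 ^ n * (xi * Q) = xi * (DD 2 ^ n * Q)" "DD 2 ^ n * (dxi * Q) = dxi * (DD 2 ^ n * Q)"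
  "xi * (xi * Q) = 0" "dxi * (dxi * Q) = 0" "dxi * (xi * Q) = Q - xi * (dxi * Q)"
  by (simp_all add: gen_simps left_diff_distrib flip: mult.assoc)

lemma dx_power_mult: "DD 2 ^ m * DD 2 ^ n = DD 2 ^ (m + n)" by (simp add: power_add)

lemma gen_odd_square: "gen_odd s m * gen_odd s n = 0"
  by (cases s) (simp_all only: gen_odd_def sgn2.case mult.assoc gen_simps gen_simps' mult_zero_right)

text \<open>The anticommutator of \<open>dxi\<close> and \<open>xi\<close> is 1, so only a power of
  \<open>DD 2\<close> is left, which commutes with all generators. Pairing with
  \<open>opp s\<close>, while equal signs give 0, is why the correction in \<open>tD_odd s\<close>
  carries the odd times of the opposite sign.\<close>

lemma gen_odd_anticommutator:
  "gen_odd s m * gen_odd (opp s) n + gen_odd (opp s) n * gen_odd s m = DD 2 ^ (m + n + 1)"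
  by (cases s)
    (simp_all only: gen_odd_def sgn2.case opp.simps mult.assoc gen_simps gen_simps' dx_power_mult,
     simp_all add: add_ac)

text \<open>The two even times of one index together generate a power of \<open>DD 2\<close>; hence
  the sum of two even derivatives in \<open>tD_odd\<close>, which has to reproduce such
  powers.\<close>

lemma gen_even_sum: "gen_even Plus n + gen_even Minus n = DD 2 ^ n"
  by (simp add: gen_even_def dxi_xi_anti algebra_simps)

lemma gen_even_commute: "gen_even r m * gen_even s n = gen_even s n * gen_even r m"
  by (cases r; cases s)
    (simp_all only: gen_even_def sgn2.case opp.simps mult.assoc gen_simps gen_simps' dx_power_mult right_diff_distrib,
     simp_all add: add_ac gen_simps gen_simps' left_diff_distrib right_diff_distrib mult.assoc dx_power_mult)

definition ssgn :: "sgn2 \<Rightarrow> complex" where "ssgn s = (case s of Plus \<Rightarrow> 1 | Minus \<Rightarrow> -1)"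

text \<open>\<open>dxi * xi\<close> and \<open>xi * dxi\<close> are complementary projections, and
  \<open>dxi\<close> and \<open>xi\<close> map between their ranges in opposite directions. This is
  the source of the signs in \<open>tD_even\<close>.\<close>

lemma gen_even_odd:
  "gen_even s n * gen_odd r m - gen_odd r m * gen_even s n = osc (ssgn s * ssgn r) (gen_odd r (n + m))"
  by (cases r; cases s)
    (simp_all only: gen_even_def gen_odd_def sgn2.case opp.simps mult.assoc gen_simps gen_simps' dx_power_mult right_diff_distrib
      ssgn_def,
     simp_all add: add_ac gen_simps gen_simps' gen_simps'[of 1, simplified] left_diff_distrib right_diff_distrib mult.assoc dx_power_mult)

lemma dx_power_gen_odd: "DD 2 ^ n * gen_odd s m = gen_odd s m * DD 2 ^ n"
  by (cases s) (simp_all only: gen_odd_def sgn2.case mult.assoc gen_simps gen_simps' dx_power_mult add.commute)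

lemma opar_xi: "opar xi = - xi"
  by (rule ops_eqI) (simp add: xi_def opar_cofo par_var odd_count_X opc_cofo)

lemma opar_dx: "opar (DD 2 ^ n) = DD 2 ^ n"
  by (simp add: opar_power opar_DD eps_def)

lemma opar_dxi: "opar dxi = - dxi"
  by (simp add: dxi_def opar_diff opar_mult opar_xi opar_DD eps_def)

lemma opar_gen_odd: "opar (gen_odd s n) = - gen_odd s n"
  by (cases s) (simp_all only: gen_odd_def sgn2.case opar_mult opar_dx opar_xi opar_dxi mult_minus_left)

lemma opar_gen_even: "opar (gen_even s n) = gen_even s n"
  by (cases s) (simp_all add: gen_even_def opar_mult opar_dx opar_xi opar_dxi)

lemma opd_xi [simp]: "opd s n xi = 0"
  by (rule ops_eqI) (simp add: xi_def opd_cofo opc_cofo pds_var)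

lemma opd_power0: "opd s n P = 0 \<Longrightarrow> opd s n (P ^ k) = 0"
  by (induction k) (simp_all add: opd_mult)

lemma opd_dxi [simp]: "opd s n dxi = 0"
  by (simp add: dxi_def opd_diff opd_mult)

lemma opd_gen [simp]: "opd s n (gen_odd r m) = 0" "opd s n (gen_even r m) = 0"
  by (cases r; simp add: gen_odd_def gen_even_def opd_mult opd_power0 del: power_Suc)+

lemma bd_dx: "bd (2 * int n) (opc (DD 2 ^ n))"
  using bd_opc_DD[of "2 * int n"] by (simp add: DD_power)

lemma bd_dxi: "bd 1 (opc dxi)"
  unfolding dxi_def using bd_opc_mult[OF bd_opc_xi bd_opc_DD[of 2]]
  by (intro bd_opc_diff bd_opc_DD) (simp add: xi_def)

text \<open>For \<open>Minus\<close> the degree in \<open>D\<close> is \<open>2n + 2\<close>, and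
  the factor \<open>xi\<close> makes up for the excess. The bound is the weight of the time that
  multiplies the generator, so \<open>h_odd n\<close> gets the constant 0, which powers and
  exponentials preserve.\<close>

lemma bd_gen_odd: "bd (2 * int n + 1) (opc (gen_odd s n))"
proof (cases s)
  case Plus
  then show ?thesis using bd_opc_mult[OF bd_dxi bd_dx[of n]] by (simp add: gen_odd_def algebra_simps)
next
  case Minus
  then show ?thesis using bd_opc_mult[OF bd_opc_xi bd_dx[of "Suc n"]]
    by (simp add: gen_odd_def xi_def algebra_simps del: power_Suc)
qed

lemma bd_gen_even: "bd (2 * int n) (opc (gen_even s n))"
proof (cases s)
  case Plus
  then show ?thesis using bd_opc_mult[OF bd_opc_mult[OF bd_dxi bd_opc_xi] bd_dx[of n]]
    by (simp add: gen_even_def xi_def)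
next
  case Minus
  then show ?thesis using bd_opc_mult[OF bd_opc_mult[OF bd_opc_xi bd_dxi] bd_dx[of n]]
    by (simp add: gen_even_def xi_def)
qed

definition h_odd :: "nat \<Rightarrow> 'a::supercommutative_superalgebra ops" where
  "h_odd n = tv Plus (2*n+1) * gen_odd Plus n + tv Minus (2*n+1) * gen_odd Minus n"

definition h_even :: "nat \<Rightarrow> 'a::supercommutative_superalgebra ops" where
  "h_even n = (if n \<ge> 1 then tv Plus (2*n) * gen_even Plus n + tv Minus (2*n) * gen_even Minus n else 0)"

definition Hodd :: "'a::supercommutative_superalgebra ops" where "Hodd = opsum h_odd"
definition Heven :: "'a::supercommutative_superalgebra ops" where "Heven = opsum h_even"

lemma wto_h_odd: "wto (2*n+1) (h_odd n)"
  unfolding h_odd_def by (intro wto_add wto_mult_left wto_tv)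

lemma wto_h_even: "wto (2*n) (h_even n)"
  unfolding h_even_def by (auto intro!: wto_add wto_mult_left wto_tv)

lemma bd_h_odd: "bd 0 (opc (h_odd n))"
proof -
  have "bd 0 (opc (tv s (2*n+1) * gen_odd s n))" for s
    using bd_opc_mult[OF bd_opc_tv[of "2*n+1" s] bd_gen_odd[of n s]] by simp
  then show ?thesis unfolding h_odd_def by (intro bd_opc_add)
qed

lemma bd_zero: "bd C (opc 0)"
  by (simp add: bd_def)

lemma bd_h_even: "bd 0 (opc (h_even n))"
proof -
  have "bd 0 (opc (tv s (2*n) * gen_even s n))" for s
    using bd_opc_mult[OF bd_opc_tv[of "2*n" s] bd_gen_even[of n s]] by simp
  then show ?thesis unfolding h_even_def by (auto intro!: bd_opc_add simp: bd_zero)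
qed

lemma Hodd: "osums h_odd Hodd" "bd 0 (opc Hodd)"
    "coef (opc Hodd k) \<mu> = Sum_any (\<lambda>j. coef (opc (h_odd j) k) \<mu>)"
  unfolding Hodd_def by (rule opsum[OF wto_mono[OF wto_h_odd] bd_h_odd]; simp)+

lemma Heven: "osums h_even Heven" "bd 0 (opc Heven)"
    "coef (opc Heven k) \<mu> = Sum_any (\<lambda>j. coef (opc (h_even j) k) \<mu>)"
  unfolding Heven_def by (rule opsum[OF wto_mono[OF wto_h_even] bd_h_even]; simp)+

lemma wto_Hodd: "wto 1 Hodd"
  by (rule osums_wto[OF Hodd(1)]) (rule wto_mono[OF wto_h_odd], simp)

lemma wto_Heven: "wto 1 Heven"
proof (rule osums_wto[OF Heven(1)])
  fix j show "wto 1 (h_even j)"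
    using wto_mono[OF wto_h_even, of 1 j] by (cases "j = 0") (simp_all add: h_even_def)
qed

lemma opar_h_odd: "opar (h_odd n) = h_odd n"
  by (simp add: h_odd_def opar_add opar_mult opar_tv opar_gen_odd eps_def)

lemma opar_h_even: "opar (h_even n) = h_even n"
  by (simp add: h_even_def opar_add opar_mult opar_tv opar_gen_even eps_def)

lemma opar_Hodd: "opar Hodd = Hodd"
  using osums_opar[OF Hodd(1)] Hodd(1) unfolding opar_h_odd by (rule osums_unique)

lemma opar_Heven: "opar Heven = Heven"
  using osums_opar[OF Heven(1)] Heven(1) unfolding opar_h_even by (rule osums_unique)

lemma opd_odd_Hodd: "opd s (2*n+1) Hodd = gen_odd s n"
proof -
  have "opd s (2*n+1) (h_odd j) = (if j = n then gen_odd s n else 0 :: 'a ops)" for j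
    by (cases s) (simp_all add: h_odd_def opd_add opd_mult opd_tv)
  then show ?thesis by (rule osums_eqI[OF osums_opd[OF Hodd(1)] osums_single])
qed

lemma opd_even_Hodd: "opd s (2*n) Hodd = 0"
proof -
  have "opd s (2*n) (h_odd j) = (0 :: 'a ops)" for j
    by (auto simp: h_odd_def opd_add opd_mult opd_tv) presburger+
  then show ?thesis by (rule osums_eqI[OF osums_opd[OF Hodd(1)] osums_zero])
qed

lemma opd_even_Heven: "1 \<le> n \<Longrightarrow> opd s (2*n) Heven = gen_even s n"
proof -
  assume n: "1 \<le> n"
  have "opd s (2*n) (h_even j) = (if j = n then gen_even s n else 0 :: 'a ops)" for j
    using n by (cases s) (auto simp: h_even_def opd_add opd_mult opd_tv)
  then show ?thesis by (rule osums_eqI[OF osums_opd[OF Heven(1)] osums_single])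
qed

lemma opd_odd_Heven: "opd s (2*n+1) Heven = 0"
proof -
  have "opd s (2*n+1) (h_even j) = (0 :: 'a ops)" for j
    by (auto simp: h_even_def opd_add opd_mult opd_tv) presburger+
  then show ?thesis by (rule osums_eqI[OF osums_opd[OF Heven(1)] osums_zero])
qed

lemma dx_Hodd: "DD 2 ^ n * Hodd = Hodd * DD 2 ^ n"
proof -
  have t: "DD 2 ^ n * tv s k = (tv s k * DD 2 ^ n :: 'a ops)" for s k
    by (simp add: tv_commute[of s k "DD 2 ^ n"] opart_def opar_dx)
  have "DD 2 ^ n * (tv s k * gen_odd s j) = (tv s k * gen_odd s j * DD 2 ^ n :: 'a ops)" for s k j
    by (simp add: mult.assoc dx_power_gen_odd[symmetric]) (simp add: t flip: mult.assoc)
  then have "DD 2 ^ n * h_odd j = (h_odd j * DD 2 ^ n :: 'a ops)" for j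
    by (simp add: h_odd_def distrib_left distrib_right)
  then show ?thesis by (rule osums_eqI[OF osums_mult_left[OF Hodd(1)] osums_mult_right[OF Hodd(1)]])
qed

lemma gen_even_tv: "gen_even s n * tv r m = tv r m * gen_even s n"
  by (simp only: tv_commute[of r m "gen_even s n"]) (simp add: opart_def opar_gen_even)

lemma gen_odd_tv: "gen_odd s n * tv r (2*m+1) = - (tv r (2*m+1) * gen_odd s n)"
  by (simp only: tv_commute[of r "2*m+1" "gen_odd s n"]) (simp add: opart_def opar_gen_odd)

lemma gen_even_Heven: "gen_even s n * Heven = Heven * gen_even s n"
proof -
  have "gen_even s n * (tv r k * gen_even r j) = (tv r k * gen_even r j * gen_even s n :: 'a ops)" for r k j
    by (simp add: mult.assoc gen_even_commute[of r j]) (simp add: gen_even_tv flip: mult.assoc)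
  then have "gen_even s n * h_even j = (h_even j * gen_even s n :: 'a ops)" for j
    by (simp add: h_even_def distrib_left distrib_right)
  then show ?thesis by (rule osums_eqI[OF osums_mult_left[OF Heven(1)] osums_mult_right[OF Heven(1)]])
qed

definition comm_odd :: "sgn2 \<Rightarrow> nat \<Rightarrow> 'a::supercommutative_superalgebra ops" where
  "comm_odd s n = gen_odd s n * Hodd - Hodd * gen_odd s n"

text \<open>An odd time anticommutes with \<open>gen_odd s n\<close>, so the commutator with a term
  of \<open>h_odd j\<close> is minus the time times an anticommutator. This is 0 for equal signs and
  a power of \<open>DD 2\<close> for opposite ones.\<close>

lemma comm_odd_osums: "osums (\<lambda>j. - (tv (opp s) (2*j+1) * DD 2 ^ (n + j + 1))) (comm_odd s n)"
proof -
  have t: "gen_odd s n * (tv r (2*j+1) * gen_odd r j) - tv r (2*j+1) * gen_odd r j * gen_odd s n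
    = (- (tv r (2*j+1) * (gen_odd s n * gen_odd r j + gen_odd r j * gen_odd s n)) :: 'a ops)" for r j
  proof -
    have "gen_odd s n * (tv r (2*j+1) * gen_odd r j) = (- (tv r (2*j+1) * (gen_odd s n * gen_odd r j)) :: 'a ops)"
      by (simp only: mult.assoc[symmetric] gen_odd_tv mult_minus_left)
    then show ?thesis by (simp only: distrib_left mult.assoc) simp
  qed
  have "gen_odd s n * h_odd j - h_odd j * gen_odd s n = (- (tv (opp s) (2*j+1) * DD 2 ^ (n + j + 1)) :: 'a ops)" for j
  proof -
    have "gen_odd s n * h_odd j - h_odd j * gen_odd s n =
      (gen_odd s n * (tv Plus (2*j+1) * gen_odd Plus j) - tv Plus (2*j+1) * gen_odd Plus j * gen_odd s n :: 'a ops)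
      + (gen_odd s n * (tv Minus (2*j+1) * gen_odd Minus j) - tv Minus (2*j+1) * gen_odd Minus j * gen_odd s n)"
      by (simp only: h_odd_def distrib_left distrib_right) (simp add: algebra_simps)
    also have "\<dots> = - (tv (opp s) (2*j+1) * DD 2 ^ (n + j + 1))"
    proof -
      have "gen_odd s n * gen_odd (opp s) j + gen_odd (opp s) j * gen_odd s n = (DD 2 ^ (n + j + 1) :: 'a ops)"
        by (rule gen_odd_anticommutator)
      then show ?thesis
        unfolding t by (cases s) (simp_all only: opp.simps gen_odd_square, simp_all)
    qed
    finally show ?thesis .
  qed
  then have "(\<lambda>j. - (tv (opp s) (2*j+1) * DD 2 ^ (n + j + 1))) = (\<lambda>j. gen_odd s n * h_odd j - (h_odd j * gen_odd s n :: 'a ops))"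
    by (simp only:)
  then show ?thesis
    unfolding comm_odd_def by (simp only: osums_diff osums_mult_left osums_mult_right Hodd(1))
qed

text \<open>\<open>Hodd\<close> is even, so the odd times commute with it without a sign, and so do
  the powers of \<open>DD 2\<close>. This is the hypothesis on \<open>c\<close> in
  \<open>op_exp_derivation\<close>.\<close>

lemma comm_odd_Hodd: "comm_odd s n * Hodd = Hodd * comm_odd s n"
proof -
  have "tv r (2*j+1) * DD 2 ^ k * Hodd = (Hodd * (tv r (2*j+1) * DD 2 ^ k) :: 'a ops)" for r j k
  proof -
    have "tv r (2*j+1) * DD 2 ^ k * Hodd = (tv r (2*j+1) * Hodd) * (DD 2 ^ k :: 'a ops)"
      by (simp add: mult.assoc dx_Hodd)
    also have "tv r (2*j+1) * Hodd = (Hodd * tv r (2*j+1) :: 'a ops)"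
      by (simp only: tv_commute[of r "2*j+1" Hodd]) (simp add: opart_def opar_Hodd)
    finally show ?thesis by (simp add: mult.assoc)
  qed
  then have "- (tv r (2*j+1) * DD 2 ^ k) * Hodd = (Hodd * - (tv r (2*j+1) * DD 2 ^ k) :: 'a ops)" for r j k
    by (simp only: mult_minus_left mult_minus_right)
  then show ?thesis
    by (rule osums_eqI[OF osums_mult_right[OF comm_odd_osums] osums_mult_left[OF comm_odd_osums]])
qed

subsection \<open>The flows\<close>

definition sum_odd :: "sgn2 \<Rightarrow> nat \<Rightarrow> 'a::supercommutative_superalgebra ops \<Rightarrow> 'a ops" where
  "sum_odd s n P = opsum (\<lambda>m. tv (opp s) (2*m+1) * (opd Plus (2*(n+m+1)) P + opd Minus (2*(n+m+1)) P))"

definition sum_even :: "nat \<Rightarrow> 'a::supercommutative_superalgebra ops \<Rightarrow> 'a ops" where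
  "sum_even n P = opsum (\<lambda>m. tv Plus (2*m+1) * opd Plus (2*(n+m)+1) P - tv Minus (2*m+1) * opd Minus (2*(n+m)+1) P)"

definition flow_odd :: "sgn2 \<Rightarrow> nat \<Rightarrow> 'a::supercommutative_superalgebra ops \<Rightarrow> 'a ops" where
  "flow_odd s n P = opd s (2*n+1) P - osc (1/2) (sum_odd s n P)"

definition flow_even :: "sgn2 \<Rightarrow> nat \<Rightarrow> 'a::supercommutative_superalgebra ops \<Rightarrow> 'a ops" where
  "flow_even s n P = opd s (2*n) P + osc (ssgn s) (sum_even n P)"

lemma sum_odd:
  fixes P :: "'a::supercommutative_superalgebra ops"
  shows "osums (\<lambda>m. tv (opp s) (2*m+1) * (opd Plus (2*(n+m+1)) P + opd Minus (2*(n+m+1)) P)) (sum_odd s n P)"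
    "coef (opc (sum_odd s n P) k) \<mu> = Sum_any (\<lambda>m. coef (opc
      (tv (opp s) (2*m+1) * (opd Plus (2*(n+m+1)) P + opd Minus (2*(n+m+1)) P)) k) \<mu>)"
proof -
  obtain C where C: "bd C (opc P)" by (rule ops_bd)
  \<comment> \<open>The derivative raises the constant by \<open>2(n+m+1)\<close> and the time
    lowers it by \<open>2m+1\<close>; the difference is the same for all \<open>m\<close>, as
    \<open>opsum\<close> requires.\<close>
  have b: "bd (C + 2 * int n + 1) (opc (tv (opp s) (2*m+1) * (opd Plus (2*(n+m+1)) P + opd Minus (2*(n+m+1)) P)))" for m
    using bd_opc_mult[OF bd_opc_tv[of "2*m+1" "opp s"] bd_opc_add[OF bd_opc_opd[OF C] bd_opc_opd[OF C]], of "2*(n+m+1)" Plus Minus]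
    by (simp add: algebra_simps)
  have w: "wto m (tv (opp s) (2*m+1) * (opd Plus (2*(n+m+1)) P + opd Minus (2*(n+m+1)) P))" for m
    by (intro wto_mult_left wto_mono[OF wto_tv]) simp
  show "osums (\<lambda>m. tv (opp s) (2*m+1) * (opd Plus (2*(n+m+1)) P + opd Minus (2*(n+m+1)) P)) (sum_odd s n P)"
    "coef (opc (sum_odd s n P) k) \<mu> = Sum_any (\<lambda>m. coef (opc
      (tv (opp s) (2*m+1) * (opd Plus (2*(n+m+1)) P + opd Minus (2*(n+m+1)) P)) k) \<mu>)"
    unfolding sum_odd_def by (rule opsum[OF w b])+
qed

lemma sum_even:
  fixes P :: "'a::supercommutative_superalgebra ops"
  shows "osums (\<lambda>m. tv Plus (2*m+1) * opd Plus (2*(n+m)+1) P - tv Minus (2*m+1) * opd Minus (2*(n+m)+1) P) (sum_even n P)"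
    "coef (opc (sum_even n P) k) \<mu> = Sum_any (\<lambda>m. coef (opc
      (tv Plus (2*m+1) * opd Plus (2*(n+m)+1) P - tv Minus (2*m+1) * opd Minus (2*(n+m)+1) P) k) \<mu>)"
proof -
  obtain C where C: "bd C (opc P)" by (rule ops_bd)
  have "bd (C + 2 * int n) (opc (tv s (2*m+1) * opd s (2*(n+m)+1) P))" for m s
    using bd_opc_mult[OF bd_opc_tv[of "2*m+1" s] bd_opc_opd[OF C], of "2*(n+m)+1" s]
    by (simp add: algebra_simps)
  then have b: "bd (C + 2 * int n) (opc (tv Plus (2*m+1) * opd Plus (2*(n+m)+1) P - tv Minus (2*m+1) * opd Minus (2*(n+m)+1) P))" for m
    by (intro bd_opc_diff)
  have w: "wto m (tv Plus (2*m+1) * opd Plus (2*(n+m)+1) P - tv Minus (2*m+1) * opd Minus (2*(n+m)+1) P)" for m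
    by (intro wto_diff wto_mult_left wto_mono[OF wto_tv]) simp_all
  show "osums (\<lambda>m. tv Plus (2*m+1) * opd Plus (2*(n+m)+1) P - tv Minus (2*m+1) * opd Minus (2*(n+m)+1) P) (sum_even n P)"
    "coef (opc (sum_even n P) k) \<mu> = Sum_any (\<lambda>m. coef (opc
      (tv Plus (2*m+1) * opd Plus (2*(n+m)+1) P - tv Minus (2*m+1) * opd Minus (2*(n+m)+1) P) k) \<mu>)"
    unfolding sum_even_def by (rule opsum[OF w b])+
qed

lemma sum_odd_mult: "sum_odd s n (P * Q) = sum_odd s n P * Q + opar P * sum_odd s n Q"
proof -
  have "tv (opp s) (2*m+1) * P = opar P * tv (opp s) (2*m+1)" for m
    by (simp only: tv_commute[of "opp s" "2*m+1" P]) (simp add: opart_def)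
  then have "tv (opp s) (2*m+1) * (P * R) = opar P * (tv (opp s) (2*m+1) * R)" for m R
    by (simp only: mult.assoc[symmetric])
  then have "osums (\<lambda>m. tv (opp s) (2*m+1) * (opd Plus (2*(n+m+1)) (P * Q) + opd Minus (2*(n+m+1)) (P * Q)))
     (sum_odd s n P * Q + opar P * sum_odd s n Q)"
    using osums_add[OF osums_mult_right[OF sum_odd(1)[of s n P], of Q] osums_mult_left[OF sum_odd(1)[of s n Q], of "opar P"]]
    by (simp add: opd_mult opart_def algebra_simps)
  then show ?thesis using sum_odd(1) osums_unique by blast
qed

text \<open>The odd derivative twists \<open>P\<close> and the odd time in front twists it back, so
  the result is an even derivation. In \<open>sum_odd\<close> the derivatives are even and the twist
  by the time remains.\<close>

lemma sum_even_mult: "sum_even n (P * Q) = sum_even n P * Q + P * sum_even n Q"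
proof -
  have "tv s (2*m+1) * opar P = P * tv s (2*m+1)" for m s
    by (simp only: tv_commute[of s "2*m+1" "opar P"]) (simp add: opart_def)
  then have "tv s (2*m+1) * (opar P * R) = P * (tv s (2*m+1) * R)" for m R s
    by (simp only: mult.assoc[symmetric])
  then have "osums (\<lambda>m. tv Plus (2*m+1) * opd Plus (2*(n+m)+1) (P * Q) - tv Minus (2*m+1) * opd Minus (2*(n+m)+1) (P * Q))
     (sum_even n P * Q + P * sum_even n Q)"
    using osums_add[OF osums_mult_right[OF sum_even(1)[of n P], of Q] osums_mult_left[OF sum_even(1)[of n Q], of P]]
    by (simp add: opd_mult opart_def algebra_simps)
  then show ?thesis using sum_even(1) osums_unique by blast
qed

lemma sum_odd_zero: "(\<And>r m. opd r (2*m) P = 0) \<Longrightarrow> sum_odd s n P = 0"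
proof -
  assume z: "\<And>r m. opd r (2*m) P = 0"
  have "osums (\<lambda>m. 0) (sum_odd s n P)" using sum_odd(1)[of s n P] unfolding z by simp
  then show ?thesis using osums_zero osums_unique by blast
qed

lemma sum_even_zero: "(\<And>r m. opd r (2*m+1) P = 0) \<Longrightarrow> sum_even n P = 0"
proof -
  assume z: "\<And>r m. opd r (2*m+1) P = 0"
  have "osums (\<lambda>m. 0) (sum_even n P)" using sum_even(1)[of n P] unfolding z by simp
  then show ?thesis using osums_zero osums_unique by blast
qed

lemma sum_even_diff: "sum_even n (P - Q) = sum_even n P - sum_even n Q"
proof -
  have "osums (\<lambda>m. tv Plus (2*m+1) * opd Plus (2*(n+m)+1) (P - Q) - tv Minus (2*m+1) * opd Minus (2*(n+m)+1) (P - Q))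
    (sum_even n P - sum_even n Q)"
    using osums_diff[OF sum_even(1)[of n P] sum_even(1)[of n Q]]
    by (simp add: opd_diff algebra_simps)
  then show ?thesis using sum_even(1) osums_unique by blast
qed

lemma sum_even_osc: "sum_even n (osc c P) = osc c (sum_even n P)"
proof -
  have "osums (\<lambda>m. tv Plus (2*m+1) * opd Plus (2*(n+m)+1) (osc c P) - tv Minus (2*m+1) * opd Minus (2*(n+m)+1) (osc c P))
    (osc c (sum_even n P))"
    using osums_osc[OF sum_even(1)[of n P], of c]
    by (simp add: opd_osc osc_mult_right osc.scale_right_diff_distrib)
  then show ?thesis using sum_even(1) osums_unique by blast
qed

text \<open>The loss of weight is independent of \<open>m\<close>: the derivative costs
  \<open>2(n+m)+1\<close> and the time returns \<open>2m+1\<close>. Once \<open>2m+1\<close> reaches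
  \<open>w\<close>, the time alone provides the weight.\<close>

lemma wto_sum_even: "wto (w + 2*n) P \<Longrightarrow> wto w (sum_even n P)"
proof (rule osums_wto[OF sum_even(1)])
  fix m assume P: "wto (w + 2*n) P"
  have "wto w (tv s (2*m+1) * opd s (2*(n+m)+1) P)" for s
  proof (cases "w \<le> 2*m+1")
    case True
    then show ?thesis by (intro wto_mult_left wto_mono[OF wto_tv])
  next
    case False
    then have "wto (w - (2*m+1)) (opd s (2*(n+m)+1) P)"
      using P by (intro wto_opd) (simp add: algebra_simps)
    from wto_mult[OF wto_tv[of "2*m+1" s] this] show ?thesis using False by simp
  qed
  then show "wto w (tv Plus (2*m+1) * opd Plus (2*(n+m)+1) P - tv Minus (2*m+1) * opd Minus (2*(n+m)+1) P)"
    by (intro wto_diff)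
qed

lemma flow_odd_mult: "flow_odd s n (P * Q) = flow_odd s n P * Q + opar P * flow_odd s n Q"
  by (simp add: flow_odd_def opd_mult sum_odd_mult opart_def osc.scale_right_distrib
      osc_mult_left osc_mult_right algebra_simps)

lemma flow_even_mult: "flow_even s n (P * Q) = flow_even s n P * Q + P * flow_even s n Q"
  by (simp add: flow_even_def opd_mult sum_even_mult opart_def osc.scale_right_distrib
      osc_mult_left osc_mult_right algebra_simps)

lemma wto_opd': "wto (w + n) P \<Longrightarrow> wto w (opd s n P)"
  by (rule wto_opd) (simp add: add.commute)

lemma opd_even_Ex_Hodd: "opd s (2*n) (op_exp Hodd) = 0"
  using op_exp_derivation[OF wto_Hodd Hodd(2), of "opd s (2*n) :: 'a ops \<Rightarrow> 'a ops" "2*n" 0 0]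
  by (simp add: opd_diff opd_osc opd_mult opart_def opd_even_Hodd wto_opd')

lemma opd_odd_Ex_Heven: "opd s (2*n+1) (op_exp Heven) = 0"
  using op_exp_derivation[OF wto_Heven Heven(2), of "opd s (2*n+1) :: 'a ops \<Rightarrow> 'a ops" "2*n+1" 0 0]
  by (simp add: opd_diff opd_osc opd_mult opart_def wto_opd' opar_Heven opd_odd_Heven[simplified])

lemma opd_even_Ex_Heven: "1 \<le> n \<Longrightarrow> opd s (2*n) (op_exp Heven) = gen_even s n * op_exp Heven"
  using op_exp_derivation[OF wto_Heven Heven(2), of "opd s (2*n) :: 'a ops \<Rightarrow> 'a ops" "2*n" "gen_even s n" 0]
  by (simp add: opd_diff opd_osc opd_mult opart_def opd_even_Heven wto_opd' gen_even_Heven)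

lemma opd_odd_Ex_Hodd:
  "opd s (2*n+1) (op_exp Hodd) = gen_odd s n * op_exp Hodd - osc (1/2) (comm_odd s n * op_exp Hodd)"
proof (rule op_exp_derivation[OF wto_Hodd Hodd(2), where d = "2*n+1"])
  show "gen_odd s n * Hodd = Hodd * gen_odd s n + comm_odd s n" by (simp add: comm_odd_def)
qed (simp_all add: opd_diff opd_osc opd_mult opart_def wto_opd' opar_Hodd comm_odd_Hodd opd_odd_Hodd[simplified])

definition evol :: "'a::supercommutative_superalgebra ops" where "evol = op_exp Hodd * op_exp Heven"

text \<open>\<open>op_exp Hodd\<close> has vanishing even derivatives and
  \<open>op_exp Heven\<close> vanishing odd ones. With \<open>c = comm_odd s n\<close>, the plain
  derivative acts on the first factor and leaves \<open>- c / 2\<close>. The correction acts on the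
  second factor, where by \<open>gen_even_sum\<close> its sum is \<open>- c\<close>, and the factor
  \<open>- 1/2\<close> of the flow turns this into \<open>+ c / 2\<close>. The two cancel since
  \<open>c\<close> commutes with \<open>op_exp Hodd\<close>.\<close>

lemma flow_odd_evol: "flow_odd s n evol = gen_odd s n * evol"
proof -
  have 1: "flow_odd s n (op_exp Hodd) = (gen_odd s n * op_exp Hodd - osc (1/2) (comm_odd s n * op_exp Hodd) :: 'a ops)"
    by (simp add: flow_odd_def opd_odd_Ex_Hodd[simplified] sum_odd_zero opd_even_Ex_Hodd)
  have "tv (opp s) (2*m+1) * (opd Plus (2*(n+m+1)) (op_exp Heven) + opd Minus (2*(n+m+1)) (op_exp Heven))
     = (tv (opp s) (2*m+1) * DD 2 ^ (n + m + 1) * op_exp Heven :: 'a ops)" for m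
  proof -
    have "opd Plus (2*(n+m+1)) (op_exp Heven) + opd Minus (2*(n+m+1)) (op_exp Heven) = (DD 2 ^ (n + m + 1) * op_exp Heven :: 'a ops)"
      by (simp only: opd_even_Ex_Heven le_add2 gen_even_sum flip: distrib_right)
    then show ?thesis by (simp only: mult.assoc)
  qed
  then have "tv (opp s) (2*m+1) * (opd Plus (2*(n+m+1)) (op_exp Heven) + opd Minus (2*(n+m+1)) (op_exp Heven))
     = (- (- (tv (opp s) (2*m+1) * DD 2 ^ (n + m + 1)) * op_exp Heven) :: 'a ops)" for m
    by (simp only: mult_minus_left minus_minus)
  then have "sum_odd s n (op_exp Heven) = (- (comm_odd s n * op_exp Heven) :: 'a ops)"
    by (rule osums_eqI[OF sum_odd(1) osums_minus[OF osums_mult_right[OF comm_odd_osums]]])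
  then have 0: "flow_odd s n (op_exp Heven) = (osc (1/2) (comm_odd s n * op_exp Heven) :: 'a ops)"
    by (simp add: flow_odd_def opd_odd_Ex_Heven[simplified])
  have "comm_odd s n * op_exp Hodd = (op_exp Hodd * comm_odd s n :: 'a ops)"
    by (rule op_exp_commute[OF wto_Hodd Hodd(2) comm_odd_Hodd])
  then have "op_exp Hodd * (comm_odd s n * op_exp Heven) = (comm_odd s n * (op_exp Hodd * op_exp Heven) :: 'a ops)"
    by (simp only: mult.assoc[symmetric])
  then show ?thesis
    by (simp add: evol_def flow_odd_mult 1 0 op_exp_opar[OF wto_Hodd Hodd(2) opar_Hodd] left_diff_distrib
        osc_mult_left osc_mult_right mult.assoc)
qed

text \<open>Differentiating \<open>Hodd\<close> by the odd time of index \<open>2(n+j)+1\<close>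
  gives \<open>gen_odd r (n + j)\<close>. Multiplied by the time of index \<open>2j+1\<close> this
  is, up to the sign of \<open>gen_even_odd\<close>, the commutator of \<open>gen_even s n\<close>
  with a term of \<open>h_odd j\<close>.\<close>

lemma flow_even_Hodd: "flow_even s n Hodd = gen_even s n * Hodd - Hodd * gen_even s n"
proof -
  have t: "gen_even s n * (tv r k * gen_odd r j) - tv r k * gen_odd r j * gen_even s n
     = (osc (ssgn s * ssgn r) (tv r k * gen_odd r (n + j)) :: 'a ops)" for r k j
  proof -
    have "gen_even s n * (tv r k * gen_odd r j) - tv r k * gen_odd r j * gen_even s n
      = (tv r k * (gen_even s n * gen_odd r j - gen_odd r j * gen_even s n) :: 'a ops)"
      by (simp add: right_diff_distrib mult.assoc) (simp add: gen_even_tv flip: mult.assoc)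
    then show ?thesis by (simp add: gen_even_odd osc_mult_right)
  qed
  have e: "gen_even s n * h_odd j - h_odd j * gen_even s n =
     osc (ssgn s) (tv Plus (2*j+1) * opd Plus (2*(n+j)+1) Hodd - tv Minus (2*j+1) * opd Minus (2*(n+j)+1) (Hodd :: 'a ops))" for j
  proof -
    have "gen_even s n * h_odd j - h_odd j * gen_even s n =
     (gen_even s n * (tv Plus (2*j+1) * gen_odd Plus j) - tv Plus (2*j+1) * gen_odd Plus j * gen_even s n :: 'a ops) +
     (gen_even s n * (tv Minus (2*j+1) * gen_odd Minus j) - tv Minus (2*j+1) * gen_odd Minus j * gen_even s n)"
      by (simp only: h_odd_def distrib_left distrib_right) (simp add: algebra_simps)
    then show ?thesis
      unfolding t opd_odd_Hodd by (simp add: ssgn_def osc.scale_right_diff_distrib)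
  qed
  have "osums (\<lambda>j. gen_even s n * h_odd j - h_odd j * gen_even s n) (gen_even s n * Hodd - Hodd * gen_even s n :: 'a ops)"
    by (intro osums_diff osums_mult_left osums_mult_right Hodd(1))
  moreover have "osums (\<lambda>j. gen_even s n * h_odd j - h_odd j * gen_even s n) (osc (ssgn s) (sum_even n (Hodd :: 'a ops)))"
    unfolding e by (intro osums_osc sum_even(1))
  ultimately have "osc (ssgn s) (sum_even n Hodd) = (gen_even s n * Hodd - Hodd * gen_even s n :: 'a ops)"
    using osums_unique by blast
  then show ?thesis by (simp add: flow_even_def opd_even_Hodd)
qed

text \<open>With \<open>g = gen_even s n\<close>, the flow sends \<open>op_exp Hodd\<close> to its
  commutator with \<open>g\<close> and \<open>op_exp Heven\<close> to
  \<open>g * op_exp Heven\<close>; in the product rule the terms with \<open>g\<close> in the middle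
  cancel.\<close>

lemma flow_even_evol:
  assumes "1 \<le> n"
  shows "flow_even s n evol = gen_even s n * evol"
proof -
  have 1: "flow_even s n (op_exp Hodd) = (gen_even s n * op_exp Hodd - op_exp Hodd * gen_even s n :: 'a ops)"
  proof (rule op_exp_bracket[OF wto_Hodd Hodd(2), where d = "2*n"])
    show "flow_even s n (x - y) = flow_even s n x - flow_even s n y" for x y
      by (simp add: flow_even_def opd_diff sum_even_diff osc.scale_right_diff_distrib algebra_simps)
    show "flow_even s n (osc c x) = osc c (flow_even s n x)" for c x
      by (simp add: flow_even_def opd_osc sum_even_osc osc.scale_right_distrib mult.commute)
    show "wto w (flow_even s n x)" if "wto (w + 2*n) x" for w x
      unfolding flow_even_def using that
      by (intro wto_add wto_osc wto_sum_even wto_opd) (simp_all add: add.commute)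
    show "flow_even s n 1 = 0" by (simp add: flow_even_def sum_even_zero)
    show "flow_even s n (Hodd * X) = (gen_even s n * Hodd - Hodd * gen_even s n) * X + Hodd * flow_even s n X" for X
      by (simp add: flow_even_mult flow_even_Hodd)
  qed
  have 0: "flow_even s n (op_exp Heven) = (gen_even s n * op_exp Heven :: 'a ops)"
    using opd_even_Ex_Heven[OF assms] by (simp add: flow_even_def sum_even_zero opd_odd_Ex_Heven[simplified])
  show ?thesis by (simp add: evol_def flow_even_mult 1 0 left_diff_distrib mult.assoc)
qed

subsection \<open>The coefficient algebra\<close>

text \<open>A series belongs to \<open>coeffRt\<close> iff, for each \<open>t\<close>-monomial \<open>\<mu>\<close>, its coefficients at the
  monomials \<open>\<rho> \<mu>\<close> with \<open>\<rho>\<close> in \<open>x, \<xi>\<close> span a finite-dimensional space.\<close>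

definition fd :: "'a::supercommutative_superalgebra ser \<Rightarrow> bool" where
  "fd f \<longleftrightarrow> (\<forall>\<mu>. X \<notin># \<mu> \<and> Xi \<notin># \<mu> \<longrightarrow>
     (\<exists>B. finite B \<and> (\<forall>\<rho>. set_mset \<rho> \<subseteq> {X, Xi} \<longrightarrow> coef f (\<rho> + \<mu>) \<in> scaleC.span B)))"

lemma fd_imp_coeffRt:
  fixes f :: "'a::supercommutative_superalgebra ser"
  assumes "fd f"
  shows "coef f \<in> coeffRt"
proof -
  have "t_coeff \<mu> (coef f) \<in> coeffR" if \<mu>: "X \<notin># \<mu> \<and> Xi \<notin># \<mu>" for \<mu>
  proof -
    obtain B where B: "finite B" "\<And>\<rho>. set_mset \<rho> \<subseteq> {X, Xi} \<Longrightarrow> coef f (\<rho> + \<mu>) \<in> scaleC.span B"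
      using assms \<mu> unfolding fd_def by blast
    obtain k :: nat and a where a: "B = a ` {i. i < k}" "inj_on a {i. i < k}"
      using finite_imp_nat_seg_image_inj_on[OF B(1)] by blast
    have "\<exists>u. coef f (\<rho> + \<mu>) = (\<Sum>i<k. u i *\<^sub>C a i)" if \<rho>: "set_mset \<rho> \<subseteq> {X, Xi}" for \<rho>
    proof -
      obtain u where "coef f (\<rho> + \<mu>) = (\<Sum>b\<in>B. u b *\<^sub>C b)"
        using B(2)[OF \<rho>] unfolding scaleC.span_finite[OF B(1)] by auto
      then have "coef f (\<rho> + \<mu>) = (\<Sum>i<k. u (a i) *\<^sub>C a i)"
        unfolding a(1) sum.reindex[OF a(2)] by (simp add: lessThan_def)
      then show ?thesis by (rule exI[of _ "\<lambda>i. u (a i)"])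
    qed
    then obtain u where u: "\<And>\<rho>. set_mset \<rho> \<subseteq> {X, Xi} \<Longrightarrow> coef f (\<rho> + \<mu>) = (\<Sum>i<k. u \<rho> i *\<^sub>C a i)"
      by metis
    \<comment> \<open>Putting 0 where the coefficient vanishes confines the support to valid
      monomials, as \<open>C_x_xi\<close> demands.\<close>
    define \<phi> where "\<phi> i m = (if set_mset m \<subseteq> {X, Xi} \<and> coef f (m + \<mu>) \<noteq> 0 then u m i else 0)" for i m
    have "\<phi> i \<in> C_x_xi" for i
    proof -
      have "valid m" if "coef f (m + \<mu>) \<noteq> 0" for m
        using that coef_invalid[of "m + \<mu>" f] valid_add(1)[of m \<mu>] by blast
      then show ?thesis by (simp add: C_x_xi_def \<phi>_def)
    qed
    moreover have "t_coeff \<mu> (coef f) = (\<lambda>m. \<Sum>i<k. \<phi> i m *\<^sub>C a i)"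
    proof
      fix m show "t_coeff \<mu> (coef f) m = (\<Sum>i<k. \<phi> i m *\<^sub>C a i)"
        using u[of m] unfolding t_coeff_def \<phi>_def by (cases "coef f (m + \<mu>) = 0") simp_all
    qed
    ultimately show ?thesis unfolding coeffR_def by blast
  qed
  then show ?thesis using coef_invalid[of _ f] unfolding coeffRt_def by blast
qed

lemma coeffRt_imp_fd:
  assumes "coef f \<in> coeffRt"
  shows "fd f"
  unfolding fd_def
proof (intro allI impI)
  fix \<mu> :: smon assume "X \<notin># \<mu> \<and> Xi \<notin># \<mu>"
  then have "t_coeff \<mu> (coef f) \<in> coeffR" using assms unfolding coeffRt_def by blast
  then obtain k :: nat and a \<phi> where k: "t_coeff \<mu> (coef f) = (\<lambda>m. \<Sum>i<k. \<phi> i m *\<^sub>C a i)"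
    unfolding coeffR_def by blast
  have "coef f (\<rho> + \<mu>) \<in> scaleC.span (a ` {..<k})" if "set_mset \<rho> \<subseteq> {X, Xi}" for \<rho>
  proof -
    have "coef f (\<rho> + \<mu>) = (\<Sum>i<k. \<phi> i \<rho> *\<^sub>C a i)"
      using that fun_cong[OF k, of \<rho>] by (simp add: t_coeff_def)
    then show ?thesis
      by (auto intro!: scaleC.span_sum scaleC.span_scale intro: scaleC.span_base)
  qed
  then show "\<exists>B. finite B \<and> (\<forall>\<rho>. set_mset \<rho> \<subseteq> {X, Xi} \<longrightarrow> coef f (\<rho> + \<mu>) \<in> scaleC.span B)"
    by (intro exI[of _ "a ` {..<k}"]) simp
qed

lemma span_parity_inv:
  assumes "x \<in> scaleC.span B" shows "parity_inv x \<in> scaleC.span (parity_inv ` B)"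
  using assms
proof (induction rule: scaleC.span_induct_alt)
  case (step c x y)
  then show ?case
    by (simp add: parity_inv_add parity_inv_scaleC scaleC.span_add scaleC.span_scale scaleC.span_base)
qed (simp add: scaleC.span_zero)

lemma span_parity_inv_funpow:
  assumes "x \<in> scaleC.span B" shows "(parity_inv ^^ n) x \<in> scaleC.span (B \<union> parity_inv ` B)"
  using assms span_parity_inv[OF assms] scaleC.span_mono[of B "B \<union> parity_inv ` B"]
    scaleC.span_mono[of "parity_inv ` B" "B \<union> parity_inv ` B"]
  by (auto simp: parity_inv_funpow)

lemma span_mult:
  assumes "x \<in> scaleC.span A" "y \<in> scaleC.span B"
  shows "x * y \<in> scaleC.span ((\<lambda>(a, b). a * b) ` (A \<times> B))"
  using assms(1)
proof (induction rule: scaleC.span_induct_alt)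
  case (step c a z)
  have "a * y \<in> scaleC.span ((\<lambda>(a, b). a * b) ` (A \<times> B))"
    using assms(2)
  proof (induction rule: scaleC.span_induct_alt)
    case (step d b w)
    have "a * b \<in> (\<lambda>(a, b). a * b) ` (A \<times> B)" using step \<open>a \<in> A\<close> by auto
    then show ?case using step
      by (simp add: distrib_left scaleC_mult_right scaleC.span_add scaleC.span_scale scaleC.span_base)
  qed (simp add: scaleC.span_zero)
  then show ?case using step
    by (simp add: distrib_right scaleC_mult_left scaleC.span_add scaleC.span_scale)
qed (simp add: scaleC.span_zero)

lemma fdD:
  assumes "fd f" "X \<notin># \<mu>" "Xi \<notin># \<mu>"
  obtains B where "finite B" "\<And>\<rho>. set_mset \<rho> \<subseteq> {X, Xi} \<Longrightarrow> coef f (\<rho> + \<mu>) \<in> scaleC.span B"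
  using assms unfolding fd_def by blast

lemma fd_zero: "fd 0"
  unfolding fd_def by (auto intro!: exI[of _ "{}"])

lemma fd_add: assumes "fd f" "fd g" shows "fd (f + g)"
  unfolding fd_def
proof (intro allI impI)
  fix \<mu> :: smon assume \<mu>: "X \<notin># \<mu> \<and> Xi \<notin># \<mu>"
  obtain B where B: "finite B" "\<And>\<rho>. set_mset \<rho> \<subseteq> {X, Xi} \<Longrightarrow> coef f (\<rho> + \<mu>) \<in> scaleC.span B"
    using fdD[OF assms(1)] \<mu> by blast
  obtain C where C: "finite C" "\<And>\<rho>. set_mset \<rho> \<subseteq> {X, Xi} \<Longrightarrow> coef g (\<rho> + \<mu>) \<in> scaleC.span C"
    using fdD[OF assms(2)] \<mu> by blast
  show "\<exists>B. finite B \<and> (\<forall>\<rho>. set_mset \<rho> \<subseteq> {X, Xi} \<longrightarrow> coef (f + g) (\<rho> + \<mu>) \<in> scaleC.span B)"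
    using B C scaleC.span_mono[of B "B \<union> C"] scaleC.span_mono[of C "B \<union> C"]
    by (intro exI[of _ "B \<union> C"]) (auto intro!: scaleC.span_add)
qed

lemma fd_sc: "fd f \<Longrightarrow> fd (sc c f)"
  unfolding fd_def coef_sc by (meson scaleC.span_scale)

lemma fd_minus: "fd f \<Longrightarrow> fd (- f)"
  using fd_sc[of f "-1"] by simp

lemma fd_sum: "(\<And>i. i \<in> A \<Longrightarrow> fd (F i)) \<Longrightarrow> fd (sum F A)"
  by (induction A rule: infinite_finite_induct) (auto simp: fd_zero fd_add)

lemma fd_par: assumes "fd f" shows "fd (par f)"
  unfolding fd_def
proof (intro allI impI)
  fix \<mu> :: smon assume \<mu>: "X \<notin># \<mu> \<and> Xi \<notin># \<mu>"
  obtain B where B: "finite B" "\<And>\<rho>. set_mset \<rho> \<subseteq> {X, Xi} \<Longrightarrow> coef f (\<rho> + \<mu>) \<in> scaleC.span B"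
    using fdD[OF assms(1)] \<mu> by blast
  show "\<exists>B. finite B \<and> (\<forall>\<rho>. set_mset \<rho> \<subseteq> {X, Xi} \<longrightarrow> coef (par f) (\<rho> + \<mu>) \<in> scaleC.span B)"
    using B span_parity_inv
    by (intro exI[of _ "parity_inv ` B"]) (auto simp: coef_par intro!: scaleC.span_scale)
qed

lemma fd_one: "fd 1"
  unfolding fd_def
  by (intro allI impI exI[of _ "{1}"]) (auto simp: coef_one scaleC.span_zero intro: scaleC.span_base)

lemma fd_var: "fd (var v)"
proof (cases "valid {#v#}")
  case True
  then show ?thesis unfolding fd_def
    by (intro allI impI exI[of _ "{1}"]) (auto simp: coef_var scaleC.span_zero intro: scaleC.span_base)
qed (simp add: var_invalid fd_zero)

lemma fd_pds: assumes "fd f" "v = X \<or> v = Xi" shows "fd (pds v f)"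
  unfolding fd_def
proof (intro allI impI)
  fix \<mu> :: smon assume \<mu>: "X \<notin># \<mu> \<and> Xi \<notin># \<mu>"
  obtain B where B: "finite B" "\<And>\<rho>. set_mset \<rho> \<subseteq> {X, Xi} \<Longrightarrow> coef f (\<rho> + \<mu>) \<in> scaleC.span B"
    using fdD[OF assms(1)] \<mu> by blast
  have "coef f (add_mset v (\<rho> + \<mu>)) \<in> scaleC.span B" if "set_mset \<rho> \<subseteq> {X, Xi}" for \<rho>
    using B(2)[of "add_mset v \<rho>"] that assms(2) by auto
  then show "\<exists>B. finite B \<and> (\<forall>\<rho>. set_mset \<rho> \<subseteq> {X, Xi} \<longrightarrow> coef (pds v f) (\<rho> + \<mu>) \<in> scaleC.span B)"
    using B(1)
    by (intro exI[of _ "B \<union> parity_inv ` B"]) (auto simp: coef_pds intro!: scaleC.span_scale span_parity_inv_funpow)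
qed

text \<open>A \<open>t\<close>-monomial has finitely many submonomials, so the spanning sets of
  \<open>f\<close> and of \<open>g\<close> at all of them have finite unions, and products from
  these span the coefficients. The parity images appear because the product twists the coefficients
  of \<open>g\<close>.\<close>

lemma fd_mult: 
  fixes f g :: "'a::supercommutative_superalgebra ser"
  assumes "fd f" "fd g" shows "fd (f * g)"
  unfolding fd_def
proof (intro allI impI)
  fix \<mu> :: smon assume \<mu>: "X \<notin># \<mu> \<and> Xi \<notin># \<mu>"
  have nu: "\<forall>\<nu>\<in>{\<nu>. \<nu> \<subseteq># \<mu>}. X \<notin># \<nu> \<and> Xi \<notin># \<nu>"
    using \<mu> by (auto dest: mset_subset_eqD)
  have "\<forall>\<nu>\<in>{\<nu>. \<nu> \<subseteq># \<mu>}. \<exists>B. finite B \<and> (\<forall>\<rho>. set_mset \<rho> \<subseteq> {X, Xi} \<longrightarrow> coef f (\<rho> + \<nu>) \<in> scaleC.span B)"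
    using assms(1) nu unfolding fd_def by blast
  then obtain A where A: "\<And>\<nu>. \<nu> \<subseteq># \<mu> \<Longrightarrow> finite (A \<nu>)"
    "\<And>\<nu> \<rho>. \<nu> \<subseteq># \<mu> \<Longrightarrow> set_mset \<rho> \<subseteq> {X, Xi} \<Longrightarrow> coef f (\<rho> + \<nu>) \<in> scaleC.span (A \<nu>)"
    unfolding bchoice_iff by blast
  have "\<forall>\<nu>\<in>{\<nu>. \<nu> \<subseteq># \<mu>}. \<exists>B. finite B \<and> (\<forall>\<rho>. set_mset \<rho> \<subseteq> {X, Xi} \<longrightarrow> coef g (\<rho> + \<nu>) \<in> scaleC.span B)"
    using assms(2) nu unfolding fd_def by blast
  then obtain B where B: "\<And>\<nu>. \<nu> \<subseteq># \<mu> \<Longrightarrow> finite (B \<nu>)"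
    "\<And>\<nu> \<rho>. \<nu> \<subseteq># \<mu> \<Longrightarrow> set_mset \<rho> \<subseteq> {X, Xi} \<Longrightarrow> coef g (\<rho> + \<nu>) \<in> scaleC.span (B \<nu>)"
    unfolding bchoice_iff by blast
  define P where "P = \<Union> (A ` {\<nu>. \<nu> \<subseteq># \<mu>})"
  define Q where "Q = \<Union> (B ` {\<nu>. \<nu> \<subseteq># \<mu>})"
  define G where "G = (\<lambda>(a, b). a * b) ` (P \<times> (Q \<union> parity_inv ` Q))"
  have "finite G" unfolding G_def P_def Q_def using A(1) B(1) finite_subset_mset[of \<mu>] by simp
  moreover have "coef (f * g) (\<rho> + \<mu>) \<in> scaleC.span G" if \<rho>: "set_mset \<rho> \<subseteq> {X, Xi}" for \<rho>
    unfolding coef_mult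
  proof (intro scaleC.span_sum scaleC.span_scale)
    fix m assume "m \<in> {m. m \<subseteq># \<rho> + \<mu>}"
    then obtain n where n: "\<rho> + \<mu> = m + n" by (auto simp: subset_mset.le_iff_add)
    \<comment> \<open>\<open>?in\<close> keeps the part of a monomial in \<open>X\<close> and
      \<open>Xi\<close>, \<open>?out\<close> the part in the times; \<open>\<mu>\<close> constrains
      the latter.\<close>
    let ?in = "filter_mset (\<lambda>v. v = X \<or> v = Xi)" and ?out = "filter_mset (\<lambda>v. \<not> (v = X \<or> v = Xi))"
    have "?out \<rho> = {#}" using \<rho> by (auto simp: filter_mset_eq_conv)
    moreover have "?out \<mu> = \<mu>" using \<mu> by (auto simp: filter_mset_eq_conv)
    ultimately have out: "\<mu> = ?out m + ?out n"
      using arg_cong[OF n, of ?out] by (simp only: filter_union_mset add_0)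
    then have sub: "?out m \<subseteq># \<mu>" "?out n \<subseteq># \<mu>" by (metis mset_subset_eq_add_left mset_subset_eq_add_right)+
    have dec: "k = ?in k + ?out k" for k :: smon by (rule multiset_partition)
    have "coef f m \<in> scaleC.span (A (?out m))"
      using A(2)[OF sub(1), of "?in m"] dec[of m] by auto
    then have f: "coef f m \<in> scaleC.span P"
      using scaleC.span_mono[of "A (?out m)" P] sub(1) unfolding P_def by blast
    have "coef g n \<in> scaleC.span (B (?out n))"
      using B(2)[OF sub(2), of "?in n"] dec[of n] by auto
    then have "coef g n \<in> scaleC.span Q"
      using scaleC.span_mono[of "B (?out n)" Q] sub(2) unfolding Q_def by blast
    then have "(parity_inv ^^ odd_count m) (coef g n) \<in> scaleC.span (Q \<union> parity_inv ` Q)"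
      by (rule span_parity_inv_funpow)
    with f show "coef f m * (parity_inv ^^ odd_count m) (coef g (\<rho> + \<mu> - m)) \<in> scaleC.span G"
      unfolding G_def n by (simp add: span_mult)
  qed
  ultimately show "\<exists>B. finite B \<and> (\<forall>\<rho>. set_mset \<rho> \<subseteq> {X, Xi} \<longrightarrow> coef (f * g) (\<rho> + \<mu>) \<in> scaleC.span B)"
    by blast
qed

lemma fd_Ds: "fd f \<Longrightarrow> fd (Ds f)"
  unfolding Ds_def by (intro fd_add fd_mult fd_var fd_pds) auto

lemma fd_Dp: "fd f \<Longrightarrow> fd (Dp r f)"
  by (induction r) (auto intro: fd_Ds)

lemma fd_chi: "fd f \<Longrightarrow> fd (chi m j f)"
  by (auto simp: chi_def tw_def intro!: fd_zero fd_sc fd_Dp fd_par)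

subsection \<open>Inverses of monic operators\<close>

definition monic :: "'a::supercommutative_superalgebra ops \<Rightarrow> bool" where
  "monic P \<longleftrightarrow> opc P 0 = 1 \<and> (\<forall>k>0. opc P k = 0)"

lemma opc_mult_high:
  assumes "\<And>k. M < k \<Longrightarrow> opc P k = 0" "\<And>k. N < k \<Longrightarrow> opc Q k = 0" "M + N < k"
  shows "opc (P * Q) k = 0"
proof (rule opc_mult_eqI[of "{}"])
  fix A assume "finite (A :: int set)"
  have "opc P a * chi a (k - b) (opc Q b) = 0" for a b
    using assms by (cases "M < a"; cases "N < b") auto
  then show "wsum A (opc P) (opc Q) k = 0" by (simp add: wsum_def)
qed simp

lemma opc_mult_low:
  assumes "\<And>k. k < 0 \<Longrightarrow> opc P k = 0" "\<And>k. k < 0 \<Longrightarrow> opc Q k = 0" "k < 0"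
  shows "opc (P * Q) k = 0"
proof (rule opc_mult_eqI[of "{}"])
  fix A assume "finite (A :: int set)"
  have "opc P a * chi a (k - b) (opc Q b) = 0" for a b
    using assms by (cases "a < 0"; cases "b < 0") (auto simp: chi_nonneg)
  then show "wsum A (opc P) (opc Q) k = 0" by (simp add: wsum_def)
qed simp

lemma monic_mult: "monic P \<Longrightarrow> monic Q \<Longrightarrow> monic (P * Q)"
proof -
  assume PQ: "monic P" "monic Q"
  have "opc (P * Q) 0 = 1"
  proof (rule opc_mult_eqI[of "{0}"])
    fix A assume A: "finite (A :: int set)" "{0} \<subseteq> A"
    have "opc P a * chi a (0 - b) (opc Q b) = (if b = 0 then if a = 0 then 1 else 0 else 0)" for a b
    proof (cases "a = 0 \<and> b = 0")
      case True
      then show ?thesis using PQ by (simp add: monic_def chi_0)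
    next
      case False
      then have "0 < a \<or> 0 < b \<or> a < - b" by linarith
      then show ?thesis using False PQ by (auto simp: monic_def)
    qed
    then show "wsum A (opc P) (opc Q) 0 = 1" using A by (simp add: wsum_def)
  qed simp
  moreover have "\<forall>k>0. opc (P * Q) k = 0"
    using PQ opc_mult_high[of 0 P 0 Q] by (simp add: monic_def)
  ultimately show ?thesis by (simp add: monic_def)
qed

text \<open>The coefficient of \<open>D^(-j)\<close> in the solution \<open>V\<close> of
  \<open>P V = 1\<close> for monic \<open>P\<close>: the unknown enters through the leading 1 of
  \<open>P\<close>, and all other terms involve earlier coefficients. The recursion uses operations
  that preserve \<open>fd\<close>.\<close>

fun inv_coeff :: "(int \<Rightarrow> 'a::supercommutative_superalgebra ser) \<Rightarrow> nat \<Rightarrow> 'a ser" where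
  "inv_coeff P j = (if j = 0 then 1
     else - (\<Sum>i<j. \<Sum>a\<in>{- int j..<0}. P a * chi a (int i - int j) (inv_coeff P i)))"

declare inv_coeff.simps [simp del]

lemma fd_inv_coeff: "(\<And>a. fd (P a)) \<Longrightarrow> fd (inv_coeff P j)"
proof (induction j rule: less_induct)
  case (less j)
  then show ?case
    by (subst inv_coeff.simps) (auto intro!: fd_one fd_minus fd_sum fd_mult fd_chi)
qed

lift_definition right_inv :: "'a::supercommutative_superalgebra ops \<Rightarrow> 'a ops"
  is "\<lambda>P n. if n \<le> 0 then inv_coeff P (nat (- n)) else 0"
  by (rule exI[of _ 0]) (simp add: bd_def xwt_nonpos)

lemma opc_right_inv: "opc (right_inv P) n = (if n \<le> 0 then inv_coeff (opc P) (nat (- n)) else 0)"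
  by (simp add: right_inv.rep_eq)

lemma monic_right_inv: "monic (right_inv P)"
  by (simp add: monic_def opc_right_inv inv_coeff.simps[of _ 0])

lemma right_inv:
  assumes "monic P" shows "P * right_inv P = 1"
proof (rule ops_eqI)
  fix k
  have m: "monic (P * right_inv P)" by (intro monic_mult assms monic_right_inv)
  show "opc (P * right_inv P) k = opc 1 k"
  proof (cases "k < 0")
    case False
    then show ?thesis using m by (cases "k = 0") (auto simp: monic_def opc_1)
  next
    case True
    define j where "j = nat (- k)"
    have k: "k = - int j" "0 < j" using True by (simp_all add: j_def)
    let ?V = "opc (right_inv P)"
    let ?t = "\<lambda>a b. opc P a * chi a (k - b) (?V b)"
    have "opc (P * right_inv P) k = 0"
    proof (rule opc_mult_eqI[of "{k..0}"])
      fix A assume A: "finite (A :: int set)" "{k..0} \<subseteq> A"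
      have t0: "?t a b = 0" if "a \<notin> {k..0} \<or> b \<notin> {k..0}" for a b
        using that assms by (cases "0 < a"; cases "0 < b"; cases "a < k - b") (auto simp: monic_def opc_right_inv)
      have "wsum A (opc P) ?V k = (\<Sum>a\<in>{k..0}. \<Sum>b\<in>A. ?t a b)"
        unfolding wsum_def using A t0 by (intro sum.mono_neutral_right) auto
      also have "\<dots> = (\<Sum>a\<in>{k..0}. \<Sum>b\<in>{k..0}. ?t a b)"
        using A t0 by (intro sum.cong refl sum.mono_neutral_right) auto
      also have "{k..0} = insert 0 {k..<0}" using True by auto
      also have "(\<Sum>a\<in>insert 0 {k..<0}. \<Sum>b\<in>insert 0 {k..<0}. ?t a b) =
          (\<Sum>b\<in>insert 0 {k..<0}. ?t 0 b) + (\<Sum>a\<in>{k..<0}. \<Sum>b\<in>insert 0 {k..<0}. ?t a b)"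
        by (subst sum.insert) auto
      also have "(\<Sum>b\<in>insert 0 {k..<0}. ?t 0 b) = (\<Sum>b\<in>insert 0 {k..<0}. if b = k then ?V b else 0)"
        using assms by (intro sum.cong refl) (auto simp: chi_0 monic_def)
      also have "\<dots> = ?V k" using True by simp
      also have "(\<Sum>a\<in>{k..<0}. \<Sum>b\<in>insert 0 {k..<0}. ?t a b) = (\<Sum>b\<in>insert 0 {k..<0}. \<Sum>a\<in>{k..<0}. ?t a b)"
        by (rule sum.swap)
      also have "\<dots> = (\<Sum>b\<in>{k<..0}. \<Sum>a\<in>{k..<0}. ?t a b)"
      proof (rule sum.mono_neutral_right)
        show "\<forall>b\<in>insert 0 {k..<0} - {k<..0}. (\<Sum>a\<in>{k..<0}. ?t a b) = 0"
          by (auto intro!: sum.neutral)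
      qed (use True in auto)
      also have "\<dots> = (\<Sum>i<j. \<Sum>a\<in>{k..<0}. ?t a (- int i))"
        by (rule sum.reindex_bij_witness[of _ "\<lambda>i. - int i" "\<lambda>b. nat (- b)"]) (auto simp: k)
      also have "\<dots> = (\<Sum>i<j. \<Sum>a\<in>{- int j..<0}. opc P a * chi a (int i - int j) (inv_coeff (opc P) i))"
        by (intro sum.cong refl) (auto simp: k opc_right_inv algebra_simps)
      also have "?V k + \<dots> = 0"
        using k by (simp add: opc_right_inv inv_coeff.simps[of _ j])
      finally show "wsum A (opc P) ?V k = 0" .
    qed simp
    then show ?thesis using True by (simp add: opc_1)
  qed
qed

lemma left_right_inverse_unique: "V * P = 1 \<Longrightarrow> P * W = 1 \<Longrightarrow> V = (W :: 'a::monoid_mult)"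
  by (metis mult.assoc mult_1_left mult_1_right)

text \<open>The right inverse is itself monic, so it has a right inverse too, and this must be
  \<open>P\<close>.\<close>

lemma right_inv_left: assumes "monic P" shows "right_inv P * P = 1"
proof -
  let ?V = "right_inv P"
  have "P * ?V = 1" "?V * right_inv ?V = 1" by (simp_all add: right_inv assms monic_right_inv)
  then have "P = right_inv ?V" by (rule left_right_inverse_unique)
  then show ?thesis using \<open>?V * right_inv ?V = 1\<close> by simp
qed

subsection \<open>The concrete operators as elements of the algebra\<close>

definition raw :: "'a::supercommutative_superalgebra ops \<Rightarrow> 'a sop" where
  "raw P = (\<lambda>n. coef (opc P n))"

lemma raw_inject: "raw P = raw Q \<longleftrightarrow> P = Q"
  by (metis raw_def ops_eqI coef_inject)

lemma raw_mult: "raw P \<otimes>\<^bsub>Ehat\<^esub> raw Q = raw (P * Q)"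
  by (simp add: raw_def Ehat_def times_ops.rep_eq mulraw.rep_eq)

lemma raw_0: "raw 0 = 0" by (intro ext) (simp add: raw_def)
lemma raw_add: "raw P + raw Q = raw (P + Q)" by (intro ext) (simp add: raw_def)
lemma raw_diff: "raw P - raw Q = raw (P - Q)" by (intro ext) (simp add: raw_def)
lemma raw_minus: "- raw P = raw (- P)" by (intro ext) (simp add: raw_def)

lemma raw_DD: "raw (DD j) = D_pow j"
  by (intro ext) (simp add: raw_def D_pow_def opc_DD one_ser.rep_eq)

lemma raw_1: "raw 1 = \<one>\<^bsub>Ehat\<^esub>"
  by (simp add: Ehat_def raw_DD[symmetric] DD_0)

lemma raw_power: "raw P [^]\<^bsub>Ehat\<^esub> (n::nat) = raw (P ^ n)"
  by (induction n) (simp_all add: nat_pow_def raw_1 raw_mult power_Suc2 del: power_Suc)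

lemma carrier_Ehat_raw:
  assumes "y \<in> carrier Ehat" obtains Y where "y = raw Y"
proof -
  obtain C where y: "\<And>n. y n \<in> coeffRt" "\<And>n m. y n m \<noteq> 0 \<Longrightarrow> int (weight m) \<ge> n - C"
    using assms by (auto simp: Ehat_def)
  have c: "coef (Ser (y n)) = y n" for n
    using y(1)[of n] unfolding coeffRt_def by (intro Ser_inverse) blast
  have "bd C (\<lambda>n. Ser (y n))"
    unfolding bd_def xwt_def c using y(2) by (meson of_nat_le_iff order_trans trans_le_add1 le_add1)
  then have "opc (Ops (\<lambda>n. Ser (y n))) = (\<lambda>n. Ser (y n))" by (auto intro!: Ops_inverse)
  then have "y = raw (Ops (\<lambda>n. Ser (y n)))" by (simp add: raw_def c)
  then show ?thesis by (rule that)
qed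

text \<open>\<open>inv\<close> in \<open>Ehat\<close> is a description over the carrier, so
  \<open>right_inv P\<close> has to be placed there, by \<open>fd_inv_coeff\<close>, and compared
  with any other candidate, which comes from \<open>ops\<close>. The parity condition becomes
  \<open>opar P = P\<close>, because \<open>D^(-j)\<close> and its coefficient have the same
  parity.\<close>

lemma Gamma0_hat_raw:
  fixes S :: "'a::supercommutative_superalgebra sop"
  assumes "S \<in> Gamma0_hat"
  obtains P where "S = raw P" "monic P" "opar P = P" "inv\<^bsub>Ehat\<^esub> S = raw (right_inv P)"
proof -
  have S: "S 0 = sser_one" "\<And>n. 0 < n \<Longrightarrow> S n = 0"
    "\<And>j::nat. 1 \<le> j \<Longrightarrow> S (- int j) \<in> coeffRt \<and> sser_homogeneous j (S (- int j))"
    using assms by (auto simp: Gamma0_hat_def monic_even_def)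
  have neg: "\<exists>j::nat. 1 \<le> j \<and> n = - int j" if "n < 0" for n
    using that by (intro exI[of _ "nat (- n)"]) auto
  have "S n m = 0" if "\<not> valid m" for n m
  proof -
    consider "n = 0" | "0 < n" | "n < 0" by linarith
    then show ?thesis
    proof cases
      case 1 then show ?thesis using S(1) that by (auto simp: sser_one_def)
    next
      case 2 then show ?thesis using S(2) by simp
    next
      case 3
      then have "S n \<in> coeffRt" using S(3) neg by blast
      then show ?thesis using that unfolding coeffRt_def by blast
    qed
  qed
  then have c: "coef (Ser (S n)) = S n" for n by (intro Ser_inverse) blast
  have s0: "Ser (S 0) = 1" using c[of 0] by (intro ser_eqI) (simp add: S(1) one_ser.rep_eq)
  have sp: "Ser (S n) = 0" if "0 < n" for n using c[of n] by (intro ser_eqI) (simp add: S(2)[OF that])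
  have "bd 0 (\<lambda>n. Ser (S n))"
    unfolding bd_def
  proof
    fix n show "xwt (n - 0) (Ser (S n))"
      by (cases "0 < n") (simp_all add: sp xwt_nonpos)
  qed
  then have o: "opc (Ops (\<lambda>n. Ser (S n))) = (\<lambda>n. Ser (S n))" by (auto intro!: Ops_inverse)
  define P where "P = Ops (\<lambda>n. Ser (S n))"
  have P: "opc P n = Ser (S n)" for n by (simp add: P_def o)
  have SP: "S = raw P" by (simp add: raw_def P c)
  have mon: "monic P" by (simp add: monic_def P s0 sp)
  have fdP: "fd (opc P n)" for n
  proof -
    consider "n = 0" | "0 < n" | "n < 0" by linarith
    then show ?thesis
    proof cases
      case 3
      then have "coef (opc P n) \<in> coeffRt" using S(3) neg by (auto simp: P c)
      then show ?thesis by (rule coeffRt_imp_fd)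
    qed (simp_all add: P s0 sp fd_one fd_zero)
  qed
  have par: "opar P = P"
  proof (rule ops_eqI)
    fix n :: int
    consider "n = 0" | "0 < n" | "n < 0" by linarith
    then show "opc (opar P) n = opc P n"
    proof cases
      case 3
      then obtain j :: nat where j: "1 \<le> j" "n = - int j" using neg by blast
      then have h: "S n m \<in> graded_part (j + odd_count m)" for m
        using S(3) by (auto simp: sser_homogeneous_def)
      show ?thesis
      proof (rule ser_eqI)
        fix m
        have "parity_inv (S n m) = (-1) ^ (j + odd_count m) *\<^sub>C S n m"
          using h[of m] parity_inv_even[of "S n m"] parity_inv_odd[of "S n m"]
          by (auto simp: graded_part_def scaleC_one split: if_splits)
        then show "coef (opc (opar P) n) m = coef (opc P n) m"
          by (simp add: opc_opar coef_par P c j(2)[symmetric] scaleC_one) (auto simp: j(2) eps_def power_add scaleC_one)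
      qed
    qed (simp_all add: opc_opar P s0 sp)
  qed
  have car: "raw (right_inv P) \<in> carrier Ehat"
  proof -
    have "raw (right_inv P) n \<in> coeffRt" for n
      using fdP by (auto simp: raw_def opc_right_inv intro!: fd_imp_coeffRt fd_inv_coeff fd_zero)
    moreover have "int (weight m) \<ge> n - 0" if "raw (right_inv P) n m \<noteq> 0" for n m
      using that by (cases "n \<le> 0") (auto simp: raw_def opc_right_inv)
    ultimately show ?thesis unfolding Ehat_def by (auto intro!: exI[of _ 0])
  qed
  have "inv\<^bsub>Ehat\<^esub> S = raw (right_inv P)"
    unfolding m_inv_def
  proof (rule the_equality)
    show "raw (right_inv P) \<in> carrier Ehat \<and> S \<otimes>\<^bsub>Ehat\<^esub> raw (right_inv P) = \<one>\<^bsub>Ehat\<^esub> \<and>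
      raw (right_inv P) \<otimes>\<^bsub>Ehat\<^esub> S = \<one>\<^bsub>Ehat\<^esub>"
      by (simp add: car SP raw_mult right_inv[OF mon] right_inv_left[OF mon] raw_1)
  next
    fix y assume y: "y \<in> carrier Ehat \<and> S \<otimes>\<^bsub>Ehat\<^esub> y = \<one>\<^bsub>Ehat\<^esub> \<and> y \<otimes>\<^bsub>Ehat\<^esub> S = \<one>\<^bsub>Ehat\<^esub>"
    then obtain Y where Y: "y = raw Y" using carrier_Ehat_raw by blast
    then have "P * Y = 1" using y by (simp add: SP raw_mult raw_inject flip: raw_1)
    then have "right_inv P = Y" by (rule left_right_inverse_unique[OF right_inv_left[OF mon]])
    then show "y = raw (right_inv P)" using Y by simp
  qed
  then show ?thesis using that SP mon par by blast
qed

lemma Gamma0_subset: "Gamma0 \<subseteq> Gamma0_hat"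
proof -
  have "f \<in> coeffRt" if f: "f \<in> coeffR" for f :: "'a sser"
  proof -
    obtain k :: nat and a \<phi> where k: "\<forall>i<k. \<phi> i \<in> C_x_xi" "f = (\<lambda>m. \<Sum>i<k. \<phi> i m *\<^sub>C a i)"
      using f unfolding coeffR_def by blast
    have sup: "valid m \<and> set_mset m \<subseteq> {X, Xi}" if nz: "f m \<noteq> 0" for m
    proof (rule ccontr)
      assume "\<not> (valid m \<and> set_mset m \<subseteq> {X, Xi})"
      then have "\<phi> i m = 0" if "i < k" for i
        using k(1) that unfolding C_x_xi_def by blast
      then have "f m = 0" unfolding k(2) by simp
      then show False using nz by contradiction
    qed
    have z: "(\<lambda>m. 0) \<in> (coeffR :: 'a sser set)" unfolding coeffR_def by (auto intro!: exI[of _ 0])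
    have "t_coeff \<mu> f \<in> coeffR" if "X \<notin># \<mu> \<and> Xi \<notin># \<mu>" for \<mu>
    proof (cases "\<mu> = {#}")
      case True
      then have "t_coeff \<mu> f = f" using sup by (auto simp: t_coeff_def fun_eq_iff)
      then show ?thesis using f by simp
    next
      case False
      then obtain v where v: "v \<in># \<mu>" by auto
      have "f (\<rho> + \<mu>) = 0" for \<rho>
        using sup[of "\<rho> + \<mu>"] v that by auto
      then have "t_coeff \<mu> f = (\<lambda>m. 0)" by (auto simp: t_coeff_def fun_eq_iff)
      then show ?thesis using z by simp
    qed
    then show ?thesis using sup unfolding coeffRt_def by blast
  qed
  then show ?thesis unfolding Gamma0_def Gamma0_hat_def monic_even_def by blast
qed

lemma Gamma0_opd:
  assumes "raw P \<in> Gamma0" shows "opd s n P = 0"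
proof (intro ops_eqI ser_eqI)
  fix k m
  have P: "raw P 0 = sser_one" "\<And>n. 0 < n \<Longrightarrow> raw P n = 0" "\<And>j::nat. 1 \<le> j \<Longrightarrow> raw P (- int j) \<in> coeffR"
    using assms by (auto simp: Gamma0_def monic_even_def)
  have "raw P k (add_mset (T s n) m) = 0"
  proof -
    consider "k = 0" | "0 < k" | "k < 0" by linarith
    then show ?thesis
    proof cases
      case 3
      then have "raw P k \<in> coeffR" using P(3)[of "nat (- k)"] by auto
      then obtain l :: nat and a \<phi> where l: "\<forall>i<l. \<phi> i \<in> C_x_xi" "raw P k = (\<lambda>m. \<Sum>i<l. \<phi> i m *\<^sub>C a i)"
        unfolding coeffR_def by blast
      have "\<phi> i (add_mset (T s n) m) = 0" if "i < l" for i
        using l(1) that unfolding C_x_xi_def by fastforce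
      then show ?thesis unfolding l(2) by simp
    qed (simp_all add: P sser_one_def)
  qed
  then show "coef (opc (opd s n P) k) m = coef (opc 0 k) m"
    by (simp add: opc_opd coef_pds raw_def parity_inv_funpow_zero)
qed

subsection \<open>The Grassmann equation\<close>

lift_definition oneg :: "'a::supercommutative_superalgebra ops \<Rightarrow> 'a ops" is "\<lambda>P n. if n < 0 then P n else 0"
  by (auto simp: bd_def)

lemma opc_oneg: "opc (oneg P) n = (if n < 0 then opc P n else 0)"
  by (simp add: oneg.rep_eq)

lemma raw_oneg: "neg_part (raw P) = raw (oneg P)"
  by (intro ext) (simp add: neg_part_def raw_def opc_oneg)

text \<open>Since \<open>W = 1\<close> up to positive weight, the lowest weight part of \<open>Z\<close> is that of \<open>Z W\<close>.\<close>

lemma negative_eq_zero: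
  assumes W: "wto 1 (W - 1)" and Z: "\<And>k. 0 \<le> k \<Longrightarrow> opc Z k = 0"
    and ZW: "\<And>k. k < 0 \<Longrightarrow> opc (Z * W) k = 0"
  shows "Z = 0"
proof (rule wto_all_zero)
  fix w show "wto w Z"
  proof (induction w)
    case (Suc w)
    have "wto (w + 1) (Z * (W - 1))" by (rule wto_mult[OF Suc W])
    then have "wt (Suc w) (opc (Z * W) k - opc Z k)" for k
      by (simp add: wto_def right_diff_distrib)
    then have "wt (Suc w) (opc Z k)" for k
      using Z[of k] ZW[of k] wt_minus[of "Suc w" "opc (Z * W) k - opc Z k"]
      by (cases "0 \<le> k") fastforce+
    then show ?case by (simp add: wto_def)
  qed simp
qed

text \<open>Stated for an abstract \<open>\<delta>\<close>, since the odd and even flows obey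
  different product rules. What enters is the value of \<open>\<delta>\<close> on
  \<open>S * E * Q\<close> and that it kills the coefficients 0 and 1. The latter leaves
  \<open>\<delta> (S * E * Q)\<close> without a negative part and \<open>\<delta> S\<close> with
  negative powers only.\<close>

lemma Grassmann_flow:
  assumes S: "monic S" "S * V = 1" "V * S = 1" "monic V" and Q: "monic Q"
    and E: "wto 1 (E - 1)"
    and W: "oneg (S * E * Q) = 0"
    and \<delta>: "\<delta> (S * E * Q) = (\<delta> S + S * g) * E * Q"
    and \<delta>0: "\<And>P k. opc P k = 0 \<or> opc P k = 1 \<Longrightarrow> opc (\<delta> P) k = 0"
  shows "\<delta> S = - (oneg (S * g * V) * S)"
proof -
  let ?W = "S * E * Q"
  have Wneg: "opc ?W k = 0" if "k < 0" for k
    using opc_oneg[of ?W k] that W by simp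
  have "?W - S * Q = S * (E - 1) * Q" by (simp add: algebra_simps)
  moreover have "wto 1 (S * (E - 1) * Q)" by (intro wto_mult_left wto_mult_right E)
  ultimately have w1: "wt 1 (opc ?W k - opc (S * Q) k)" for k unfolding wto_def by (metis opc_diff)
  \<comment> \<open>Modulo positive weight \<open>?W\<close> is the monic operator
    \<open>S * Q\<close>, which settles the powers \<open>k \<ge> 0\<close>; for
    \<open>k < 0\<close> the Grassmann equation makes the coefficients zero.\<close>
  have "wto 1 (?W - 1)"
    unfolding wto_def
  proof
    fix k show "wt 1 (opc (?W - 1) k)"
    proof (cases "k < 0")
      case True
      then show ?thesis by (simp add: Wneg opc_1)
    next
      case False
      then have "opc (S * Q) k = opc 1 k"
        using monic_mult[OF S(1) Q] by (cases "k = 0") (simp_all add: monic_def opc_1)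
      then show ?thesis using w1[of k] by simp
    qed
  qed
  define Y where "Y = (\<delta> S + S * g) * V"
  have "Y * ?W = (\<delta> S + S * g) * (V * S) * E * Q" unfolding Y_def by (simp only: mult.assoc)
  then have YW: "Y * ?W = \<delta> ?W" by (simp add: S(3) \<delta>)
  have "oneg Y = 0"
  proof (rule negative_eq_zero[OF \<open>wto 1 (?W - 1)\<close>])
    fix k :: int assume "k < 0"
    \<comment> \<open>Neither factor has negative powers, hence neither has the product; so
      \<open>oneg Y * ?W\<close> has the same negative part as \<open>\<delta> ?W\<close>, namely
      zero.\<close>
    have "opc ((Y - oneg Y) * ?W) k = 0"
      by (rule opc_mult_low[OF _ Wneg \<open>k < 0\<close>]) (simp add: opc_oneg)
    moreover have "opc (\<delta> ?W) k = 0" using \<delta>0 Wneg[OF \<open>k < 0\<close>] by blast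
    ultimately show "opc (oneg Y * ?W) k = 0" by (simp add: left_diff_distrib YW)
  qed (simp add: opc_oneg)
  have dS: "opc (\<delta> S) k = 0" if "- 1 < k" for k
    using that S(1) \<delta>0[of S k] by (cases "k = 0") (auto simp: monic_def)
  \<comment> \<open>As \<open>V\<close> is monic, \<open>\<delta> S * V\<close> has only negative
    powers and equals its own negative part.\<close>
  have "opc (\<delta> S * V) k = 0" if "0 \<le> k" for k
    by (rule opc_mult_high[of "-1" _ 0]) (use that dS S(4) in \<open>auto simp: monic_def\<close>)
  then have "oneg Y = \<delta> S * V + oneg (S * g * V)"
    by (intro ops_eqI) (auto simp: opc_oneg Y_def distrib_right)
  then have "\<delta> S * V = - oneg (S * g * V)"
    using \<open>oneg Y = 0\<close> by (simp add: eq_neg_iff_add_eq_0)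
  then have "\<delta> S * (V * S) = - oneg (S * g * V) * S" by (simp only: mult.assoc[symmetric])
  then show ?thesis by (simp add: S(3))
qed

lemma opc_tv_mult: "opc (tv s n * P) k = var (T s n) * opc P k"
  by (simp add: tv_def opc_cofo_mult)

lemma opc_flow_zero:
  assumes "\<And>s n. pds (T s n) (opc P k) = 0"
  shows "opc (flow_odd s n P) k = 0" "opc (flow_even s n P) k = 0"
proof -
  have "opc (sum_odd s n P) k = 0"
    by (rule ser_eqI) (simp add: sum_odd(2) opc_tv_mult opc_opd assms)
  then show "opc (flow_odd s n P) k = 0" by (simp add: flow_odd_def opc_opd assms)
  have "opc (sum_even n P) k = 0"
    by (rule ser_eqI) (simp add: sum_even(2) opc_tv_mult opc_opd assms)
  then show "opc (flow_even s n P) k = 0" by (simp add: flow_even_def opc_opd assms)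
qed

lemma opc_flow_zero':
  assumes "opc P k = 0 \<or> opc P k = 1"
  shows "opc (flow_odd s n P) k = 0" "opc (flow_even s n P) k = 0"
  using assms by (intro opc_flow_zero; auto)+

lemma flow_zero:
  assumes "\<And>s n. opd s n P = 0"
  shows "flow_odd s n P = 0" "flow_even s n P = 0"
proof -
  have "pds (T s n) (opc P k) = 0" for s n k
    using assms[of s n] by (metis opc_opd opc_0)
  then show "flow_odd s n P = 0" "flow_even s n P = 0"
    by (auto intro!: ops_eqI simp: opc_flow_zero)
qed

lemma opar_evol: "opar evol = evol"
  by (simp add: evol_def opar_mult op_exp_opar[OF wto_Hodd Hodd(2) opar_Hodd] op_exp_opar[OF wto_Heven Heven(2) opar_Heven])

lemma wto_evol: "wto 1 (evol - 1)"
proof -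
  have "evol - 1 = (op_exp Hodd - 1) * op_exp Heven + (op_exp Heven - 1 :: 'a ops)"
    by (simp add: evol_def algebra_simps)
  moreover have "wto 1 \<dots>"
    by (intro wto_add wto_mult_left op_exp_minus_one wto_Hodd wto_Heven Hodd(2) Heven(2))
  ultimately show ?thesis by (simp only:)
qed

lemma flows:
  fixes S S0 :: "'a::supercommutative_superalgebra ops"
  assumes S: "monic S" "opar S = S" and S0: "monic S0" "opar S0 = S0" "\<And>s n. opd s n S0 = 0"
    and W: "oneg (S * evol * right_inv S0) = 0"
  shows "flow_odd s n S = - (oneg (S * gen_odd s n * right_inv S) * S)"
    and "1 \<le> n \<Longrightarrow> flow_even s n S = - (oneg (S * gen_even s n * right_inv S) * S)"
proof -
  let ?T = "right_inv S0"
  have inv0: "?T * S0 = 1" "S0 * ?T = 1" using S0 by (simp_all add: right_inv right_inv_left)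
  have one: "flow_odd s n 1 = (0 :: 'a ops)" "flow_even s n 1 = (0 :: 'a ops)" for s n
    by (simp_all add: flow_zero)
  have cancel: "Q = 0" if "S0 * Q = 0" for Q
  proof -
    have "Q = ?T * (S0 * Q)" by (simp add: inv0 flip: mult.assoc)
    then show ?thesis by (simp add: that)
  qed
  \<comment> \<open>Apply the flow to \<open>S0 * ?T = 1\<close>: it kills \<open>S0\<close> and 1,
    so \<open>S0\<close> times the flow of \<open>?T\<close> is zero, and \<open>S0\<close> is
    invertible.\<close>
  have T: "flow_odd s n ?T = 0" "flow_even s n ?T = 0" for s n
    using flow_odd_mult[of s n S0 ?T] flow_even_mult[of s n S0 ?T]
    by (auto intro!: cancel simp: inv0 one S0 flow_zero)
  have "flow_odd s n (S * evol * ?T) = (flow_odd s n S + S * gen_odd s n) * evol * ?T"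
    by (simp add: flow_odd_mult T flow_odd_evol S(2) opar_mult opar_evol algebra_simps)
  then show "flow_odd s n S = - (oneg (S * gen_odd s n * right_inv S) * S)"
    by (intro Grassmann_flow[OF S(1) right_inv[OF S(1)] right_inv_left[OF S(1)] monic_right_inv
          monic_right_inv wto_evol W] opc_flow_zero')
  assume n: "1 \<le> n"
  have "flow_even s n (S * evol * ?T) = (flow_even s n S + S * gen_even s n) * evol * ?T"
    using n by (simp add: flow_even_mult T flow_even_evol algebra_simps)
  then show "flow_even s n S = - (oneg (S * gen_even s n * right_inv S) * S)"
    by (intro Grassmann_flow[OF S(1) right_inv[OF S(1)] right_inv_left[OF S(1)] monic_right_inv
          monic_right_inv wto_evol W] opc_flow_zero')
qed

section \<open>The operators and flows of the statement as images under \<open>raw\<close>\<close>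

lemma raw_xi: "xi_op = raw xi"
  by (intro ext) (simp add: xi_op_def sop_coeff_def raw_def xi_def opc_cofo var.rep_eq)

lemma raw_dx: "dx_op = raw (DD 2)"
  by (simp add: dx_op_def raw_DD)

lemma raw_dxi: "dxi_op = raw dxi"
  by (simp only: dxi_op_def dxi_def raw_xi raw_diff[symmetric] raw_mult[symmetric] raw_DD)

lemma raw_tv: "1 \<le> n \<Longrightarrow> t_op s n = raw (tv s n)"
  by (intro ext) (simp add: t_op_def sop_coeff_def raw_def tv_def opc_cofo var.rep_eq valid_single)

lemma raw_Hodd: "H_odd = raw Hodd"
proof -
  have "t_op Plus (2*n+1) \<otimes>\<^bsub>Ehat\<^esub> (dxi_op \<otimes>\<^bsub>Ehat\<^esub> dx_op [^]\<^bsub>Ehat\<^esub> n)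
    + t_op Minus (2*n+1) \<otimes>\<^bsub>Ehat\<^esub> (xi_op \<otimes>\<^bsub>Ehat\<^esub> dx_op [^]\<^bsub>Ehat\<^esub> (n+1)) = raw (h_odd n :: 'a ops)" for n
    by (simp add: raw_xi raw_dx raw_dxi raw_tv raw_power raw_mult raw_add h_odd_def gen_odd_def power_Suc2 del: power_Suc)
  then show ?thesis
    unfolding H_odd_def sop_sum_def sser_sum_def by (intro ext) (simp add: raw_def Hodd(3))
qed

lemma raw_Heven: "H_even = raw Heven"
proof -
  have "(if n \<ge> 1 then
      t_op Plus (2*n) \<otimes>\<^bsub>Ehat\<^esub> (dxi_op \<otimes>\<^bsub>Ehat\<^esub> xi_op \<otimes>\<^bsub>Ehat\<^esub> dx_op [^]\<^bsub>Ehat\<^esub> n)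
    + t_op Minus (2*n) \<otimes>\<^bsub>Ehat\<^esub> (xi_op \<otimes>\<^bsub>Ehat\<^esub> dxi_op \<otimes>\<^bsub>Ehat\<^esub> dx_op [^]\<^bsub>Ehat\<^esub> n)
    else 0) = raw (h_even n :: 'a ops)" for n
    by (simp add: raw_xi raw_dx raw_dxi raw_tv raw_power raw_mult raw_add raw_0 h_even_def gen_even_def)
  then show ?thesis
    unfolding H_even_def sop_sum_def sser_sum_def by (intro ext) (simp add: raw_def Heven(3))
qed

lemma raw_Ex:
  assumes "wto 1 H" "bd 0 (opc H)" shows "sop_exp (raw H) = raw (op_exp H)"
  unfolding sop_exp_def sop_sum_def sser_sum_def raw_power
  by (intro ext) (simp add: raw_def op_exp_coef[OF assms] sop_scale_def sser_scale_def)

lemma raw_evol: "U_M = raw evol"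
  by (simp add: U_M_def evol_def raw_Hodd raw_Heven raw_Ex[OF wto_Hodd Hodd(2)] raw_Ex[OF wto_Heven Heven(2)] raw_mult)

lemma coef_var_mult: "1 \<le> n \<Longrightarrow> coef (var (T s n) * f) = sser_var (T s n) \<star> coef f"
  by (simp add: times_ser.rep_eq var.rep_eq valid_single)

lemma raw_flow_odd: "tD_odd s n \<circ> raw P = raw (flow_odd s n P)"
proof (intro ext)
  fix k \<mu>
  have "sser_var (T (opp s) (2*m+1)) \<star> (pd (T Plus (2*(n+m+1))) (coef (opc P k)) + pd (T Minus (2*(n+m+1))) (coef (opc P k)))
     = coef (opc (tv (opp s) (2*m+1) * (opd Plus (2*(n+m+1)) P + opd Minus (2*(n+m+1)) P)) k)" for m
  proof -
    have "pd (T Plus (2*(n+m+1))) (coef (opc P k)) + pd (T Minus (2*(n+m+1))) (coef (opc P k)) =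
      coef (pds (T Plus (2*(n+m+1))) (opc P k) + pds (T Minus (2*(n+m+1))) (opc P k))"
      by (intro ext) (simp add: pds.rep_eq)
    then show ?thesis by (simp only: opc_tv_mult opc_add opc_opd coef_var_mult le_add2)
  qed
  then show "(tD_odd s n \<circ> raw P) k \<mu> = raw (flow_odd s n P) k \<mu>"
    by (simp add: tD_odd_def raw_def flow_odd_def opc_opd pds.rep_eq sser_scale_def sser_sum_def sum_odd(2))
qed

lemma raw_flow_even: "tD_even s n \<circ> raw P = raw (flow_even s n P)"
proof (intro ext)
  fix k \<mu>
  have "sser_var (T Plus (2*m+1)) \<star> pd (T Plus (2*(n+m)+1)) (coef (opc P k))
         - sser_var (T Minus (2*m+1)) \<star> pd (T Minus (2*(n+m)+1)) (coef (opc P k))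
     = coef (opc (tv Plus (2*m+1) * opd Plus (2*(n+m)+1) P - tv Minus (2*m+1) * opd Minus (2*(n+m)+1) P) k)" for m
    by (intro ext) (simp only: opc_tv_mult opc_diff opc_opd coef_diff coef_var_mult le_add2 pds.rep_eq fun_diff_def)
  then show "(tD_even s n \<circ> raw P) k \<mu> = raw (flow_even s n P) k \<mu>"
    by (simp add: tD_even_def raw_def flow_even_def opc_opd pds.rep_eq sser_scale_def sser_sum_def sum_even(2) ssgn_def)
qed

theorem mainTheorem1:
  fixes S0 S :: "'a::supercommutative_superalgebra sop"
  assumes "S0 \<in> Gamma0"
    and "S \<in> Gamma0_hat"
    and "neg_part (S \<otimes>\<^bsub>Ehat\<^esub> U_M \<otimes>\<^bsub>Ehat\<^esub> inv\<^bsub>Ehat\<^esub> S0) = 0"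
  shows "(\<forall>n::nat. tD_odd Plus n \<circ> S
           = - (neg_part (S \<otimes>\<^bsub>Ehat\<^esub> dxi_op \<otimes>\<^bsub>Ehat\<^esub> dx_op [^]\<^bsub>Ehat\<^esub> n \<otimes>\<^bsub>Ehat\<^esub> inv\<^bsub>Ehat\<^esub> S) \<otimes>\<^bsub>Ehat\<^esub> S))
       \<and> (\<forall>n::nat. tD_odd Minus n \<circ> S
           = - (neg_part (S \<otimes>\<^bsub>Ehat\<^esub> xi_op \<otimes>\<^bsub>Ehat\<^esub> dx_op [^]\<^bsub>Ehat\<^esub> (n + 1) \<otimes>\<^bsub>Ehat\<^esub> inv\<^bsub>Ehat\<^esub> S) \<otimes>\<^bsub>Ehat\<^esub> S))
       \<and> (\<forall>n\<ge>1::nat. tD_even Plus n \<circ> S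
           = - (neg_part (S \<otimes>\<^bsub>Ehat\<^esub> dxi_op \<otimes>\<^bsub>Ehat\<^esub> xi_op \<otimes>\<^bsub>Ehat\<^esub> dx_op [^]\<^bsub>Ehat\<^esub> n \<otimes>\<^bsub>Ehat\<^esub> inv\<^bsub>Ehat\<^esub> S) \<otimes>\<^bsub>Ehat\<^esub> S))
       \<and> (\<forall>n\<ge>1::nat. tD_even Minus n \<circ> S
           = - (neg_part (S \<otimes>\<^bsub>Ehat\<^esub> xi_op \<otimes>\<^bsub>Ehat\<^esub> dxi_op \<otimes>\<^bsub>Ehat\<^esub> dx_op [^]\<^bsub>Ehat\<^esub> n \<otimes>\<^bsub>Ehat\<^esub> inv\<^bsub>Ehat\<^esub> S) \<otimes>\<^bsub>Ehat\<^esub> S))"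
proof -
  obtain P where P: "S = raw P" "monic P" "opar P = P" "inv\<^bsub>Ehat\<^esub> S = raw (right_inv P)"
    using Gamma0_hat_raw[OF assms(2)] by blast
  obtain P0 where P0: "S0 = raw P0" "monic P0" "opar P0 = P0" "inv\<^bsub>Ehat\<^esub> S0 = raw (right_inv P0)"
    using Gamma0_hat_raw[of S0] Gamma0_subset assms(1) by blast
  have opd: "opd s n P0 = 0" for s n
    using assms(1) unfolding P0(1) by (rule Gamma0_opd)
  have "raw (oneg (P * evol * right_inv P0)) = raw 0"
    using assms(3) unfolding P0(4) unfolding P(1) by (simp add: raw_evol raw_mult raw_oneg raw_0)
  then have W: "oneg (P * evol * right_inv P0) = 0" unfolding raw_inject .
  note flows = flows[OF P(2,3) P0(2,3) opd W]
  show ?thesis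
    unfolding P(4) unfolding P(1)
    using flows(1)[of Plus] flows(1)[of Minus] flows(2)[of _ Plus] flows(2)[of _ Minus]
    by (simp add: raw_xi raw_dx raw_dxi raw_power raw_mult raw_oneg raw_minus raw_flow_odd raw_flow_even raw_inject
        gen_odd_def gen_even_def mult.assoc power_Suc2 del: power_Suc)
qed

end
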